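(* Let $n=3$ and let $k$ be a domain. Let $\mathbf{w}=(w_1,w_2,w_3)\in(\Gamma_+)^3$ and $(d_1,d_2,d_3)\in\mathrm{mdeg}_{\mathbf{w}}(\mathrm{Aut}_k\,k[\mathbf{x}])$ be such that at least two of $d_1,d_2,d_3$ are not greater than $\max\{w_1,w_2,w_3\}$. Then $(d_1,d_2,d_3)$ belongs to $|\mathrm{E}_3^{\mathbf{w}}|$.
   Context: $\Gamma$ is a totally ordered additive group, i.e. an additive (abelian) group with a total ordering such that $\alpha\leq\beta$ implies $\alpha+\gamma\leq\beta+\gamma$; $\Gamma_+=\{\gamma\in\Gamma\mid\gamma>0\}$. Commutative rings have a nonzero identity. For a commutative ring $\kappa$, write $\kappa[\mathbf{x}]=\kappa[x_1,\ldots,x_n]$, and for a $\kappa$-algebra automorphism $F\in\mathrm{Aut}_\kappa\,\kappa[\mathbf{x}]$ write $F=(f_1,\ldots,f_n)$ with $f_i=F(x_i)$. For $\mathbf{w}\in\Gamma^n$ and nonzero $f\in\kappa[\mathbf{x}]$, $\deg_{\mathbf{w}}f$ is the maximum of $\sum_ia_iw_i$ over monomials $x_1^{a_1}\cdots x_n^{a_n}$ appearing in $f$ with nonzero coefficient, and $f^{\mathbf{w}}$ is the sum of the terms of $f$ attaining this maximum. $\mathrm{mdeg}_{\mathbf{w}}F=(\deg_{\mathbf{w}}f_1,\ldots,\deg_{\mathbf{w}}f_n)$, and $\mathrm{mdeg}_{\mathbf{w}}S=\{\mathrm{mdeg}_{\mathbf{w}}F\mid F\in S\}$ for a set $S$ of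 automorphisms. $F$ is elementary if there exist $1\leq l\leq n$, $a\in\kappa^\times$ and $p\in\kappa[\{x_i\mid i\neq l\}]$ with $f_l=ax_l+p$ and $f_i=x_i$ for $i\neq l$. $\mathrm{E}_n(\kappa)$ is the subgroup of $\mathrm{Aut}_\kappa\,\kappa[\mathbf{x}]$ generated by all elementary automorphisms, $\mathrm{Aut}_\kappa^{\mathbf{w}}\kappa[\mathbf{x}]$ is the set of $F\in\mathrm{Aut}_\kappa\,\kappa[\mathbf{x}]$ such that $f_1^{\mathbf{w}},\ldots,f_n^{\mathbf{w}}$ are nonzero divisors (i.e. not zero divisors) of $\kappa[\mathbf{x}]$, and $\mathrm{E}_n^{\mathbf{w}}(\kappa)=\mathrm{E}_n(\kappa)\cap\mathrm{Aut}_\kappa^{\mathbf{w}}\kappa[\mathbf{x}]$. Finally $|\mathrm{E}_n^{\mathbf{w}}|=\bigcap_\kappa\mathrm{mdeg}_{\mathbf{w}}\mathrm{E}_n^{\mathbf{w}}(\kappa)$, where $\kappa$ runs through all commutative rings. *)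

theory Defs
  imports
    "HOL-Library.Poly_Mapping"
    "HOL-Library.Numeral_Type"
    "HOL-Algebra.Generated_Groups"
begin

text \<open>Polynomials over \<open>'r\<close> in variables indexed by the finite type \<open>'n\<close>: finitely supported
  maps from exponent vectors to coefficients. Multiplication on \<open>poly_mapping\<close> is convolution.\<close>

type_synonym 'n mon = "('n, nat) poly_mapping"
type_synonym ('n, 'r) mpol = "('n mon, 'r) poly_mapping"

definition mconst :: "'r \<Rightarrow> ('n::finite, 'r::comm_ring_1) mpol" where
  "mconst c = Poly_Mapping.single 0 c"

definition mvar :: "'n \<Rightarrow> ('n::finite, 'r::comm_ring_1) mpol" where
  "mvar i = Poly_Mapping.single (Poly_Mapping.single i 1) 1"

text \<open>The weight \<open>\<Sum>i. a\<^sub>i w\<^sub>i\<close> of a monomial; the inner sum is the \<open>a\<^sub>i\<close>-fold multiple of \<open>w\<^sub>i\<close>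
  in the additive group.\<close>

definition mon_weight :: "('n::finite \<Rightarrow> 'g::linordered_ab_group_add) \<Rightarrow> 'n mon \<Rightarrow> 'g" where
  "mon_weight w m = (\<Sum>i\<in>UNIV. \<Sum>_<Poly_Mapping.lookup m i. w i)"

text \<open>Only meaningful for nonzero polynomials (otherwise a maximum over the empty set).\<close>

definition wdeg ::
  "('n::finite \<Rightarrow> 'g::linordered_ab_group_add) \<Rightarrow> ('n, 'r::comm_ring_1) mpol \<Rightarrow> 'g" where
  "wdeg w f = Max (mon_weight w ` Poly_Mapping.keys f)"

definition init_form ::
  "('n::finite \<Rightarrow> 'g::linordered_ab_group_add) \<Rightarrow> ('n, 'r::comm_ring_1) mpol \<Rightarrow> ('n, 'r) mpol" where
  "init_form w f =
     (\<Sum>m \<in> {m \<in> Poly_Mapping.keys f. mon_weight w m = wdeg w f}.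
        Poly_Mapping.single m (Poly_Mapping.lookup f m))"

definition nonzero_divisor :: "'a::comm_ring_1 \<Rightarrow> bool" where
  "nonzero_divisor f \<longleftrightarrow> (\<forall>g. f * g = 0 \<longrightarrow> g = 0)"

definition poly_auts :: "(('n::finite, 'r::comm_ring_1) mpol \<Rightarrow> ('n, 'r) mpol) set" where
  "poly_auts = {F. bij F \<and>
     (\<forall>p q. F (p + q) = F p + F q) \<and>
     (\<forall>p q. F (p * q) = F p * F q) \<and>
     (\<forall>c. F (mconst c) = mconst c)}"

definition poly_aut_group :: "(('n::finite, 'r::comm_ring_1) mpol \<Rightarrow> ('n, 'r) mpol) monoid" where
  "poly_aut_group = \<lparr>carrier = poly_auts, mult = (\<circ>), one = id\<rparr>"

lemma group_poly_aut_group: "group poly_aut_group"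
proof (rule groupI)
  fix F :: "('n::finite, 'r::comm_ring_1) mpol \<Rightarrow> ('n, 'r) mpol"
  assume "F \<in> carrier poly_aut_group"
  then have F: "bij F" "\<And>p q. F (p + q) = F p + F q"
      "\<And>p q. F (p * q) = F p * F q" "\<And>c. F (mconst c) = mconst c"
    by (auto simp: poly_aut_group_def poly_auts_def)
  have surj: "\<And>y. F (inv_into UNIV F y) = y"
    using F(1) by (simp add: bij_is_surj surj_f_inv_f)
  have inj: "\<And>x. inv_into UNIV F (F x) = x"
    using F(1) by (simp add: bij_is_inj inv_f_f)
  have "inv_into UNIV F (p + q) = inv_into UNIV F p + inv_into UNIV F q" for p q
    by (metis F(2) surj inj)
  moreover have "inv_into UNIV F (p * q) = inv_into UNIV F p * inv_into UNIV F q" for p q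
    by (metis F(3) surj inj)
  moreover have "inv_into UNIV F (mconst c) = mconst c" for c
    by (metis F(4) inj)
  moreover have "inv_into UNIV F \<circ> F = id"
    using inj by auto
  ultimately show "\<exists>G\<in>carrier poly_aut_group. G \<otimes>\<^bsub>poly_aut_group\<^esub> F = \<one>\<^bsub>poly_aut_group\<^esub>"
    using F(1) by (intro bexI[of _ "inv_into UNIV F"])
      (auto simp: poly_aut_group_def poly_auts_def bij_imp_bij_inv)
qed (auto simp: poly_aut_group_def poly_auts_def bij_comp o_assoc)

definition elementary :: "(('n::finite, 'r::comm_ring_1) mpol \<Rightarrow> ('n, 'r) mpol) \<Rightarrow> bool" where
  "elementary F \<longleftrightarrow> F \<in> poly_auts \<and>
     (\<exists>l a p. a dvd 1 \<and>
        (\<forall>m \<in> Poly_Mapping.keys p. Poly_Mapping.lookup m l = 0) \<and>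
        F (mvar l) = mconst a * mvar l + p \<and>
        (\<forall>i. i \<noteq> l \<longrightarrow> F (mvar i) = mvar i))"

definition elem_auts :: "(('n::finite, 'r::comm_ring_1) mpol \<Rightarrow> ('n, 'r) mpol) set" where
  "elem_auts = generate poly_aut_group {F. elementary F}"

definition poly_auts_w ::
  "('n::finite \<Rightarrow> 'g::linordered_ab_group_add) \<Rightarrow>
   (('n, 'r::comm_ring_1) mpol \<Rightarrow> ('n, 'r) mpol) set" where
  "poly_auts_w w = {F \<in> poly_auts. \<forall>i. nonzero_divisor (init_form w (F (mvar i)))}"

definition elem_auts_w ::
  "('n::finite \<Rightarrow> 'g::linordered_ab_group_add) \<Rightarrow>
   (('n, 'r::comm_ring_1) mpol \<Rightarrow> ('n, 'r) mpol) set" where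
  "elem_auts_w w = elem_auts \<inter> poly_auts_w w"

definition mdeg ::
  "('n::finite \<Rightarrow> 'g::linordered_ab_group_add) \<Rightarrow>
   (('n, 'r::comm_ring_1) mpol \<Rightarrow> ('n, 'r) mpol) \<Rightarrow> 'n \<Rightarrow> 'g" where
  "mdeg w F = (\<lambda>i. wdeg w (F (mvar i)))"

text \<open>Membership in the intersection of \<open>mdeg w ` elem_auts_w w\<close> over all commutative rings is
  expressed by leaving the coefficient type \<open>'r::comm_ring_1\<close> of \<open>elem_auts_w\<close> a free type variable
  of the theorem, independent of every other type in it. Such a quantification over types cannot
  occur inside a definition.\<close>

end

theory Submission
  imports
    Defs
    "HOL-Algebra.Algebraic_Closure_Type"
    "HOL-Computational_Algebra.Fraction_Field"
begin

text \<open>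
  Write x, y, z for the variables, and rename them so that z has the largest weight. Let f and g be
  two components of degree at most the weight of z, and h the third. The domain is embedded in an
  algebraically closed field K, which changes no degree.

  A monomial containing z and weighing at most as much as z is z itself. So f and g are sums of a
  multiple of z and a polynomial in x and y. If z occurs in neither, then (f, g) is an
  automorphism of K[x,y] and h = c z + r with r in K[x,y] (\<open>triangular_case\<close>). Otherwise z occurs
  in f, say, and f can be made the new variable z without changing degrees; after subtracting a
  multiple of f from g, setting z to 0 in g and h gives an automorphism of K[x,y], and h differs
  from its value at z = 0 by a multiple of z in K[g,z] (\<open>slanted_case\<close>). In both cases the degrees
  of all components are expressed by the degrees of an automorphism of K[x,y].

  Hence everything rests on the pairs of weighted degrees of automorphisms of K[x,y], in any
  characteristic (\<open>planar_automorphism_degrees\<close>): up to order they are the two weights, or one is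
  a multiple of the other and the smaller one is the degree of a simple kind of coordinate. This
  is a weighted form of the Jung--van der Kulk theorem. A coordinate f is fixed by the translation
  of the second coordinate by a parameter, a homomorphism from K[x,y] to K[x,y,z] that is the
  identity at z = 0. Taking top components for suitable weights yields a homomorphism of the same
  kind, not the inclusion, that fixes the initial form of f (\<open>graded_slide\<close>). Polynomials fixed by
  it have only fixed factors, and two different irreducible homogeneous forms cannot both be
  fixed; so the initial form of f is a power of one irreducible form, which is x, y or
  \<open>x^a - c y^b\<close>. A comparison of the partial derivatives and degrees shows that a or b is 1
  (\<open>binomial_rigidity\<close>, \<open>coordinate_initial_form\<close>). Applying this once to the automorphism and
  once to its inverse, with the degrees of the components as weights, gives the divisibility of
  degrees.

  Conversely, all these degrees are attained over every ring by adding monomials in some components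
  to another one, always so that the initial form stays a monomial with coefficient 1 and
  therefore a nonzero divisor (\<open>realizable_triangular\<close>, \<open>realizable_slanted\<close>).
\<close>

section \<open>Ring morphisms\<close>

abbreviation (input) "lookup \<equiv> Poly_Mapping.lookup"
abbreviation (input) "keys \<equiv> Poly_Mapping.keys"
abbreviation (input) "single \<equiv> Poly_Mapping.single"

definition ring_morph :: "('a::comm_ring_1 \<Rightarrow> 'b::comm_ring_1) \<Rightarrow> bool" where
  "ring_morph h \<longleftrightarrow> h 1 = 1 \<and> (\<forall>a b. h (a + b) = h a + h b) \<and> (\<forall>a b. h (a * b) = h a * h b)"

lemma ring_morphI:
  "h 1 = 1 \<Longrightarrow> (\<And>a b. h (a + b) = h a + h b) \<Longrightarrow> (\<And>a b. h (a * b) = h a * h b) \<Longrightarrow> ring_morph h"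
  by (simp add: ring_morph_def)

lemma
  assumes "ring_morph h"
  shows ring_morph_1: "h 1 = 1" and ring_morph_add: "h (a + b) = h a + h b"
    and ring_morph_mult: "h (a * b) = h a * h b"
    and ring_morph_0: "h 0 = 0" and ring_morph_uminus: "h (- a) = - h a"
    and ring_morph_diff: "h (a - b) = h a - h b"
proof -
  show add: "h (a + b) = h a + h b" for a b using assms by (simp add: ring_morph_def)
  show "h 1 = 1" "h (a * b) = h a * h b" using assms by (auto simp: ring_morph_def)
  show z: "h 0 = 0" using add[of 0 0] by simp
  show um: "h (- a) = - h a" for a using add[of a "- a"] z by (simp add: eq_neg_iff_add_eq_0 add.commute)
  show "h (a - b) = h a - h b" using add[of a "- b"] um by simp
qed

lemma ring_morph_sum: "ring_morph h \<Longrightarrow> h (sum f A) = (\<Sum>x\<in>A. h (f x))"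
  by (induction A rule: infinite_finite_induct) (auto simp: ring_morph_add ring_morph_0)

lemma ring_morph_prod: "ring_morph h \<Longrightarrow> h (prod f A) = (\<Prod>x\<in>A. h (f x))"
  by (induction A rule: infinite_finite_induct) (auto simp: ring_morph_mult ring_morph_1)

lemma ring_morph_power: "ring_morph h \<Longrightarrow> h (a ^ n) = h a ^ n"
  by (induction n) (auto simp: ring_morph_mult ring_morph_1)

lemmas ring_morph_simps = ring_morph_0 ring_morph_1 ring_morph_add ring_morph_mult
  ring_morph_uminus ring_morph_diff ring_morph_sum ring_morph_prod ring_morph_power

lemma ring_morph_comp: "ring_morph g \<Longrightarrow> ring_morph h \<Longrightarrow> ring_morph (\<lambda>x. g (h x))"
  by (auto simp: ring_morph_def)

lemma ring_morph_id: "ring_morph (\<lambda>x. x)"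
  by (auto simp: ring_morph_def)

lemma ring_morph_mconst: "ring_morph mconst"
  by (auto simp: ring_morph_def mconst_def single_add mult_single)

lemma ring_morph_inv_into:
  assumes "bij h" "ring_morph h" shows "ring_morph (inv_into UNIV h)"
proof (rule ring_morphI)
  have s: "h (inv_into UNIV h y) = y" for y using assms(1) by (simp add: bij_is_surj surj_f_inv_f)
  have i: "inv_into UNIV h (h x) = x" for x using assms(1) by (simp add: bij_is_inj inv_f_f)
  show "inv_into UNIV h 1 = 1" by (metis assms(2) ring_morph_1 i)
  show "inv_into UNIV h (a + b) = inv_into UNIV h a + inv_into UNIV h b" for a b
    using i[of "inv_into UNIV h a + inv_into UNIV h b"] by (simp add: ring_morph_add[OF assms(2)] s)
  show "inv_into UNIV h (a * b) = inv_into UNIV h a * inv_into UNIV h b" for a b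
    using i[of "inv_into UNIV h a * inv_into UNIV h b"] by (simp add: ring_morph_mult[OF assms(2)] s)
qed

section \<open>Evaluation of polynomials\<close>

lemma mpol_expand: "p = (\<Sum>m\<in>keys p. single m (lookup p m))"
proof (rule poly_mapping_eqI)
  fix k
  show "lookup p k = lookup (\<Sum>m\<in>keys p. single m (lookup p m)) k"
    by (cases "k \<in> keys p") (auto simp: lookup_sum lookup_single when_def in_keys_iff sum.delta)
qed

lemma mvar_power: "mvar i ^ k = single (single i k) (1::'r::comm_ring_1)"
  by (induction k) (auto simp: mvar_def mult_single single_add[symmetric])

lemma prod_single: "(\<Prod>i\<in>A. single (f i) (1::'r::comm_ring_1)) = single (\<Sum>i\<in>A. f i) 1"
  by (induction A rule: infinite_finite_induct) (auto simp: mult_single)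

lemma mon_expand: "(\<Sum>i\<in>UNIV. single i (lookup m i)) = (m :: 'n::finite mon)"
  by (rule poly_mapping_eqI) (auto simp: lookup_sum lookup_single when_def)

lemma single_expand: "single m c = mconst c * (\<Prod>i\<in>UNIV. mvar i ^ lookup m i)"
  by (simp add: mvar_power prod_single mon_expand mconst_def mult_single)

text \<open>The morphism \<open>h\<close> on coefficients is kept separate from the images of the variables, so that
  substitution, extension of coefficients and evaluation at a point are instances of one notion.\<close>

definition peval :: "('r \<Rightarrow> 's) \<Rightarrow> ('n \<Rightarrow> 's) \<Rightarrow> ('n::finite, 'r::comm_ring_1) mpol \<Rightarrow> 's::comm_ring_1" where
  "peval h \<sigma> p = (\<Sum>m\<in>keys p. h (lookup p m) * (\<Prod>i\<in>UNIV. \<sigma> i ^ lookup m i))"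

abbreviation subst :: "('n \<Rightarrow> ('m::finite, 'r) mpol) \<Rightarrow> ('n::finite, 'r::comm_ring_1) mpol \<Rightarrow> ('m, 'r) mpol" where
  "subst \<sigma> \<equiv> peval mconst \<sigma>"

lemma peval_superset:
  assumes "ring_morph h" "finite S" "keys p \<subseteq> S"
  shows "peval h \<sigma> p = (\<Sum>m\<in>S. h (lookup p m) * (\<Prod>i\<in>UNIV. \<sigma> i ^ lookup m i))"
  unfolding peval_def
  by (rule sum.mono_neutral_left) (use assms in \<open>auto simp: in_keys_iff ring_morph_0\<close>)

lemma peval_single: "ring_morph h \<Longrightarrow> peval h \<sigma> (single m c) = h c * (\<Prod>i\<in>UNIV. \<sigma> i ^ lookup m i)"
  by (subst peval_superset[of h "{m}"]) auto

lemma peval_add: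
  assumes "ring_morph h"
  shows "peval h \<sigma> (p + q) = peval h \<sigma> p + peval h \<sigma> q"
proof -
  let ?S = "keys p \<union> keys q"
  show ?thesis
    using peval_superset[of h ?S "p + q" \<sigma>] peval_superset[of h ?S p \<sigma>]
      peval_superset[of h ?S q \<sigma>] assms keys_add[of p q]
    by (simp add: lookup_add ring_morph_add distrib_right sum.distrib)
qed

lemma peval_0: "peval h \<sigma> 0 = 0" by (simp add: peval_def)

lemma peval_sum: "ring_morph h \<Longrightarrow> peval h \<sigma> (sum f A) = (\<Sum>x\<in>A. peval h \<sigma> (f x))"
  by (induction A rule: infinite_finite_induct) (auto simp: peval_add peval_0)

lemma ring_morph_peval:
  fixes h :: "'r::comm_ring_1 \<Rightarrow> 's::comm_ring_1" and \<sigma> :: "'n::finite \<Rightarrow> 's"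
  assumes h: "ring_morph h" shows "ring_morph (peval h \<sigma>)"
proof (rule ring_morphI)
  show "peval h \<sigma> 1 = 1" using peval_single[OF h, of \<sigma> 0 1] by (simp add: ring_morph_1[OF h])
  show "peval h \<sigma> (a + b) = peval h \<sigma> a + peval h \<sigma> b" for a b by (rule peval_add[OF h])
  fix p q :: "('n, 'r) mpol"
  have *: "peval h \<sigma> (single m c * single n d) = peval h \<sigma> (single m c) * peval h \<sigma> (single n d)" for m n c d
    by (simp add: mult_single peval_single h ring_morph_mult[OF h] lookup_add power_add prod.distrib)
  have "p * q = (\<Sum>m\<in>keys p. \<Sum>n\<in>keys q. single m (lookup p m) * single n (lookup q n))"
    by (subst (1) mpol_expand[of p], subst (1) mpol_expand[of q]) (rule sum_product)
  also have "peval h \<sigma> \<dots> = (\<Sum>m\<in>keys p. \<Sum>n\<in>keys q. peval h \<sigma> (single m (lookup p m)) * peval h \<sigma> (single n (lookup q n)))"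
    by (simp add: peval_sum[OF h] *)
  also have "\<dots> = peval h \<sigma> p * peval h \<sigma> q"
    unfolding sum_product[symmetric] peval_sum[OF h, symmetric] mpol_expand[symmetric] ..
  finally show "peval h \<sigma> (p * q) = peval h \<sigma> p * peval h \<sigma> q" .
qed

lemma peval_mconst: "ring_morph h \<Longrightarrow> peval h \<sigma> (mconst c) = h c"
  by (simp add: mconst_def peval_single)

lemma prod_delta_power: "(\<Prod>i\<in>UNIV. \<sigma> i ^ lookup (single j k) i) = (\<sigma> (j::'n::finite) ^ k :: 's::comm_ring_1)"
proof -
  have "(\<Prod>i\<in>UNIV. \<sigma> i ^ lookup (single j k) i) = (\<Prod>i\<in>UNIV. if i = j then \<sigma> j ^ k else 1)"
    by (rule prod.cong) (auto simp: lookup_single when_def)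
  thus ?thesis by simp
qed

lemma peval_mvar: "ring_morph h \<Longrightarrow> peval h \<sigma> (mvar i) = \<sigma> i"
  by (simp add: mvar_def peval_single prod_delta_power ring_morph_1 del: One_nat_def)

text \<open>All composition laws for substitutions come from this uniqueness statement.\<close>

lemma ring_morph_mpol_ext:
  assumes "ring_morph F" "ring_morph G" "\<And>c. F (mconst c) = G (mconst c)" "\<And>i. F (mvar i) = G (mvar i)"
  shows "F p = G p"
proof -
  have "F (single m c) = G (single m c)" for m c
    unfolding single_expand by (simp add: ring_morph_simps[OF assms(1)] ring_morph_simps[OF assms(2)] assms)
  thus ?thesis
    by (subst (1 2) mpol_expand[of p]) (simp only: ring_morph_sum[OF assms(1)] ring_morph_sum[OF assms(2)])
qed

lemmas ring_morph_subst = ring_morph_peval[OF ring_morph_mconst]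
lemmas subst_simps = ring_morph_simps[OF ring_morph_subst]
  peval_mconst[OF ring_morph_mconst] peval_mvar[OF ring_morph_mconst]

lemma peval_subst:
  assumes "ring_morph h"
  shows "peval h \<tau> (subst \<sigma> p) = peval h (\<lambda>i. peval h \<tau> (\<sigma> i)) p"
  by (rule ring_morph_mpol_ext[where F = "\<lambda>p. peval h \<tau> (subst \<sigma> p)"])
     (auto intro: ring_morph_comp ring_morph_peval assms ring_morph_mconst
        simp: subst_simps peval_mconst[OF assms] peval_mvar[OF assms])

lemmas subst_subst = peval_subst[OF ring_morph_mconst]

lemma subst_mvar: "subst mvar p = p"
  by (rule ring_morph_mpol_ext[where G = "\<lambda>p. p"])
     (auto intro: ring_morph_subst ring_morph_id simp: subst_simps)

lemma morph_eq_subst: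
  assumes "ring_morph F" "\<And>c. F (mconst c) = mconst c"
  shows "F p = subst (\<lambda>i. F (mvar i)) p"
  by (rule ring_morph_mpol_ext) (auto intro: ring_morph_subst assms simp: subst_simps assms)

lemma subst_0: "subst \<sigma> 0 = 0" by (simp add: subst_simps)

lemma subst_cong: "(\<And>i. \<sigma> i = \<tau> i) \<Longrightarrow> subst \<sigma> p = subst \<tau> p"
  by (simp add: peval_def)

section \<open>Weights and homogeneous components\<close>

text \<open>The inner sum of \<open>mon_weight\<close>.\<close>

definition nmul :: "nat \<Rightarrow> 'g::linordered_ab_group_add \<Rightarrow> 'g" where "nmul n g = (\<Sum>_<n. g)"

lemma nmul_0 [simp]: "nmul 0 g = 0" and nmul_Suc [simp]: "nmul (Suc n) g = g + nmul n g"
  and nmul_zero [simp]: "nmul n 0 = 0"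
  by (auto simp: nmul_def add.commute)

lemma nmul_1 [simp]: "nmul 1 g = g" by simp

lemma nmul_add: "nmul (m + n) g = nmul m g + nmul n g"
  by (induction m) (auto simp: algebra_simps)

lemma nmul_add_right: "nmul n (g + h) = nmul n g + nmul n h"
  by (induction n) (auto simp: algebra_simps)

lemma nmul_diff_right: "nmul n (g - h) = nmul n g - nmul n h"
  by (induction n) (auto simp: algebra_simps)

lemma nmul_mult: "nmul (m * n) g = nmul m (nmul n g)"
  by (induction m) (auto simp: nmul_add algebra_simps)

lemma nmul_int: "nmul n (k::int) = int n * k"
  by (induction n) (auto simp: algebra_simps)

lemma nmul_mono: "g \<le> h \<Longrightarrow> nmul n g \<le> nmul n h"
  by (induction n) (auto simp: add_mono)

lemma nmul_strict_mono: "0 < n \<Longrightarrow> g < h \<Longrightarrow> nmul n g < nmul n h"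
  by (cases n) (simp_all add: add_less_le_mono nmul_mono order_less_imp_le)

lemma nmul_less_iff: "0 < n \<Longrightarrow> nmul n g < nmul n h \<longleftrightarrow> g < h"
  by (metis nmul_strict_mono nmul_mono not_less)
lemma nmul_le_iff: "0 < n \<Longrightarrow> nmul n g \<le> nmul n h \<longleftrightarrow> g \<le> h"
  by (metis nmul_strict_mono nmul_mono not_less)
lemma nmul_eq_iff: "0 < n \<Longrightarrow> nmul n g = nmul n h \<longleftrightarrow> g = h"
  by (metis nmul_less_iff neq_iff)

lemma nmul_pos: "0 < n \<Longrightarrow> 0 < g \<Longrightarrow> 0 < nmul n g"
  using nmul_strict_mono[of n 0 g] by simp
lemma nmul_nonneg: "0 \<le> g \<Longrightarrow> 0 \<le> nmul n g"
  using nmul_mono[of 0 g n] by simp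

lemma nmul_left_strict: "m < n \<Longrightarrow> 0 < g \<Longrightarrow> nmul m g < nmul n g"
  using nmul_add[of m "n - m" g] nmul_pos[of "n - m" g] by simp
lemma nmul_left_less_iff: "0 < g \<Longrightarrow> nmul m g < nmul n g \<longleftrightarrow> m < n"
  by (metis nmul_left_strict linorder_neqE_nat order_less_asym)
lemma nmul_left_eq_iff: "0 < g \<Longrightarrow> nmul m g = nmul n g \<longleftrightarrow> m = n"
  by (metis nmul_left_strict linorder_neqE_nat order_less_irrefl)
lemma nmul_left_le_iff: "0 < g \<Longrightarrow> nmul m g \<le> nmul n g \<longleftrightarrow> m \<le> n"
  by (metis nmul_left_less_iff not_less)

lemma mon_weight_nmul: "mon_weight w m = (\<Sum>i\<in>UNIV. nmul (lookup m i) (w i))"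
  by (simp add: mon_weight_def nmul_def)

lemma mon_weight_add: "mon_weight w (m + n) = mon_weight w m + mon_weight w n"
  by (simp add: mon_weight_nmul lookup_add nmul_add sum.distrib)

lemma mon_weight_0 [simp]: "mon_weight w 0 = 0"
  by (simp add: mon_weight_nmul)

lemma mon_weight_single: "mon_weight w (single i k) = nmul k (w i)"
proof -
  have "(\<Sum>j\<in>UNIV. nmul (lookup (single i k) j) (w j)) = (\<Sum>j\<in>UNIV. if j = i then nmul k (w i) else 0)"
    by (rule sum.cong) (auto simp: lookup_single when_def)
  thus ?thesis by (simp add: mon_weight_nmul)
qed

definition deg_le :: "('n::finite \<Rightarrow> 'g::linordered_ab_group_add) \<Rightarrow> 'g \<Rightarrow> ('n, 'r::comm_ring_1) mpol \<Rightarrow> bool" where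
  "deg_le w D p \<longleftrightarrow> (\<forall>m\<in>keys p. mon_weight w m \<le> D)"

definition deg_lt :: "('n::finite \<Rightarrow> 'g::linordered_ab_group_add) \<Rightarrow> 'g \<Rightarrow> ('n, 'r::comm_ring_1) mpol \<Rightarrow> bool" where
  "deg_lt w D p \<longleftrightarrow> (\<forall>m\<in>keys p. mon_weight w m < D)"

text \<open>The part of a polynomial that is homogeneous of weight \<open>D\<close>; for \<open>D = wdeg w p\<close> it is the initial
  form.\<close>

definition hcomp :: "('n::finite \<Rightarrow> 'g::linordered_ab_group_add) \<Rightarrow> 'g \<Rightarrow> ('n, 'r::comm_ring_1) mpol \<Rightarrow> ('n, 'r) mpol" where
  "hcomp w D p = (\<Sum>m\<in>{m\<in>keys p. mon_weight w m = D}. single m (lookup p m))"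

lemma lookup_hcomp: "lookup (hcomp w D p) m = (if mon_weight w m = D then lookup p m else 0)"
  by (auto simp: hcomp_def lookup_sum lookup_single when_def in_keys_iff)

lemma keys_hcomp: "keys (hcomp w D p) = {m\<in>keys p. mon_weight w m = D}"
  by (auto simp: in_keys_iff lookup_hcomp split: if_splits)

lemma hcomp_add: "hcomp w D (p + q) = hcomp w D p + hcomp w D q"
  by (rule poly_mapping_eqI) (auto simp: lookup_hcomp lookup_add)
lemma hcomp_diff: "hcomp w D (p - q) = hcomp w D p - hcomp w D q"
  by (rule poly_mapping_eqI) (auto simp: lookup_hcomp lookup_minus)
lemma hcomp_0 [simp]: "hcomp w D 0 = 0"
  by (rule poly_mapping_eqI) (auto simp: lookup_hcomp)
lemma hcomp_sum: "hcomp w D (sum f A) = (\<Sum>x\<in>A. hcomp w D (f x))"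
  by (induction A rule: infinite_finite_induct) (auto simp: hcomp_add)
lemma hcomp_hcomp: "hcomp w D (hcomp w E p) = (if D = E then hcomp w D p else 0)"
  by (rule poly_mapping_eqI) (auto simp: lookup_hcomp)

lemma hcomp_deg_lt: "deg_lt w D p \<Longrightarrow> hcomp w D p = 0"
  by (rule poly_mapping_eqI) (force simp: lookup_hcomp deg_lt_def in_keys_iff)

lemma hcomp_id: "(\<And>m. m \<in> keys p \<Longrightarrow> mon_weight w m = D) \<Longrightarrow> hcomp w D p = p"
  by (rule poly_mapping_eqI) (force simp: lookup_hcomp in_keys_iff)

lemma hcomp_weight: "hcomp w D p = p \<Longrightarrow> m \<in> keys p \<Longrightarrow> mon_weight w m = D"
  using keys_hcomp[of w D p] by auto

lemma deg_le_0 [simp]: "deg_le w D 0" by (simp add: deg_le_def)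
lemma deg_le_add: "deg_le w D p \<Longrightarrow> deg_le w D q \<Longrightarrow> deg_le w D (p + q)"
  using keys_add[of p q] by (auto simp: deg_le_def)
lemma deg_lt_add: "deg_lt w D p \<Longrightarrow> deg_lt w D q \<Longrightarrow> deg_lt w D (p + q)"
  using keys_add[of p q] by (auto simp: deg_lt_def)
lemma deg_le_diff: "deg_le w D p \<Longrightarrow> deg_le w D q \<Longrightarrow> deg_le w D (p - q)"
  using keys_diff[of p q] by (auto simp: deg_le_def)
lemma deg_le_sum: "(\<And>x. x \<in> A \<Longrightarrow> deg_le w D (f x)) \<Longrightarrow> deg_le w D (sum f A)"
  by (induction A rule: infinite_finite_induct) (auto intro: deg_le_add)
lemma deg_le_mono: "deg_le w D p \<Longrightarrow> D \<le> E \<Longrightarrow> deg_le w E p"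
  by (force simp: deg_le_def)
lemma deg_le_imp_deg_lt: "deg_le w D p \<Longrightarrow> D < E \<Longrightarrow> deg_lt w E p"
  by (force simp: deg_le_def deg_lt_def)
lemma deg_lt_imp_deg_le: "deg_lt w D p \<Longrightarrow> deg_le w D p"
  by (force simp: deg_le_def deg_lt_def)

lemma deg_le_hcomp: "deg_le w D (hcomp w D p)" by (auto simp: deg_le_def keys_hcomp)

lemma deg_le_mult: "deg_le w D p \<Longrightarrow> deg_le w E q \<Longrightarrow> deg_le w (D + E) (p * q)"
  using keys_mult[of p q] by (fastforce simp: deg_le_def mon_weight_add intro: add_mono)
lemma deg_lt_mult1: "deg_lt w D p \<Longrightarrow> deg_le w E q \<Longrightarrow> deg_lt w (D + E) (p * q)"
  using keys_mult[of p q] by (fastforce simp: deg_le_def deg_lt_def mon_weight_add intro: add_less_le_mono)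
lemma deg_lt_mult2: "deg_le w D p \<Longrightarrow> deg_lt w E q \<Longrightarrow> deg_lt w (D + E) (p * q)"
  using keys_mult[of p q] by (fastforce simp: deg_le_def deg_lt_def mon_weight_add intro: add_le_less_mono)

lemma deg_lt_diff_hcomp: "deg_le w D p \<Longrightarrow> deg_lt w D (p - hcomp w D p)"
  by (auto simp: deg_le_def deg_lt_def in_keys_iff lookup_minus lookup_hcomp le_less split: if_splits)

lemma hcomp_mult_hcomp: "hcomp w (D + E) (hcomp w D p * hcomp w E q) = hcomp w D p * hcomp w E q"
  by (rule hcomp_id) (use keys_mult[of "hcomp w D p" "hcomp w E q"] in \<open>fastforce simp: keys_hcomp mon_weight_add\<close>)

text \<open>Taking top components is multiplicative as soon as \<open>D\<close> and \<open>E\<close> bound the degrees: every other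
  product of components has weight below \<open>D + E\<close>. The bounds need not be attained, hence no case
  distinction on cancellation of leading terms.\<close>

lemma hcomp_mult:
  assumes "deg_le w D p" "deg_le w E q"
  shows "hcomp w (D + E) (p * q) = hcomp w D p * hcomp w E q"
proof -
  let ?p = "hcomp w D p" and ?q = "hcomp w E q"
  have "p * q = ?p * ?q + (?p * (q - ?q) + (p - ?p) * q)" by (simp add: algebra_simps)
  moreover have "deg_lt w (D + E) (?p * (q - ?q) + (p - ?p) * q)"
    by (intro deg_lt_add deg_lt_mult1 deg_lt_mult2 deg_lt_diff_hcomp deg_le_hcomp assms)
  ultimately show ?thesis by (metis hcomp_add hcomp_deg_lt hcomp_mult_hcomp add_0_right)
qed

lemma deg_le_1: "deg_le w 0 1" by (simp add: deg_le_def)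
lemma hcomp_1: "hcomp w 0 1 = 1" by (rule hcomp_id) simp
lemma deg_le_mconst: "deg_le w 0 (mconst c)" by (simp add: deg_le_def mconst_def)
lemma hcomp_mconst: "hcomp w 0 (mconst c) = mconst c"
  by (rule hcomp_id) (auto simp: mconst_def split: if_splits)
lemma deg_le_mvar: "deg_le w (w i) (mvar i)" by (simp add: deg_le_def mvar_def mon_weight_single)
lemma hcomp_mvar: "hcomp w (w i) (mvar i) = mvar i"
  by (rule hcomp_id) (auto simp: mvar_def mon_weight_single split: if_splits)

lemma deg_le_power: "deg_le w D p \<Longrightarrow> deg_le w (nmul n D) (p ^ n)"
  by (induction n) (auto simp: deg_le_1 deg_le_mult)
lemma hcomp_power: "deg_le w D p \<Longrightarrow> hcomp w (nmul n D) (p ^ n) = hcomp w D p ^ n"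
  by (induction n) (auto simp: hcomp_1 hcomp_mult deg_le_power)
lemma deg_le_prod: "(\<And>i. i \<in> A \<Longrightarrow> deg_le w (D i) (p i)) \<Longrightarrow> deg_le w (\<Sum>i\<in>A. D i) (\<Prod>i\<in>A. p i)"
  by (induction A rule: infinite_finite_induct) (auto simp: deg_le_1 deg_le_mult)
lemma hcomp_prod: "(\<And>i. i \<in> A \<Longrightarrow> deg_le w (D i) (p i)) \<Longrightarrow> hcomp w (\<Sum>i\<in>A. D i) (\<Prod>i\<in>A. p i) = (\<Prod>i\<in>A. hcomp w (D i) (p i))"
  by (induction A rule: infinite_finite_induct) (auto simp: hcomp_1 hcomp_mult deg_le_prod)

text \<open>Giving each variable the degree of the polynomial substituted for it turns substitution into a
  filtered map, and its effect on top components is the substitution of the top components. Both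
  the degeneration of slides and every computation of the degree of a composite use this.\<close>

lemma
  fixes \<sigma> :: "'n::finite \<Rightarrow> ('m::finite, 'r::comm_ring_1) mpol"
  assumes \<sigma>: "\<And>i. deg_le v (w i) (\<sigma> i)" and p: "deg_le w D p"
  shows deg_le_subst: "deg_le v D (subst \<sigma> p)"
    and hcomp_subst: "hcomp v D (subst \<sigma> p) = subst (\<lambda>i. hcomp v (w i) (\<sigma> i)) (hcomp w D p)"
proof -
  let ?t = "\<lambda>m. mconst (lookup p m) * (\<Prod>i\<in>UNIV. \<sigma> i ^ lookup m i)"
  have t: "deg_le v (mon_weight w m) (?t m)" for m
    using deg_le_mult[OF deg_le_mconst deg_le_prod[where p = "\<lambda>i. \<sigma> i ^ lookup m i" and A = UNIV, OF deg_le_power[OF \<sigma>]]]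
    by (simp add: mon_weight_nmul)
  have h: "hcomp v (mon_weight w m) (?t m) = mconst (lookup p m) * (\<Prod>i\<in>UNIV. hcomp v (w i) (\<sigma> i) ^ lookup m i)" for m
    using hcomp_mult[OF deg_le_mconst deg_le_prod[where p = "\<lambda>i. \<sigma> i ^ lookup m i" and A = UNIV, OF deg_le_power[OF \<sigma>]]]
    by (simp add: mon_weight_nmul hcomp_mconst hcomp_prod[OF deg_le_power[OF \<sigma>]] hcomp_power[OF \<sigma>])
  have le: "mon_weight w m \<le> D" if "m \<in> keys p" for m using p that by (auto simp: deg_le_def)
  show "deg_le v D (subst \<sigma> p)"
    unfolding peval_def by (intro deg_le_sum deg_le_mono[OF t] le)
  have "hcomp v D (subst \<sigma> p) = (\<Sum>m\<in>keys p. hcomp v D (?t m))"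
    by (simp add: peval_def hcomp_sum)
  also have "\<dots> = (\<Sum>m\<in>keys p. if mon_weight w m = D then mconst (lookup p m) * (\<Prod>i\<in>UNIV. hcomp v (w i) (\<sigma> i) ^ lookup m i) else 0)"
  proof (rule sum.cong[OF refl])
    fix m assume m: "m \<in> keys p"
    show "hcomp v D (?t m) = (if mon_weight w m = D then mconst (lookup p m) * (\<Prod>i\<in>UNIV. hcomp v (w i) (\<sigma> i) ^ lookup m i) else 0)"
      using h[of m] hcomp_deg_lt[OF deg_le_imp_deg_lt[OF t[of m], of D]] le[OF m] by auto
  qed
  also have "\<dots> = (\<Sum>m\<in>{m\<in>keys p. mon_weight w m = D}. mconst (lookup p m) * (\<Prod>i\<in>UNIV. hcomp v (w i) (\<sigma> i) ^ lookup m i))"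
    by (simp add: sum.inter_filter[symmetric])
  also have "\<dots> = subst (\<lambda>i. hcomp v (w i) (\<sigma> i)) (hcomp w D p)"
    by (simp add: peval_def keys_hcomp lookup_hcomp)
  finally show "hcomp v D (subst \<sigma> p) = subst (\<lambda>i. hcomp v (w i) (\<sigma> i)) (hcomp w D p)" .
qed

lemma keys_nonempty: "p \<noteq> 0 \<Longrightarrow> keys p \<noteq> {}" by simp

lemma wdeg_deg_le: "deg_le w (wdeg w p) p"
  by (auto simp: deg_le_def wdeg_def)

lemma init_form_hcomp: "init_form w p = hcomp w (wdeg w p) p"
  by (simp add: init_form_def hcomp_def)

lemma wdeg_attained: "p \<noteq> 0 \<Longrightarrow> \<exists>m\<in>keys p. mon_weight w m = wdeg w p"
  unfolding wdeg_def by (metis (mono_tags, lifting) Max_in finite_imageI finite_keys image_iff image_is_empty keys_nonempty)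

lemma init_form_nonzero: "p \<noteq> 0 \<Longrightarrow> hcomp w (wdeg w p) p \<noteq> 0"
  using wdeg_attained[of p w] by (metis (mono_tags, lifting) in_keys_iff lookup_hcomp lookup_zero)

lemma wdeg_least: "p \<noteq> 0 \<Longrightarrow> deg_le w D p \<Longrightarrow> wdeg w p \<le> D"
  using wdeg_attained[of p w] by (auto simp: deg_le_def)

lemma wdeg_eqI: "deg_le w D p \<Longrightarrow> hcomp w D p \<noteq> 0 \<Longrightarrow> wdeg w p = D"
  by (metis deg_le_imp_deg_lt wdeg_least hcomp_0 hcomp_deg_lt le_neq_trans wdeg_deg_le)

lemma wdeg_ge: "m \<in> keys p \<Longrightarrow> mon_weight w m \<le> wdeg w p"
  using wdeg_deg_le[of w p] by (auto simp: deg_le_def)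

lemma wdeg_mult:
  fixes p q :: "('n::{finite,linorder}, 'r::idom) mpol"
  assumes "p \<noteq> 0" "q \<noteq> 0"
  shows "wdeg w (p * q) = wdeg w p + wdeg w q"
  by (rule wdeg_eqI) (auto simp: deg_le_mult wdeg_deg_le hcomp_mult init_form_nonzero assms)

lemma wdeg_1: "wdeg w 1 = 0" by (simp add: wdeg_def)
lemma mconst_0 [simp]: "mconst 0 = 0" and mconst_1 [simp]: "mconst 1 = 1" by (auto simp: mconst_def)
lemma mconst_eq_0_iff [simp]: "mconst c = 0 \<longleftrightarrow> c = 0"
  by (metis lookup_single_eq lookup_zero mconst_def single_zero)
lemma wdeg_mconst: "c \<noteq> 0 \<Longrightarrow> wdeg w (mconst c) = 0"
  by (rule wdeg_eqI) (auto simp: deg_le_mconst hcomp_mconst)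
lemma mvar_neq_0 [simp]: "mvar i \<noteq> 0"
  by (metis lookup_single_eq lookup_zero mvar_def zero_neq_one)
lemma wdeg_mvar: "wdeg w (mvar i :: ('n::finite,'r::comm_ring_1) mpol) = w i"
  by (rule wdeg_eqI) (auto simp: deg_le_mvar hcomp_mvar)

lemma wdeg_power:
  fixes p :: "('n::{finite,linorder}, 'r::idom) mpol"
  assumes "p \<noteq> 0"
  shows "wdeg w (p ^ n) = nmul n (wdeg w p)"
  by (induction n) (auto simp: wdeg_1 wdeg_mult assms)

section \<open>Three variables, and the degree in the last one\<close>

lemma UNIV_3: "(UNIV :: 3 set) = {0, 1, 2}"
proof (rule sym, rule card_seteq)
  show "card (UNIV :: 3 set) \<le> card {0, 1, 2 :: 3}" by simp
qed auto

lemma exhaust_3: fixes i :: 3 obtains "i = 0" | "i = 1" | "i = 2"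
proof -
  have "i \<in> {0, 1, 2}" using UNIV_I[of i] by (simp only: UNIV_3)
  thus thesis using that by blast
qed

lemma sum_3: "(\<Sum>i\<in>UNIV. f (i::3)) = f 0 + (f 1 + f 2)"
  unfolding UNIV_3 by simp
lemma prod_3: "(\<Prod>i\<in>UNIV. f (i::3)) = f 0 * (f 1 * f 2)"
  unfolding UNIV_3 by simp

lemma mon_weight_3: "mon_weight (w :: 3 \<Rightarrow> _) m =
    nmul (lookup m 0) (w 0) + (nmul (lookup m 1) (w 1) + nmul (lookup m 2) (w 2))"
  by (simp add: mon_weight_nmul sum_3)

lemma mon_eqI_3: "lookup m 0 = lookup n 0 \<Longrightarrow> lookup m 1 = lookup n 1 \<Longrightarrow> lookup m 2 = lookup n 2 \<Longrightarrow> m = (n :: 3 mon)"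
proof (rule poly_mapping_eqI)
  fix i :: 3
  assume "lookup m 0 = lookup n 0" "lookup m 1 = lookup n 1" "lookup m 2 = lookup n 2"
  thus "lookup m i = lookup n i" by (cases i rule: exhaust_3) simp_all
qed

text \<open>Indices \<open>0\<close>, \<open>1\<close>, \<open>2\<close> stand for variables x, y, z. With weights \<open>z_wt\<close> the weighted degree is the
  degree in z; with the opposite weights \<open>z_low\<close> every polynomial has degree at most 0, and its
  component of weight 0 is its value at z = 0, so that setting z to 0 is also an instance of
  taking top components.\<close>

definition z_wt :: "3 \<Rightarrow> int" where "z_wt i = (if i = 2 then 1 else 0)"
definition z_low :: "3 \<Rightarrow> int" where "z_low i = (if i = 2 then - 1 else 0)"

lemma z_wt_simps [simp]: "z_wt 0 = 0" "z_wt 1 = 0" "z_wt 2 = 1" by (auto simp: z_wt_def)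
lemma z_low_simps [simp]: "z_low 0 = 0" "z_low 1 = 0" "z_low 2 = - 1" by (auto simp: z_low_def)

lemma mon_weight_z_wt: "mon_weight z_wt m = int (lookup m 2)"
  by (simp add: mon_weight_3 nmul_int)
lemma mon_weight_z_low: "mon_weight z_low m = - int (lookup m 2)"
  by (simp add: mon_weight_3 nmul_int)

text \<open>Membership in the subring of polynomials in x and y. Automorphisms of the plane are treated as
  automorphisms in three variables that keep z, which avoids passing between two polynomial rings.\<close>

definition xy_poly :: "(3, 'r::comm_ring_1) mpol \<Rightarrow> bool" where
  "xy_poly p \<longleftrightarrow> (\<forall>m\<in>keys p. lookup m 2 = 0)"

lemma xy_poly_deg_le: "xy_poly p \<longleftrightarrow> deg_le z_wt 0 p"
  by (simp add: xy_poly_def deg_le_def mon_weight_z_wt)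
lemma xy_poly_hcomp: "xy_poly p \<longleftrightarrow> hcomp z_low 0 p = p"
proof
  assume "xy_poly p" thus "hcomp z_low 0 p = p"
    by (intro hcomp_id) (auto simp: xy_poly_def mon_weight_z_low)
next
  assume *: "hcomp z_low 0 p = p"
  show "xy_poly p" unfolding xy_poly_def using hcomp_weight[OF *] by (auto simp: mon_weight_z_low)
qed
lemma xy_poly_0 [simp]: "xy_poly 0" and xy_poly_1 [simp]: "xy_poly 1" and xy_poly_mconst [simp]: "xy_poly (mconst c)"
  by (auto simp: xy_poly_def mconst_def)
lemma xy_poly_mvar: "i \<noteq> 2 \<Longrightarrow> xy_poly (mvar i)"
  by (auto simp: xy_poly_def mvar_def lookup_single when_def)
lemma xy_poly_add: "xy_poly p \<Longrightarrow> xy_poly q \<Longrightarrow> xy_poly (p + q)" by (simp add: xy_poly_deg_le deg_le_add)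
lemma xy_poly_diff: "xy_poly p \<Longrightarrow> xy_poly q \<Longrightarrow> xy_poly (p - q)" by (simp add: xy_poly_deg_le deg_le_diff)
lemma xy_poly_mult: "xy_poly p \<Longrightarrow> xy_poly q \<Longrightarrow> xy_poly (p * q)" using deg_le_mult[of z_wt 0 p 0 q] by (simp add: xy_poly_deg_le)
lemma xy_poly_power: "xy_poly p \<Longrightarrow> xy_poly (p ^ n)" by (induction n) (auto intro: xy_poly_mult)
lemma deg_le_z_low: "deg_le z_low 0 p" by (simp add: deg_le_def mon_weight_z_low)
lemma xy_poly_hcomp_z_low [simp]: "xy_poly (hcomp z_low 0 p)" by (auto simp: xy_poly_def keys_hcomp mon_weight_z_low)

lemma wdeg_z_wt_nonneg: "p \<noteq> 0 \<Longrightarrow> 0 \<le> wdeg z_wt p"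
  using wdeg_attained[of p z_wt] by (auto simp: mon_weight_z_wt)
lemma xy_poly_wdeg: "p \<noteq> 0 \<Longrightarrow> xy_poly p \<longleftrightarrow> wdeg z_wt p = 0"
  by (metis wdeg_least order_antisym_conv xy_poly_deg_le wdeg_deg_le wdeg_z_wt_nonneg)

lemma xy_poly_factor:
  fixes p q :: "(3, 'r::idom) mpol"
  assumes "xy_poly (p * q)" "p \<noteq> 0" "q \<noteq> 0" shows "xy_poly p" "xy_poly q"
proof -
  have "wdeg z_wt p + wdeg z_wt q = 0" using assms xy_poly_wdeg[of "p * q"] wdeg_mult[of p q z_wt] by auto
  with wdeg_z_wt_nonneg[of p] wdeg_z_wt_nonneg[of q] assms have "wdeg z_wt p = 0" "wdeg z_wt q = 0" by auto
  thus "xy_poly p" "xy_poly q" using assms by (auto simp: xy_poly_wdeg)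
qed

section \<open>Partial derivatives\<close>

definition pdiff :: "'n \<Rightarrow> ('n::finite, 'r::comm_ring_1) mpol \<Rightarrow> ('n, 'r) mpol" where
  "pdiff i p = (\<Sum>m\<in>keys p. single (m - single i 1) (of_nat (lookup m i) * lookup p m))"

lemma pdiff_superset: "finite S \<Longrightarrow> keys p \<subseteq> S \<Longrightarrow>
    pdiff i p = (\<Sum>m\<in>S. single (m - single i 1) (of_nat (lookup m i) * lookup p m))"
  unfolding pdiff_def by (rule sum.mono_neutral_left) (auto simp: in_keys_iff)

lemma pdiff_add: "pdiff i (p + q) = pdiff i p + pdiff i q"
  using pdiff_superset[of "keys p \<union> keys q" "p + q" i] pdiff_superset[of "keys p \<union> keys q" p i]
    pdiff_superset[of "keys p \<union> keys q" q i] keys_add[of p q]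
  by (simp add: lookup_add distrib_left single_add sum.distrib)

lemma pdiff_0 [simp]: "pdiff i 0 = 0" by (simp add: pdiff_def)
lemma pdiff_sum: "pdiff i (sum f A) = (\<Sum>x\<in>A. pdiff i (f x))"
  by (induction A rule: infinite_finite_induct) (auto simp: pdiff_add)
lemma pdiff_diff: "pdiff i (p - q) = pdiff i p - pdiff i q"
  using pdiff_add[of i "p - q" q] by (simp add: algebra_simps)

lemma pdiff_single: "pdiff i (single m c) = single (m - single i 1) (of_nat (lookup m i) * c)"
  by (subst pdiff_superset[of "{m}"]) auto

lemma minus_single_add: "0 < lookup m i \<Longrightarrow> (m - single i 1) + n = (m + n) - single i (1::nat)"
  by (rule poly_mapping_eqI) (auto simp: lookup_add lookup_minus lookup_single when_def)

lemma pdiff_mult_single: "pdiff i (single m c * single n d) = pdiff i (single m c) * single n d + single m c * pdiff i (single n d)"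
proof -
  have 1: "pdiff i (single m c) * single n d = single (m + n - single i 1) (of_nat (lookup m i) * (c * d))"
    by (cases "lookup m i = 0") (auto simp: pdiff_single mult_single minus_single_add mult.assoc simp del: One_nat_def)
  have 2: "single m c * pdiff i (single n d) = single (m + n - single i 1) (of_nat (lookup n i) * (c * d))"
    using minus_single_add[of n i m]
    by (cases "lookup n i = 0") (auto simp: pdiff_single mult_single add.commute mult_ac simp del: One_nat_def)
  show ?thesis unfolding 1 2 by (simp add: mult_single pdiff_single lookup_add distrib_right single_add)
qed

lemma pdiff_mult: "pdiff i (p * q) = pdiff i p * q + p * pdiff i q"
proof -
  let ?p = "\<lambda>m. single m (lookup p m)" and ?q = "\<lambda>m. single m (lookup q m)"
  have "p * q = (\<Sum>m\<in>keys p. \<Sum>n\<in>keys q. ?p m * ?q n)"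
    by (subst (1) mpol_expand[of p], subst (1) mpol_expand[of q]) (rule sum_product)
  hence "pdiff i (p * q) = (\<Sum>m\<in>keys p. \<Sum>n\<in>keys q. pdiff i (?p m) * ?q n) + (\<Sum>m\<in>keys p. \<Sum>n\<in>keys q. ?p m * pdiff i (?q n))"
    by (simp only: pdiff_sum pdiff_mult_single sum.distrib)
  also have "\<dots> = (\<Sum>m\<in>keys p. pdiff i (?p m)) * (\<Sum>n\<in>keys q. ?q n) + (\<Sum>m\<in>keys p. ?p m) * (\<Sum>n\<in>keys q. pdiff i (?q n))"
    by (simp only: sum_product)
  also have "\<dots> = pdiff i p * q + p * pdiff i q"
    by (simp only: pdiff_sum[symmetric] mpol_expand[symmetric])
  finally show ?thesis .
qed

lemma pdiff_mconst [simp]: "pdiff i (mconst c) = 0"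
  by (simp add: mconst_def pdiff_single)
lemma pdiff_mvar: "pdiff i (mvar j) = (if i = j then 1 else 0)"
  by (auto simp: mvar_def pdiff_single lookup_single when_def simp del: One_nat_def)
lemma pdiff_power: "pdiff i (p ^ n) = mconst (of_nat n) * p ^ (n - 1) * pdiff i p"
proof (induction n)
  case (Suc n)
  have "p * (mconst (of_nat n) * p ^ (n - 1)) = mconst (of_nat n) * p ^ n"
    by (cases n) (auto simp: algebra_simps)
  hence "pdiff i (p ^ Suc n) = (1 + mconst (of_nat n)) * p ^ n * pdiff i p"
    unfolding power_Suc pdiff_mult Suc by (simp only: mult.assoc[symmetric]) (simp add: algebra_simps)
  moreover have "1 + mconst (of_nat n) = (mconst (of_nat (Suc n)) :: ('a, 'b) mpol)"
    by (simp only: of_nat_Suc ring_morph_simps[OF ring_morph_mconst])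
  ultimately show ?case by simp
qed (simp add: single_one[symmetric] pdiff_single del: single_one)

lemma keys_pdiff: "m \<in> keys (pdiff i p) \<Longrightarrow> \<exists>n\<in>keys p. m = n - single i 1"
  using keys_sum[of "\<lambda>m. single (m - single i 1) (of_nat (lookup m i) * lookup p m)" "keys p"]
  unfolding pdiff_def by (auto split: if_splits)

lemma minus_single_add_single: "lookup m i \<noteq> 0 \<Longrightarrow> m - single i 1 + single i (1::nat) = m"
  by (rule poly_mapping_eqI) (auto simp: lookup_add lookup_minus lookup_single when_def)

lemma lookup_pdiff_0:
  fixes p :: "('n::finite, 'r::comm_ring_1) mpol"
  shows "lookup (pdiff i p) 0 = lookup p (single i 1)"
proof -
  have "lookup (pdiff i p) 0 = (\<Sum>m\<in>keys p. lookup (single (m - single i 1) (of_nat (lookup m i) * lookup p m)) 0)"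
    by (simp add: pdiff_def lookup_sum)
  also have "\<dots> = (\<Sum>m\<in>keys p. if m = single i 1 then lookup p m else 0)"
  proof (rule sum.cong[OF refl])
    fix m
    show "lookup (single (m - single i 1) (of_nat (lookup m i) * lookup p m)) 0 = (if m = single i 1 then lookup p m else 0)"
    proof (cases "lookup m i = 0")
      case True
      hence "m \<noteq> single i 1" by auto
      thus ?thesis using True by simp
    next
      case False
      have "m - single i 1 = 0 \<longleftrightarrow> m = single i 1"
        using minus_single_add_single[OF False] by auto
      thus ?thesis by (auto simp: lookup_single when_def simp del: One_nat_def)
    qed
  qed
  also have "\<dots> = lookup p (single i 1)" by (simp add: in_keys_iff)
  finally show ?thesis .
qed

text \<open>The constant term is the value at the origin, hence multiplicative.\<close>

lemma lookup_mult_0: "lookup (p * q :: ('n::finite, 'r::comm_ring_1) mpol) 0 = lookup p 0 * lookup q 0"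
proof -
  have pe: "peval (\<lambda>x. x) (\<lambda>_. 0) p = lookup p 0" for p :: "('n, 'r) mpol"
  proof -
    have z: "(\<Prod>i\<in>UNIV. (0::'r) ^ lookup m i) = (if m = 0 then 1 else 0)" for m :: "'n mon"
    proof (cases "m = 0")
      case False
      then obtain i where i: "lookup m i \<noteq> 0" by (metis lookup_zero poly_mapping_eqI)
      have "(\<Prod>i\<in>UNIV. (0::'r) ^ lookup m i) = 0"
        by (rule prod_zero) (use i in \<open>auto intro!: exI[of _ i] zero_power\<close>)
      thus ?thesis using False by simp
    qed simp
    show ?thesis by (simp add: peval_def z in_keys_iff if_distrib[of "\<lambda>x. _ * x"] cong: if_cong)
  qed
  show ?thesis
    using ring_morph_mult[OF ring_morph_peval[OF ring_morph_id], of "\<lambda>_. 0" p q] by (simp add: pe)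
qed

section \<open>Slides and their fixed polynomials\<close>

text \<open>A slide is a homomorphism from polynomials in x and y to polynomials in x, y and z that is the
  identity at z = 0. Additive group actions on the plane, with z as the parameter of the group,
  are examples, and they replace locally nilpotent derivations in positive characteristic. The
  condition at z = 0 is stable under passing to top components.\<close>

definition slide :: "(3 \<Rightarrow> (3, 'r::comm_ring_1) mpol) \<Rightarrow> bool" where
  "slide \<phi> \<longleftrightarrow> \<phi> 2 = mvar 2 \<and> hcomp z_low 0 (\<phi> 0) = mvar 0 \<and> hcomp z_low 0 (\<phi> 1) = mvar 1"

text \<open>The invariants of a slide. By the condition at z = 0, a polynomial in x and y is invariant as soon
  as its image is free of z (\<open>fixed_byI\<close>).\<close>

definition fixed_by :: "(3 \<Rightarrow> (3, 'r::comm_ring_1) mpol) \<Rightarrow> (3, 'r) mpol \<Rightarrow> bool" where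
  "fixed_by \<phi> p \<longleftrightarrow> xy_poly p \<and> subst \<phi> p = p"

lemma slide_section:
  assumes "slide \<phi>" "xy_poly p" shows "hcomp z_low 0 (subst \<phi> p) = p"
proof -
  have d: "deg_le z_low (z_low i) (\<phi> i)" for i
    using assms(1) deg_le_mvar[of z_low 2] by (cases i rule: exhaust_3) (auto simp: slide_def deg_le_z_low)
  have h: "hcomp z_low (z_low i) (\<phi> i) = mvar i" for i
    using assms(1) hcomp_mvar[of z_low 2] by (cases i rule: exhaust_3) (auto simp: slide_def)
  show ?thesis
    using hcomp_subst[OF d deg_le_z_low, of p] assms(2) by (simp add: h subst_mvar xy_poly_hcomp)
qed

lemma slide_neq_0: "slide \<phi> \<Longrightarrow> xy_poly p \<Longrightarrow> p \<noteq> 0 \<Longrightarrow> subst \<phi> p \<noteq> 0"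
  using slide_section[of \<phi> p] by auto

lemma fixed_byI: "slide \<phi> \<Longrightarrow> xy_poly p \<Longrightarrow> xy_poly (subst \<phi> p) \<Longrightarrow> fixed_by \<phi> p"
  using slide_section[of \<phi> p] by (simp add: fixed_by_def xy_poly_hcomp)

lemma fixed_by_diff: "fixed_by \<phi> p \<Longrightarrow> fixed_by \<phi> q \<Longrightarrow> fixed_by \<phi> (p - q)"
  by (simp add: fixed_by_def xy_poly_diff subst_simps)
lemma fixed_by_mult: "fixed_by \<phi> p \<Longrightarrow> fixed_by \<phi> q \<Longrightarrow> fixed_by \<phi> (p * q)"
  by (simp add: fixed_by_def xy_poly_mult subst_simps)
lemma fixed_by_power: "fixed_by \<phi> p \<Longrightarrow> fixed_by \<phi> (p ^ n)"
  by (simp add: fixed_by_def xy_poly_power subst_simps)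
lemma fixed_by_mconst: "fixed_by \<phi> (mconst c)"
  by (simp add: fixed_by_def subst_simps)

text \<open>The degree in z is additive on products, and that of the image of the product is 0. So the images
  of both factors are free of z, and such images are found by setting z to 0.\<close>

lemma fixed_by_factor:
  fixes p q :: "(3, 'r::idom) mpol"
  assumes s: "slide \<phi>" and pq: "fixed_by \<phi> (p * q)" "p \<noteq> 0" "q \<noteq> 0"
  shows "fixed_by \<phi> p" "fixed_by \<phi> q"
proof -
  have t: "xy_poly p" "xy_poly q" using pq xy_poly_factor[of p q] by (auto simp: fixed_by_def)
  have "xy_poly (subst \<phi> p * subst \<phi> q)" using pq by (simp add: fixed_by_def subst_simps)
  hence "xy_poly (subst \<phi> p)" "xy_poly (subst \<phi> q)"
    using xy_poly_factor[of "subst \<phi> p" "subst \<phi> q"] slide_neq_0[OF s t(1)] slide_neq_0[OF s t(2)] pq by auto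
  thus "fixed_by \<phi> p" "fixed_by \<phi> q" using fixed_byI[OF s] t by auto
qed

lemma fixed_by_root:
  fixes p :: "(3, 'r::idom) mpol"
  assumes "slide \<phi>" "fixed_by \<phi> (p ^ n)" "0 < n" "p \<noteq> 0"
  shows "fixed_by \<phi> p"
proof -
  have "p ^ n = p * p ^ (n - 1)" using assms(3) by (cases n) auto
  thus ?thesis using fixed_by_factor(1)[OF assms(1), of p "p ^ (n - 1)"] assms by simp
qed

lemma fixed_by_mvar: "fixed_by \<phi> (mvar i) \<longleftrightarrow> i \<noteq> 2 \<and> \<phi> i = mvar i"
proof -
  have "\<not> xy_poly (mvar 2 :: (3, 'a) mpol)" by (simp add: xy_poly_def mvar_def)
  thus ?thesis using xy_poly_mvar[of i] by (auto simp: fixed_by_def subst_simps)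
qed

definition trivial_slide :: "(3 \<Rightarrow> (3, 'r::comm_ring_1) mpol) \<Rightarrow> bool" where
  "trivial_slide \<phi> \<longleftrightarrow> \<phi> 0 = mvar 0 \<and> \<phi> 1 = mvar 1"

lemma trivial_slide_fixed: "trivial_slide \<phi> \<longleftrightarrow> fixed_by \<phi> (mvar 0) \<and> fixed_by \<phi> (mvar 1)"
  by (simp add: fixed_by_mvar trivial_slide_def)

lemma slide_xy_poly: "slide \<phi> \<Longrightarrow> xy_poly (\<phi> i) \<Longrightarrow> i \<noteq> 2 \<Longrightarrow> \<phi> i = mvar i"
  by (cases i rule: exhaust_3) (auto simp: slide_def xy_poly_hcomp)

lemma deg_le_z_wt_pdiff: "deg_le z_wt D p \<Longrightarrow> i \<noteq> 2 \<Longrightarrow> deg_le z_wt D (pdiff i p)"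
  unfolding deg_le_def mon_weight_z_wt
  by (force dest!: keys_pdiff simp: lookup_minus lookup_single when_def)

text \<open>If the degrees in z of the two terms differed, the larger one would survive in the difference.\<close>

lemma power_degree_eq:
  fixes \<xi> \<eta> :: "(3, 'k::field) mpol"
  assumes "xy_poly (\<xi> ^ a - mconst c * \<eta> ^ b)" "c \<noteq> 0" "\<xi> \<noteq> 0" "\<eta> \<noteq> 0"
  shows "int a * wdeg z_wt \<xi> = int b * wdeg z_wt \<eta>"
proof -
  let ?P = "\<xi> ^ a" and ?Q = "mconst c * \<eta> ^ b"
  have P: "wdeg z_wt ?P = int a * wdeg z_wt \<xi>" using assms by (simp add: wdeg_power nmul_int)
  have Q: "wdeg z_wt ?Q = int b * wdeg z_wt \<eta>" using assms by (simp add: wdeg_mult wdeg_mconst wdeg_power nmul_int)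
  have nz: "?P \<noteq> 0" "?Q \<noteq> 0" using assms by auto
  have *: False if "xy_poly (p - q)" "wdeg z_wt q < wdeg z_wt p" "p \<noteq> 0" "q \<noteq> 0" for p q :: "(3, 'k) mpol"
  proof -
    have "deg_le z_wt 0 (p - q)" using that(1) by (simp add: xy_poly_deg_le)
    hence "hcomp z_wt (wdeg z_wt p) (p - q) = 0"
      using that wdeg_z_wt_nonneg[OF that(4)] by (intro hcomp_deg_lt deg_le_imp_deg_lt[of _ 0]) auto
    moreover have "hcomp z_wt (wdeg z_wt p) q = 0" by (intro hcomp_deg_lt deg_le_imp_deg_lt[OF wdeg_deg_le that(2)])
    ultimately show False using init_form_nonzero[OF that(3), of z_wt] by (simp add: hcomp_diff)
  qed
  have "xy_poly (?Q - ?P)" using xy_poly_diff[OF xy_poly_0 assms(1)] by simp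
  with *[of ?P ?Q] *[of ?Q ?P] assms(1) nz P Q show ?thesis by (metis linorder_neqE_linordered_idom)
qed

lemma single_1_eq_iff: "single i (1::nat) = single j 1 \<longleftrightarrow> i = j"
  by (metis keys_single singleton_inject zero_neq_one)

text \<open>The solution of a linear system by determinants, written without division.\<close>

lemma cramer_2:
  fixes A :: "'a::comm_ring_1"
  assumes "A * x0 - B * y0 = u" "A * x1 - B * y1 = - v"
  shows "A * (x0 * y1 - x1 * y0) = u * y1 + v * y0" "B * (x0 * y1 - x1 * y0) = u * x1 + v * x0"
proof -
  have v: "v = B * y1 - A * x1" using arg_cong[OF assms(2), of uminus] by simp
  show "A * (x0 * y1 - x1 * y0) = u * y1 + v * y0" "B * (x0 * y1 - x1 * y0) = u * x1 + v * x0"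
    unfolding assms(1)[symmetric] v by (simp_all add: algebra_simps)
qed

text \<open>This is where a weighted homogeneous coordinate is forced to have the form x - c y^b or x^a - c y.
  For images \<open>\<xi>\<close>, \<open>\<eta>\<close> of x and y, differentiating \<open>\<xi>^a - c \<eta>^b = x^a - c y^b\<close> in
  x and in y gives two linear equations for \<open>a \<xi>^(a-1)\<close> and \<open>c b \<eta>^(b-1)\<close> whose
  determinant is the Jacobian of the pair \<open>(\<xi>, \<eta>)\<close>. The Jacobian is 1 at the origin, so
  it is not zero, and comparing degrees in z bounds \<open>(a - 1) deg \<xi>\<close> by \<open>deg \<eta>\<close> and
  \<open>(b - 1) deg \<eta>\<close> by \<open>deg \<xi>\<close>. Together with \<open>a deg \<xi> = b deg \<eta>\<close> and
  \<open>a \<noteq> b\<close> this leaves only degree 0. If the characteristic divides one of the exponents, a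
  single one of the two equations suffices.\<close>

theorem binomial_rigidity:
  fixes \<phi> :: "3 \<Rightarrow> (3, 'k::field) mpol"
  assumes s: "slide \<phi>" and fixed: "fixed_by \<phi> (mvar 0 ^ a - mconst c * mvar 1 ^ b)"
    and ab: "coprime a b" "2 \<le> a" "2 \<le> b" and c: "c \<noteq> 0"
  shows "trivial_slide \<phi>"
proof -
  define \<xi> where "\<xi> = \<phi> 0"
  define \<eta> where "\<eta> = \<phi> 1"
  have s0: "hcomp z_low 0 \<xi> = mvar 0" and s1: "hcomp z_low 0 \<eta> = mvar 1" using s by (auto simp: slide_def \<xi>_def \<eta>_def)
  have nz: "\<xi> \<noteq> 0" "\<eta> \<noteq> 0" using s0 s1 by auto
  have eq: "\<xi> ^ a - mconst c * \<eta> ^ b = mvar 0 ^ a - mconst c * mvar 1 ^ b"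
    using fixed by (simp add: fixed_by_def subst_simps \<xi>_def \<eta>_def)
  let ?\<alpha> = "mconst (of_nat a) :: (3, 'k) mpol" and ?\<beta> = "mconst (c * of_nat b) :: (3, 'k) mpol"
  define J where "J = pdiff 0 \<xi> * pdiff 1 \<eta> - pdiff 1 \<xi> * pdiff 0 \<eta>"
  have mc: "mconst c * mconst (of_nat b) = ?\<beta>" by (simp add: ring_morph_simps[OF ring_morph_mconst])
  have E: "?\<alpha> * \<xi> ^ (a - 1) * pdiff i \<xi> - ?\<beta> * \<eta> ^ (b - 1) * pdiff i \<eta> =
     ?\<alpha> * mvar 0 ^ (a - 1) * pdiff i (mvar 0) - ?\<beta> * mvar 1 ^ (b - 1) * pdiff i (mvar 1)" for i
    using arg_cong[OF eq, of "pdiff i"] by (simp only: pdiff_diff pdiff_mult pdiff_power pdiff_mconst mult_zero_left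
        add_0_left mc[symmetric] mult.assoc)
  have E0: "?\<alpha> * \<xi> ^ (a - 1) * pdiff 0 \<xi> - ?\<beta> * \<eta> ^ (b - 1) * pdiff 0 \<eta> = ?\<alpha> * mvar 0 ^ (a - 1)"
    using E[of 0] by (simp add: pdiff_mvar)
  have E1: "?\<alpha> * \<xi> ^ (a - 1) * pdiff 1 \<xi> - ?\<beta> * \<eta> ^ (b - 1) * pdiff 1 \<eta> = - (?\<beta> * mvar 1 ^ (b - 1))"
    using E[of 1] by (simp add: pdiff_mvar)
  have CX: "?\<alpha> * \<xi> ^ (a - 1) * J = ?\<alpha> * mvar 0 ^ (a - 1) * pdiff 1 \<eta> + ?\<beta> * mvar 1 ^ (b - 1) * pdiff 0 \<eta>"
    unfolding J_def by (rule cramer_2(1)[OF E0 E1])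
  have CY: "?\<beta> * \<eta> ^ (b - 1) * J = ?\<alpha> * mvar 0 ^ (a - 1) * pdiff 1 \<xi> + ?\<beta> * mvar 1 ^ (b - 1) * pdiff 0 \<xi>"
    unfolding J_def by (rule cramer_2(2)[OF E0 E1])
  have lin: "lookup p (single i 1) = lookup (hcomp z_low 0 p) (single i 1)" if "i \<noteq> 2" for i :: 3 and p :: "(3, 'k) mpol"
    using that by (simp add: lookup_hcomp mon_weight_z_low lookup_single when_def)
  have lv: "lookup (mvar j :: (3, 'k) mpol) (single i 1) = (if i = j then 1 else 0)" for i j
    by (auto simp: mvar_def lookup_single when_def single_1_eq_iff simp del: One_nat_def single_one)
  \<comment> \<open>At z = 0 the pair is (x, y), so its linear part is the identity.\<close>
  have "lookup J 0 = 1"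
    by (simp add: J_def lookup_minus lookup_mult_0 lookup_pdiff_0 lin s0 s1 lv del: One_nat_def single_one)
  hence J: "J \<noteq> 0" by auto
  let ?x = "wdeg z_wt \<xi>" and ?y = "wdeg z_wt \<eta>"
  have ge: "0 \<le> ?x" "0 \<le> ?y" using wdeg_z_wt_nonneg nz by auto
  have deg: "int a * ?x = int b * ?y"
    by (rule power_degree_eq[OF _ c nz]) (use fixed eq in \<open>simp add: fixed_by_def\<close>)
  have bound: "(int n - 1) * wdeg z_wt Z \<le> d"
    if "mconst e * Z ^ (n - 1) * J = ?\<alpha> * mvar 0 ^ (a - 1) * pdiff 1 W + ?\<beta> * mvar 1 ^ (b - 1) * pdiff 0 W"
      "deg_le z_wt d W" "e \<noteq> 0" "Z \<noteq> 0" "1 \<le> n" for n e Z W d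
  proof -
    have tfl: "deg_le z_wt 0 (?\<alpha> * mvar 0 ^ (a - 1))" "deg_le z_wt 0 (?\<beta> * mvar 1 ^ (b - 1))"
      unfolding xy_poly_deg_le[symmetric] by (intro xy_poly_mult xy_poly_power xy_poly_mvar xy_poly_mconst; simp)+
    have "deg_le z_wt (0 + d) (?\<alpha> * mvar 0 ^ (a - 1) * pdiff 1 W + ?\<beta> * mvar 1 ^ (b - 1) * pdiff 0 W)"
      by (intro deg_le_add deg_le_mult[OF tfl(1)] deg_le_mult[OF tfl(2)] deg_le_z_wt_pdiff that) auto
    hence "wdeg z_wt (mconst e * Z ^ (n - 1) * J) \<le> d"
      using that J by (intro wdeg_least) auto
    moreover have "wdeg z_wt (mconst e * Z ^ (n - 1) * J) = (int n - 1) * wdeg z_wt Z + wdeg z_wt J"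
      using that(3-5) J by (simp add: wdeg_mult wdeg_mconst wdeg_power nmul_int of_nat_diff)
    ultimately show ?thesis using wdeg_z_wt_nonneg[OF J] by simp
  qed
  have "?x = 0 \<and> ?y = 0"
  proof (cases "of_nat a = (0::'k)")
    case True
    have b: "of_nat b \<noteq> (0::'k)"
    proof
      assume b: "of_nat b = (0::'k)"
      have "CHAR('k) dvd a" "CHAR('k) dvd b"
        using True b by (simp_all add: of_nat_eq_0_iff_char_dvd)
      hence "CHAR('k) dvd 1" using ab(1) by (metis coprime_common_divisor_nat dvd_refl nat_dvd_1_iff_1)
      thus False by (metis of_nat_1 of_nat_eq_0_iff_char_dvd zero_neq_one)
    qed
    have e: "?\<beta> * \<eta> ^ (b - 1) * pdiff 1 \<eta> = ?\<beta> * mvar 1 ^ (b - 1)" using E1 True by simp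
    have p1: "pdiff 1 \<eta> \<noteq> 0" and nz': "?\<beta> \<noteq> 0" using e b c by auto
    have "wdeg z_wt (?\<beta> * \<eta> ^ (b - 1) * pdiff 1 \<eta>) = 0"
      unfolding e by (subst xy_poly_wdeg[symmetric]) (use nz' in \<open>auto intro!: xy_poly_mult xy_poly_power xy_poly_mvar\<close>)
    hence "(int b - 1) * ?y + wdeg z_wt (pdiff 1 \<eta>) = 0"
      using p1 nz' nz ab c by (simp add: wdeg_mult wdeg_mconst wdeg_power nmul_int of_nat_diff)
    hence "(int b - 1) * ?y \<le> 0" using wdeg_z_wt_nonneg[OF p1] by linarith
    hence "?y = 0" using ge ab by (simp add: mult_le_0_iff)
    thus ?thesis using deg ab by simp
  next
    case a: False
    show ?thesis
    proof (cases "of_nat b = (0::'k)")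
      case True
      have e: "?\<alpha> * \<xi> ^ (a - 1) * pdiff 0 \<xi> = ?\<alpha> * mvar 0 ^ (a - 1)" using E0 True by simp
      have p1: "pdiff 0 \<xi> \<noteq> 0" and nz': "?\<alpha> \<noteq> 0" using e a by auto
      have "wdeg z_wt (?\<alpha> * \<xi> ^ (a - 1) * pdiff 0 \<xi>) = 0"
        unfolding e by (subst xy_poly_wdeg[symmetric]) (use nz' in \<open>auto intro!: xy_poly_mult xy_poly_power xy_poly_mvar\<close>)
      hence "(int a - 1) * ?x + wdeg z_wt (pdiff 0 \<xi>) = 0"
        using p1 nz' nz ab a by (simp add: wdeg_mult wdeg_mconst wdeg_power nmul_int of_nat_diff)
      hence "(int a - 1) * ?x \<le> 0" using wdeg_z_wt_nonneg[OF p1] by linarith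
      hence "?x = 0" using ge ab by (simp add: mult_le_0_iff)
      thus ?thesis using deg ab by simp
    next
      case False
      have 1: "(int a - 1) * ?x \<le> ?y" using bound[OF CX wdeg_deg_le] a nz ab by simp
      have 2: "(int b - 1) * ?y \<le> ?x" using bound[OF CY wdeg_deg_le] False c nz ab by simp
      have xy: "?x \<le> ?y" using 1 ge ab mult_right_mono[of 1 "int a - 1" ?x] by simp
      have yx: "?y \<le> ?x" using 2 ge ab mult_right_mono[of 1 "int b - 1" ?y] by simp
      have "a \<noteq> b" using ab by auto
      with deg xy yx show ?thesis by (auto simp: antisym)
    qed
  qed
  hence "xy_poly \<xi>" "xy_poly \<eta>" using xy_poly_wdeg nz by auto
  thus ?thesis using slide_xy_poly[OF s] by (simp add: trivial_slide_def \<xi>_def \<eta>_def)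
qed

section \<open>Weighted degeneration of slides\<close>

text \<open>The least of the quotients \<open>\<delta> x / n x\<close>, compared by cross multiplication because the group
  of weights has no division.\<close>

lemma exists_min_slope:
  fixes \<delta> :: "'a \<Rightarrow> 'g::linordered_ab_group_add" and n :: "'a \<Rightarrow> nat"
  assumes "finite S" "S \<noteq> {}" "\<And>x. x \<in> S \<Longrightarrow> 0 < n x"
  shows "\<exists>x\<in>S. \<forall>y\<in>S. nmul (n y) (\<delta> x) \<le> nmul (n x) (\<delta> y)"
  using assms
proof (induction rule: finite_ne_induct)
  case (insert a F)
  then obtain x where x: "x \<in> F" "\<And>y. y \<in> F \<Longrightarrow> nmul (n y) (\<delta> x) \<le> nmul (n x) (\<delta> y)" by auto
  have swap: "nmul i (nmul j g) = nmul j (nmul i (g::'g))" for i j g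
    by (metis mult.commute nmul_mult)
  show ?case
  proof (cases "nmul (n a) (\<delta> x) \<le> nmul (n x) (\<delta> a)")
    case True
    thus ?thesis using x by auto
  next
    case False
    have "nmul (n y) (\<delta> a) \<le> nmul (n a) (\<delta> y)" if y: "y \<in> F" for y
    proof -
      have "nmul (n x) (nmul (n y) (\<delta> a)) = nmul (n y) (nmul (n x) (\<delta> a))" by (rule swap)
      also have "\<dots> \<le> nmul (n y) (nmul (n a) (\<delta> x))" using False by (intro nmul_mono) simp
      also have "\<dots> = nmul (n a) (nmul (n y) (\<delta> x))" by (rule swap)
      also have "\<dots> \<le> nmul (n a) (nmul (n x) (\<delta> y))" using x y by (intro nmul_mono) simp
      also have "\<dots> = nmul (n x) (nmul (n a) (\<delta> y))" by (rule swap)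
      finally show ?thesis using insert.prems[of x] x by (simp add: nmul_le_iff)
    qed
    thus ?thesis by auto
  qed
qed auto

lemma hcomp_commute: "hcomp v D (hcomp w E p) = hcomp w E (hcomp v D p)"
  by (rule poly_mapping_eqI) (simp add: lookup_hcomp)

text \<open>Give z the largest weight for which each image of a variable still has at most the weight of that
  variable; then the top components form a slide again. A monomial attaining this extremal weight
  survives, so the new slide is not trivial, and an invariant passes to its initial form.\<close>

theorem graded_slide:
  fixes \<phi> :: "3 \<Rightarrow> (3, 'r::comm_ring_1) mpol" and w :: "3 \<Rightarrow> 'g::linordered_ab_group_add"
  assumes s: "slide \<phi>" and nt: "\<not> trivial_slide \<phi>" and f: "fixed_by \<phi> f"
  obtains \<psi> where "slide \<psi>" "\<not> trivial_slide \<psi>" "fixed_by \<psi> (hcomp w (wdeg w f) f)"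
proof -
  \<comment> \<open>The slope of a monomial of \<open>\<phi> i\<close> that contains z is \<open>w i\<close> minus its weight in x and y, divided by its exponent of z.\<close>
  define u where "u m = nmul (lookup m 0) (w 0) + nmul (lookup m 1) (w 1)" for m :: "3 mon"
  define S where "S = Sigma {0, 1 :: 3} (\<lambda>i. {m \<in> keys (\<phi> i). 0 < lookup m 2})"
  have S_iff: "(i, m) \<in> S \<longleftrightarrow> (i = 0 \<or> i = 1) \<and> m \<in> keys (\<phi> i) \<and> lookup m 2 \<noteq> 0" for i m
    by (simp add: S_def)
  have "finite S" by (auto simp: S_def)
  moreover have "S \<noteq> {}"
  proof
    assume "S = {}"
    hence "(i, m) \<notin> S" for i m by blast
    hence "xy_poly (\<phi> 0)" "xy_poly (\<phi> 1)" unfolding xy_poly_def S_iff by blast+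
    hence "trivial_slide \<phi>" using slide_xy_poly[OF s, of 0] slide_xy_poly[OF s, of 1] by (simp add: trivial_slide_def)
    with nt show False ..
  qed
  ultimately obtain x where x: "x \<in> S" "\<And>y. y \<in> S \<Longrightarrow>
      nmul (lookup (snd y) 2) (w (fst x) - u (snd x)) \<le> nmul (lookup (snd x) 2) (w (fst y) - u (snd y))"
    using exists_min_slope[of S "\<lambda>x. lookup (snd x) 2" "\<lambda>x. w (fst x) - u (snd x)"] S_iff
    by (metis (no_types, lifting) gr0I prod.collapse)
  obtain i0 m0 where x_eq: "x = (i0, m0)" by (cases x)
  define j where "j = lookup m0 2"
  define \<tau> where "\<tau> = w i0 - u m0"
  \<comment> \<open>The smallest slope is \<open>\<tau> / j\<close>; multiplying all weights by \<open>j\<close> removes the denominator.\<close>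
  define v where "v i = (if i = 2 then \<tau> else nmul j (w i))" for i
  have i0: "i0 = 0 \<or> i0 = 1" "m0 \<in> keys (\<phi> i0)" "0 < j" using x(1) by (auto simp: S_iff x_eq j_def)
  have min: "nmul (lookup m 2) \<tau> \<le> nmul j (w i - u m)" if "i = 0 \<or> i = 1" "m \<in> keys (\<phi> i)" "0 < lookup m 2" for i m
    using x(2)[of "(i, m)"] that by (simp add: S_iff x_eq \<tau>_def j_def)
  have wv: "mon_weight v m = nmul j (u m) + nmul (lookup m 2) \<tau>" for m
    by (simp add: mon_weight_3 v_def u_def nmul_add_right flip: nmul_mult) (simp add: mult.commute)
  have ww: "mon_weight w m = u m" if "lookup m 2 = 0" for m
    using that by (simp add: mon_weight_3 u_def)
  have d01: "deg_le v (v i) (\<phi> i)" if i: "i = 0 \<or> i = 1" for i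
    unfolding deg_le_def
  proof
    fix m assume m: "m \<in> keys (\<phi> i)"
    show "mon_weight v m \<le> v i"
    proof (cases "lookup m 2 = 0")
      case True
      have "hcomp z_low 0 (\<phi> i) = mvar i" using s i by (auto simp: slide_def)
      moreover have "m \<in> keys (hcomp z_low 0 (\<phi> i))" using m True by (simp add: keys_hcomp mon_weight_z_low)
      ultimately have "m = single i 1" by (simp add: mvar_def)
      thus ?thesis by (simp add: mon_weight_single del: One_nat_def)
    next
      case False
      thus ?thesis using min[OF i m] i by (auto simp: wv v_def nmul_diff_right algebra_simps)
    qed
  qed
  have d: "deg_le v (v i) (\<phi> i)" for i
    using d01[of i] s deg_le_mvar[of v 2] by (cases i rule: exhaust_3) (auto simp: slide_def)
  define \<psi> where "\<psi> i = hcomp v (v i) (\<phi> i)" for i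
  have "slide \<psi>"
    using s by (simp add: slide_def \<psi>_def hcomp_commute[of z_low] hcomp_mvar)
  moreover have "\<not> trivial_slide \<psi>"
  proof
    assume "trivial_slide \<psi>"
    hence "\<psi> i0 = mvar i0" using i0 by (auto simp: trivial_slide_def)
    moreover have "m0 \<in> keys (\<psi> i0)"
      using i0 by (auto simp: \<psi>_def keys_hcomp wv \<tau>_def v_def nmul_diff_right simp flip: j_def)
    ultimately have "m0 = single i0 1" by (simp add: mvar_def)
    thus False using i0 by (auto simp: j_def lookup_single when_def)
  qed
  moreover have "fixed_by \<psi> (hcomp w (wdeg w f) f)"
  proof -
    have tff: "xy_poly f" and sf: "subst \<phi> f = f" using f by (auto simp: fixed_by_def)
    define D where "D = nmul j (wdeg w f)"
    have wt: "mon_weight v m = nmul j (mon_weight w m)" if "m \<in> keys f" for m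
      using tff that by (simp add: xy_poly_def wv ww)
    have "deg_le v D f" using wdeg_deg_le[of w f] by (auto simp: deg_le_def wt D_def nmul_mono)
    hence "hcomp v D (subst \<phi> f) = subst \<psi> (hcomp v D f)"
      unfolding \<psi>_def by (rule hcomp_subst[OF d])
    moreover have "hcomp v D f = hcomp w (wdeg w f) f"
    proof (rule poly_mapping_eqI)
      fix m
      show "lookup (hcomp v D f) m = lookup (hcomp w (wdeg w f) f) m"
        using i0(3) by (cases "m \<in> keys f") (auto simp: lookup_hcomp wt D_def nmul_eq_iff in_keys_iff)
    qed
    moreover have "xy_poly (hcomp w (wdeg w f) f)" using tff by (auto simp: xy_poly_def keys_hcomp)
    ultimately show ?thesis by (simp add: fixed_by_def sf)
  qed
  ultimately show thesis by (rule that)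
qed

section \<open>Factors of weighted homogeneous polynomials in x and y\<close>

text \<open>Up to constant factors, these are the irreducible weighted homogeneous polynomials in x and y over
  an algebraically closed field.\<close>

definition prime_form :: "(3 \<Rightarrow> 'g::linordered_ab_group_add) \<Rightarrow> (3, 'k::field) mpol \<Rightarrow> bool" where
  "prime_form w H \<longleftrightarrow> H = mvar 0 \<or> H = mvar 1 \<or>
     (\<exists>a b c. 1 \<le> a \<and> 1 \<le> b \<and> coprime a b \<and> c \<noteq> 0 \<and> nmul a (w 0) = nmul b (w 1) \<and>
        H = mvar 0 ^ a - mconst c * mvar 1 ^ b)"

lemma lookup_mvar_power: "lookup (mvar i ^ n) m = (1 when m = single i n)"
  by (auto simp: mvar_power lookup_single when_def)

lemma mconst_mult_lookup: "lookup (mconst c * p) m = c * lookup p m"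
proof -
  have "mconst c * p = Poly_Mapping.map ((*) c) p" unfolding mconst_def by (rule mult_map_scale_conv_mult[symmetric])
  thus ?thesis by (simp add: Poly_Mapping.map.rep_eq when_def)
qed

lemma single_eq_0_iff: "single i n = 0 \<longleftrightarrow> n = 0"
  by (metis lookup_single_eq lookup_zero single_zero)

lemma single_eq_single_iff: "0 < n \<Longrightarrow> single i n = single j m \<longleftrightarrow> i = j \<and> n = (m::nat)"
  by (metis keys_single lookup_single_eq neq0_conv singleton_inject insert_not_empty)

lemma binomial_neq_0:
  "1 \<le> a \<Longrightarrow> mvar 0 ^ a - mconst c * mvar 1 ^ b \<noteq> (0 :: (3, 'k::field) mpol)"
proof
  assume "1 \<le> a" "mvar 0 ^ a - mconst c * mvar 1 ^ b = (0 :: (3, 'k::field) mpol)"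
  hence "lookup (mvar 0 ^ a - mconst c * mvar 1 ^ b :: (3, 'k) mpol) (single 0 a) = 0" by simp
  with \<open>1 \<le> a\<close> show False
    by (simp add: lookup_minus mconst_mult_lookup lookup_mvar_power single_eq_single_iff when_def)
qed

lemma prime_form_neq_0: "prime_form w H \<Longrightarrow> H \<noteq> 0"
  unfolding prime_form_def using binomial_neq_0 mvar_neq_0 by metis

lemma coprime_cross:
  fixes a b c d :: nat
  assumes "coprime a b" "coprime c d" "a * d = c * b"
  shows "a = c \<and> b = d"
proof -
  have "a dvd c" using assms by (metis coprime_dvd_mult_left_iff dvd_triv_left)
  moreover have "c dvd a" using assms by (metis coprime_dvd_mult_left_iff dvd_triv_left)
  ultimately have "a = c" by (rule dvd_antisym)
  moreover have "b dvd d" using assms by (metis coprime_commute coprime_dvd_mult_right_iff dvd_triv_right)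
  moreover have "d dvd b" using assms by (metis coprime_commute coprime_dvd_mult_right_iff dvd_triv_right)
  ultimately show ?thesis by (simp add: dvd_antisym)
qed

text \<open>Two different such forms generate a ring over which x and y are integral, so a slide fixing both
  moves nothing: from x and \<open>x^a - c y^b\<close> one recovers a power of y, and from two binomials of the
  same weight, whose exponents agree by coprimality, also a power of y.\<close>

lemma fixed_prime_form_unique:
  fixes \<phi> :: "3 \<Rightarrow> (3, 'k::field) mpol" and w :: "3 \<Rightarrow> 'g::linordered_ab_group_add"
  assumes s: "slide \<phi>" "\<not> trivial_slide \<phi>" and w: "0 < w 0" "0 < w 1"
    and H: "prime_form w H" "fixed_by \<phi> H" and G: "prime_form w G" "fixed_by \<phi> G"
  shows "H = G"
proof (rule ccontr)
  assume ne: "H \<noteq> G"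
  have root: "fixed_by \<phi> (mvar i)" if "fixed_by \<phi> (mconst c * mvar i ^ n)" "1 \<le> n" "c \<noteq> 0" for i c n
  proof -
    have "fixed_by \<phi> (mvar i ^ n)" using fixed_by_factor(2)[OF s(1) that(1)] that by simp
    thus ?thesis using fixed_by_root[OF s(1)] that by simp
  qed
  have x_only: "trivial_slide \<phi>" if "fixed_by \<phi> (mvar 0)" "prime_form w F" "fixed_by \<phi> F" "F \<noteq> mvar 0" for F
  proof -
    have "fixed_by \<phi> (mvar 1)" if "1 \<le> b" "c \<noteq> 0" "F = mvar 0 ^ a - mconst c * mvar 1 ^ b" for a b c
    proof -
      have "fixed_by \<phi> (mvar 0 ^ a - F)"
        by (intro fixed_by_diff fixed_by_power) fact+
      thus ?thesis using root[of c 1 b] that by simp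
    qed
    thus ?thesis using that by (auto simp: prime_form_def trivial_slide_fixed)
  qed
  have y_only: "trivial_slide \<phi>" if "fixed_by \<phi> (mvar 1)" "prime_form w F" "fixed_by \<phi> F" "F \<noteq> mvar 1" for F
  proof -
    have "fixed_by \<phi> (mvar 0)" if "1 \<le> a" "c \<noteq> 0" "F = mvar 0 ^ a - mconst c * mvar 1 ^ b" for a b c
    proof -
      have "fixed_by \<phi> (F - (0 - mconst c) * mvar 1 ^ b)"
        by (intro fixed_by_diff fixed_by_mult fixed_by_power fixed_by_mconst fixed_by_mconst[of \<phi> 0, simplified]) fact+
      thus ?thesis using root[of 1 0 a] that by simp
    qed
    thus ?thesis using that by (auto simp: prime_form_def trivial_slide_fixed)
  qed
  consider "H = mvar 0 \<or> G = mvar 0" | "H = mvar 1 \<or> G = mvar 1" |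
    a b c a' b' c' where "1 \<le> a" "1 \<le> b" "coprime a b" "c \<noteq> 0" "nmul a (w 0) = nmul b (w 1)" "H = mvar 0 ^ a - mconst c * mvar 1 ^ b"
      "coprime a' b'" "c' \<noteq> 0" "nmul a' (w 0) = nmul b' (w 1)" "G = mvar 0 ^ a' - mconst c' * mvar 1 ^ b'"
    using H(1) G(1) unfolding prime_form_def by blast
  thus False
  proof cases
    case 1 thus False using x_only[of H] x_only[of G] ne s H G by auto
  next
    case 2 thus False using y_only[of H] y_only[of G] ne s H G by auto
  next
    case (3 a b c a' b' c')
    have "nmul (a * b') (w 0) = nmul b' (nmul a (w 0))" by (metis mult.commute nmul_mult)
    also have "\<dots> = nmul b' (nmul b (w 1))" by (simp only: 3)
    also have "\<dots> = nmul b (nmul b' (w 1))" by (metis mult.commute nmul_mult)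
    also have "\<dots> = nmul b (nmul a' (w 0))" by (simp only: 3)
    also have "\<dots> = nmul (a' * b) (w 0)" by (metis mult.commute nmul_mult)
    finally have "a * b' = a' * b" using w by (simp add: nmul_left_eq_iff)
    hence ab: "a = a'" "b = b'" using coprime_cross 3 by blast+
    have "c \<noteq> c'" using ne ab 3 by auto
    moreover have "fixed_by \<phi> (H - G)" by (intro fixed_by_diff H G)
    moreover have "H - G = mconst (c' - c) * mvar 1 ^ b"
      using ab 3 by (simp add: ring_morph_simps[OF ring_morph_mconst] algebra_simps)
    ultimately have "fixed_by \<phi> (mvar 1)" using root[of "c' - c" 1 b] 3 by simp
    thus False using y_only[of H] y_only[of G] ne s H G by auto
  qed
qed

lemma mvar_dvd:
  assumes "\<And>m. m \<in> keys p \<Longrightarrow> lookup m i \<noteq> 0"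
  shows "mvar i dvd p"
proof -
  have "single m c = mvar i * single (m - single i 1) c" if "lookup m i \<noteq> 0" for m :: "'a mon" and c :: 'b
    using minus_single_add_single[OF that] by (simp add: mvar_def mult_single add.commute del: One_nat_def)
  hence "mvar i dvd single m (lookup p m)" if "m \<in> keys p" for m
    using assms[OF that] by (metis dvd_triv_left)
  hence "mvar i dvd (\<Sum>m\<in>keys p. single m (lookup p m))" by (rule dvd_sum)
  thus ?thesis by (simp flip: mpol_expand)
qed

lemma nmul_uminus: "nmul n (- g) = - nmul n g"
  by (induction n) auto

lemma mon_weight_uminus: "mon_weight (\<lambda>i. - w i) m = - mon_weight w m"
  by (simp add: mon_weight_nmul nmul_uminus sum_negf)

text \<open>The highest weight of a product is the sum of the highest weights of its factors, and the lowest
  weight (the degree for the negated weights) is additive in the same way. Highest and lowest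
  weight of the product agree, so they agree for each factor.\<close>

lemma homogeneous_factor:
  fixes p q :: "('n::{finite,linorder}, 'r::idom) mpol"
  assumes h: "hcomp w D (p * q) = p * q" and nz: "p \<noteq> 0" "q \<noteq> 0"
  shows "hcomp w (D - wdeg w p) q = q"
proof -
  let ?w = "\<lambda>i. - w i"
  have nzpq: "p * q \<noteq> 0" using nz by simp
  have all: "mon_weight w m = D" if "m \<in> keys (p * q)" for m using hcomp_weight[OF h that] .
  have "wdeg w (p * q) = D" using wdeg_attained[OF nzpq, of w] all by auto
  hence 1: "wdeg w p + wdeg w q = D" by (simp add: wdeg_mult nz)
  have "wdeg ?w (p * q) = - D" using wdeg_attained[OF nzpq, of ?w] all by (auto simp: mon_weight_uminus)
  hence 2: "wdeg ?w p + wdeg ?w q = - D" by (simp add: wdeg_mult nz)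
  obtain m0 where m0: "m0 \<in> keys p" "mon_weight w m0 = wdeg w p" using wdeg_attained[OF nz(1)] by blast
  have p: "- wdeg ?w p \<le> wdeg w p" using wdeg_ge[OF m0(1), of ?w] m0(2) by (simp add: mon_weight_uminus minus_le_iff)
  have "wdeg ?w q = - D - wdeg ?w p" using 2 by (simp add: eq_diff_eq add.commute)
  hence low: "- wdeg ?w q = D + wdeg ?w p" by simp
  have up: "wdeg w q = D - wdeg w p" using 1 by (simp add: eq_diff_eq add.commute)
  have "- wdeg w p \<le> wdeg ?w p" using p by (simp add: minus_le_iff)
  hence le: "D - wdeg w p \<le> - wdeg ?w q" unfolding low using add_left_mono[of "- wdeg w p" "wdeg ?w p" D] by simp
  have "mon_weight w m = D - wdeg w p" if m: "m \<in> keys q" for m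
  proof (rule antisym)
    show "mon_weight w m \<le> D - wdeg w p" using wdeg_ge[OF m, of w] up by simp
    have "- wdeg ?w q \<le> mon_weight w m" using wdeg_ge[OF m, of ?w] by (simp add: mon_weight_uminus minus_le_iff)
    with le show "D - wdeg w p \<le> mon_weight w m" by (rule order_trans)
  qed
  thus ?thesis by (rule hcomp_id)
qed

lemma diff_dvd_power_diff: "(x::'a::comm_ring_1) - y dvd x ^ n - y ^ n"
proof (induction n)
  case (Suc n)
  have "x ^ Suc n - y ^ Suc n = x * (x ^ n - y ^ n) + (x - y) * y ^ n" by (simp add: algebra_simps)
  with Suc show ?case by simp
qed simp

lemma single_3: "lookup m 2 = 0 \<Longrightarrow> single m c = mconst c * (mvar 0 ^ lookup m 0 * mvar 1 ^ lookup (m :: 3 mon) 1)"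
  by (subst single_expand) (simp add: prod_3)

text \<open>A homogeneous polynomial divisible by neither x nor y contains pure powers \<open>x^A\<close> and \<open>y^B\<close>. With
  \<open>g = gcd A B\<close> all its monomials are products of g factors \<open>u = x^(A/g)\<close> and \<open>v = y^(B/g)\<close>, so it
  is a binary form in u and v, and a root z of its dehomogenization yields the factor \<open>u - z v\<close>.\<close>

theorem homogeneous_has_prime_form:
  fixes P :: "(3, 'k::alg_closed_field) mpol" and w :: "3 \<Rightarrow> 'g::linordered_ab_group_add"
  assumes w: "0 < w 0" "0 < w 1" and P: "xy_poly P" "hcomp w D P = P" "P \<noteq> 0" "D \<noteq> 0"
  obtains H where "prime_form w H" "H dvd P"
proof (cases "mvar 0 dvd P \<or> mvar 1 dvd P")
  case True
  thus ?thesis using that by (auto simp: prime_form_def)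
next
  case False
  then obtain mA mB where m: "mA \<in> keys P" "lookup mA 1 = 0" "mB \<in> keys P" "lookup mB 0 = 0"
    using mvar_dvd[of P 0] mvar_dvd[of P 1] by metis
  have wt: "nmul (lookup m 0) (w 0) + nmul (lookup m 1) (w 1) = D" and t: "lookup m 2 = 0" if "m \<in> keys P" for m
    using hcomp_weight[OF P(2) that] P(1) that by (auto simp: mon_weight_3 xy_poly_def)
  define A where "A = lookup mA 0"
  define B where "B = lookup mB 1"
  have A: "nmul A (w 0) = D" and B: "nmul B (w 1) = D" using wt[OF m(1)] wt[OF m(3)] m by (auto simp: A_def B_def)
  have pos: "0 < A" "0 < B" using A B P(4) by (auto intro!: gr0I)
  define g where "g = gcd A B"
  have "gcd A B \<noteq> 0" using pos by simp
  then obtain a b where ab: "A = a * g" "B = b * g" "coprime a b"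
    unfolding g_def using gcd_coprime_exists by blast
  have gp: "0 < g" "0 < a" "0 < b" using pos ab by auto
  have w_ab: "nmul a (w 0) = nmul b (w 1)"
  proof -
    have "nmul g (nmul a (w 0)) = nmul g (nmul b (w 1))"
      using A B by (simp add: ab mult.commute flip: nmul_mult)
    thus ?thesis using gp by (simp add: nmul_eq_iff)
  qed
  define mon where "mon s = single (0::3) (a * s) + single 1 (b * (g - s))" for s
  have mon_lookup: "lookup (mon s) 0 = a * s" "lookup (mon s) 1 = b * (g - s)" "lookup (mon s) 2 = 0" for s
    by (auto simp: mon_def lookup_add lookup_single when_def)
  have inj: "inj_on mon {..g}"
  proof (rule inj_onI)
    fix s s' assume "mon s = mon s'"
    hence "a * s = a * s'" by (metis mon_lookup(1))
    thus "s = s'" using gp by simp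
  qed
  have keys: "keys P \<subseteq> mon ` {..g}"
  proof
    fix m assume mk: "m \<in> keys P"
    define i where "i = lookup m 0"
    define j where "j = lookup m 1"
    have e: "nmul i (w 0) + nmul j (w 1) = nmul A (w 0)" using wt[OF mk] A by (simp add: i_def j_def)
    have "nmul i (w 0) \<le> nmul A (w 0)" using e nmul_nonneg[of "w 1" j] w by (metis le_add_same_cancel1 less_imp_le)
    hence iA: "i \<le> A" using w by (simp add: nmul_left_le_iff)
    have "nmul j (w 1) = nmul (A - i) (w 0)" using e nmul_add[of i "A - i" "w 0"] iA by (metis add_left_cancel le_add_diff_inverse)
    hence "nmul (b * (A - i)) (w 0) = nmul b (nmul j (w 1))" by (simp add: nmul_mult)
    also have "\<dots> = nmul j (nmul b (w 1))" by (metis mult.commute nmul_mult)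
    also have "\<dots> = nmul (j * a) (w 0)" by (simp add: nmul_mult w_ab)
    finally have bj: "b * (A - i) = j * a" using w by (simp add: nmul_left_eq_iff)
    hence "a dvd A - i" using ab(3) by (metis coprime_dvd_mult_right_iff dvd_triv_right)
    then obtain t where t': "A - i = a * t" by auto
    hence "a * t \<le> a * g" using ab by (metis diff_le_self mult.commute)
    hence tg: "t \<le> g" using gp by simp
    have "i = a * (g - t)" using t' iA ab tg by (simp add: diff_mult_distrib2 mult.commute)
    moreover have "j = b * (g - (g - t))" using bj t' tg gp by (simp add: mult.commute mult.left_commute)
    ultimately have "m = mon (g - t)"
      using t[OF mk] by (intro mon_eqI_3) (simp_all add: mon_lookup i_def j_def)
    thus "m \<in> mon ` {..g}" by auto
  qed
  define c where "c s = lookup P (mon s)" for s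
  let ?u = "mvar 0 ^ a :: (3, 'k) mpol" and ?v = "mvar 1 ^ b :: (3, 'k) mpol"
  have "P = (\<Sum>m\<in>keys P. single m (lookup P m))" by (rule mpol_expand)
  also have "\<dots> = (\<Sum>m\<in>mon ` {..g}. single m (lookup P m))"
    by (rule sum.mono_neutral_left) (use keys in \<open>auto simp: in_keys_iff\<close>)
  also have "\<dots> = (\<Sum>s\<le>g. single (mon s) (c s))" by (simp add: sum.reindex[OF inj] c_def)
  also have "\<dots> = (\<Sum>s\<le>g. mconst (c s) * (?u ^ s * ?v ^ (g - s)))"
    by (simp add: single_3 mon_lookup power_mult)
  finally have P_eq: "P = (\<Sum>s\<le>g. mconst (c s) * (?u ^ s * ?v ^ (g - s)))" .
  have "mA = mon g" using m t[OF m(1)] ab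
    by (intro mon_eqI_3) (simp_all add: mon_lookup A_def)
  hence cg: "c g \<noteq> 0" using m by (simp add: c_def in_keys_iff)
  have "mB = mon 0" using m t[OF m(3)] ab
    by (intro mon_eqI_3) (simp_all add: mon_lookup B_def)
  hence c0: "c 0 \<noteq> 0" using m by (simp add: c_def in_keys_iff)
  \<comment> \<open>The coefficient of the top power is that of \<open>x^A\<close>, and the constant term, that of \<open>y^B\<close>, excludes the root 0.\<close>
  obtain z where z: "(\<Sum>s\<le>g. c s * z ^ s) = 0" using alg_closed[of g c] gp cg by blast
  have "z \<noteq> 0"
  proof
    assume "z = 0"
    with z have "(\<Sum>s\<le>g. if s = 0 then c s else 0) = 0" by (simp add: power_0_left if_distrib cong: if_cong)
    thus False using c0 by simp
  qed
  let ?H = "?u - mconst z * ?v"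
  have "(\<Sum>s\<le>g. mconst (c s) * ((mconst z * ?v) ^ s * ?v ^ (g - s))) = (\<Sum>s\<le>g. mconst (c s * z ^ s) * ?v ^ g)"
  proof (rule sum.cong[OF refl])
    fix s assume "s \<in> {..g}"
    hence "?v ^ s * ?v ^ (g - s) = ?v ^ g" by (simp flip: power_add)
    thus "mconst (c s) * ((mconst z * ?v) ^ s * ?v ^ (g - s)) = mconst (c s * z ^ s) * ?v ^ g"
      by (simp add: power_mult_distrib ring_morph_simps[OF ring_morph_mconst] mult.assoc)
  qed
  also have "\<dots> = mconst (\<Sum>s\<le>g. c s * z ^ s) * ?v ^ g"
    by (simp only: ring_morph_sum[OF ring_morph_mconst] sum_distrib_right)
  finally have zero: "(\<Sum>s\<le>g. mconst (c s) * ((mconst z * ?v) ^ s * ?v ^ (g - s))) = 0" by (simp add: z)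
  have "P = (\<Sum>s\<le>g. mconst (c s) * ((?u ^ s - (mconst z * ?v) ^ s) * ?v ^ (g - s)))"
    using P_eq zero by (simp add: algebra_simps sum_subtractf)
  moreover have "?H dvd (\<Sum>s\<le>g. mconst (c s) * ((?u ^ s - (mconst z * ?v) ^ s) * ?v ^ (g - s)))"
    by (intro dvd_sum dvd_mult dvd_mult2 diff_dvd_power_diff)
  ultimately have "?H dvd P" by simp
  moreover have "prime_form w ?H"
    unfolding prime_form_def using gp ab w_ab \<open>z \<noteq> 0\<close> by (intro disjI2 exI[of _ a] exI[of _ b] exI[of _ z]) auto
  ultimately show ?thesis using that by blast
qed

text \<open>With positive weights only the constant monomial has weight at most 0.\<close>

lemma homogeneous_0_const:
  assumes w: "0 < w 0" "0 < w 1" and P: "xy_poly P" "deg_le w 0 P"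
  shows "\<exists>c. P = mconst c"
proof -
  have "m = 0" if "m \<in> keys P" for m
  proof -
    have t: "lookup m 2 = 0" using P that by (auto simp: xy_poly_def)
    have "nmul (lookup m 0) (w 0) + nmul (lookup m 1) (w 1) \<le> 0"
      using P(2) that t by (auto simp: deg_le_def mon_weight_3)
    moreover have "0 \<le> nmul (lookup m 0) (w 0)" "0 \<le> nmul (lookup m 1) (w 1)" using w by (auto intro: nmul_nonneg)
    ultimately have "nmul (lookup m 0) (w 0) = 0 \<and> nmul (lookup m 1) (w 1) = 0"
      by (metis add_nonneg_eq_0_iff add_nonneg_nonneg antisym)
    hence "lookup m 0 = 0" "lookup m 1 = 0" using nmul_pos w by (metis gr0I less_irrefl)+
    thus ?thesis using t by (intro mon_eqI_3) auto
  qed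
  hence "keys P \<subseteq> {0}" by blast
  hence "P = single 0 (lookup P 0)"
    by (intro poly_mapping_eqI) (auto simp: lookup_single when_def in_keys_iff)
  thus ?thesis by (auto simp: mconst_def)
qed

abbreviation (input) total :: "'n \<Rightarrow> int" where "total \<equiv> \<lambda>_. 1"

lemma mon_weight_total: "mon_weight total m \<ge> 0"
  by (auto simp: mon_weight_nmul intro!: sum_nonneg nmul_nonneg)
lemma wdeg_total_nonneg: "p \<noteq> 0 \<Longrightarrow> wdeg total p \<ge> 0"
  using wdeg_attained[of p total] mon_weight_total by metis
lemma wdeg_total_pos:
  assumes "m \<in> keys p" "m \<noteq> 0" shows "wdeg total p \<ge> 1"
proof -
  obtain i where "lookup m i \<noteq> 0" using assms by (metis lookup_zero poly_mapping_eqI)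
  hence "1 \<le> nmul (lookup m i) (1::int)" by (simp add: nmul_int)
  also have "\<dots> \<le> (\<Sum>i\<in>UNIV. nmul (lookup m i) 1)" by (rule member_le_sum) (auto simp: nmul_nonneg)
  finally show ?thesis using wdeg_ge[OF assms(1), of total] by (simp add: mon_weight_nmul)
qed

lemma prime_form_total_pos: "prime_form w H \<Longrightarrow> wdeg total H \<ge> 1"
proof -
  assume "prime_form w H"
  then consider i where "H = mvar i" | a b c where "1 \<le> a" "H = mvar 0 ^ a - mconst c * mvar 1 ^ b"
    by (auto simp: prime_form_def)
  thus ?thesis
  proof cases
    case 1 thus ?thesis by (simp add: wdeg_mvar)
  next
    case 2
    have "lookup H (single 0 a) \<noteq> 0"
      using 2 by (simp add: lookup_minus mconst_mult_lookup lookup_mvar_power single_eq_single_iff when_def)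
    moreover have "single (0::3) a \<noteq> 0" using 2 by (simp add: single_eq_0_iff)
    ultimately show ?thesis using wdeg_total_pos[of _ H] by (auto simp: in_keys_iff)
  qed
qed

text \<open>Every irreducible factor of an invariant is invariant, and there is only one invariant irreducible
  form, so the factorization involves a single form.\<close>

lemma fixed_homogeneous:
  fixes \<phi> :: "3 \<Rightarrow> (3, 'k::alg_closed_field) mpol" and w :: "3 \<Rightarrow> 'g::linordered_ab_group_add"
  assumes s: "slide \<phi>" "\<not> trivial_slide \<phi>" and w: "0 < w 0" "0 < w 1"
    and H: "prime_form w H" "fixed_by \<phi> H"
    and P: "hcomp w D P = P" "P \<noteq> 0" "fixed_by \<phi> P"
  shows "\<exists>c n. c \<noteq> 0 \<and> P = mconst c * H ^ n"
  using P
proof (induction "nat (wdeg total P)" arbitrary: P D rule: less_induct)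
  case less
  have tP: "xy_poly P" using less by (simp add: fixed_by_def)
  show ?case
  proof (cases "D = 0")
    case True
    hence "deg_le w 0 P" using less.prems deg_le_hcomp[of w D P] by simp
    then obtain c where "P = mconst c" using homogeneous_0_const[OF w tP] by auto
    thus ?thesis using less.prems by (intro exI[of _ c] exI[of _ 0]) auto
  next
    case False
    then obtain G Q where G: "prime_form w G" "P = G * Q"
      using homogeneous_has_prime_form[OF w tP less.prems(1,2)] by (metis dvdE)
    have nz: "G \<noteq> 0" "Q \<noteq> 0" using G less.prems by auto
    have fx: "fixed_by \<phi> G" "fixed_by \<phi> Q"
      using fixed_by_factor[OF s(1), of G Q] less.prems nz G by auto
    have GH: "G = H" using fixed_prime_form_unique[OF s w G(1) fx(1) H] .
    have "hcomp w (D - wdeg w G) Q = Q" using homogeneous_factor[OF _ nz] less.prems G by simp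
    moreover have "nat (wdeg total Q) < nat (wdeg total P)"
      using G nz prime_form_total_pos[OF G(1)] wdeg_total_nonneg[OF nz(2)] by (simp add: wdeg_mult)
    ultimately obtain c n where "c \<noteq> 0" "Q = mconst c * H ^ n"
      using less.hyps[of Q "D - wdeg w G"] nz fx by auto
    thus ?thesis using G GH by (intro exI[of _ c] exI[of _ "Suc n"]) (simp add: algebra_simps)
  qed
qed

section \<open>Initial forms of coordinates of the plane\<close>

definition inverse_tuples :: "('n \<Rightarrow> ('n::finite, 'r::comm_ring_1) mpol) \<Rightarrow> ('n \<Rightarrow> ('n, 'r) mpol) \<Rightarrow> bool" where
  "inverse_tuples \<sigma> \<rho> \<longleftrightarrow> (\<forall>i. subst \<sigma> (\<rho> i) = mvar i) \<and> (\<forall>i. subst \<rho> (\<sigma> i) = mvar i)"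

text \<open>The components 0 and 1 of such a tuple form a tuple in the two variables x and y.\<close>

definition planar :: "(3 \<Rightarrow> (3, 'r::comm_ring_1) mpol) \<Rightarrow> bool" where
  "planar \<sigma> \<longleftrightarrow> xy_poly (\<sigma> 0) \<and> xy_poly (\<sigma> 1) \<and> \<sigma> 2 = mvar 2"

text \<open>Weighted homogeneous forms that are coordinates of the plane: one of the two exponents is 1.\<close>

definition coordinate_form :: "(3 \<Rightarrow> 'g::linordered_ab_group_add) \<Rightarrow> (3, 'k::field) mpol \<Rightarrow> bool" where
  "coordinate_form w H \<longleftrightarrow> H = mvar 0 \<or> H = mvar 1 \<or>
     (\<exists>a b c. 1 \<le> a \<and> 1 \<le> b \<and> (a = 1 \<or> b = 1) \<and> c \<noteq> 0 \<and> nmul a (w 0) = nmul b (w 1) \<and>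
        H = mvar 0 ^ a - mconst c * mvar 1 ^ b)"

lemma subst_inverse:
  assumes "inverse_tuples \<sigma> \<rho>" shows "subst \<sigma> (subst \<rho> p) = p" "subst \<rho> (subst \<sigma> p) = p"
  using assms by (simp_all add: inverse_tuples_def subst_subst subst_mvar)

lemma inverse_tuples_not_const:
  assumes "inverse_tuples \<sigma> \<rho>" shows "\<sigma> i \<noteq> mconst c"
proof
  assume "\<sigma> i = mconst c"
  hence "mvar i = mconst c" using assms by (metis inverse_tuples_def subst_simps(10))
  hence "lookup (mvar i) (single i 1) = lookup (mconst c) (single i 1)" by simp
  thus False by (simp add: mvar_def mconst_def lookup_single when_def single_eq_0_iff)
qed

text \<open>Translate the component other than \<open>k\<close> by z and keep component \<open>k\<close>: in terms of the original
  variables this is a slide fixing \<open>\<sigma> k\<close>.\<close>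

lemma coordinate_slide:
  fixes \<sigma> \<rho> :: "3 \<Rightarrow> (3, 'r::comm_ring_1) mpol"
  assumes inv: "inverse_tuples \<sigma> \<rho>" and pl: "planar \<sigma>" "planar \<rho>" and k: "k \<noteq> 2"
  obtains \<phi> where "slide \<phi>" "\<not> trivial_slide \<phi>" "fixed_by \<phi> (\<sigma> k)"
proof -
  obtain l :: 3 where l: "l \<noteq> 2" "l \<noteq> k"
  proof (cases "k = 0")
    case True thus thesis using that[of 1] by simp
  next
    case False thus thesis using that[of 0] by simp
  qed
  have tfk: "xy_poly (\<sigma> i)" if "i \<noteq> 2" for i using pl that by (cases i rule: exhaust_3) (auto simp: planar_def)
  define \<tau> where "\<tau> = \<sigma>(l := \<sigma> l + mvar 2)"
  define \<phi> where "\<phi> = (\<lambda>i. subst \<tau> (\<rho> i))"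
  have \<tau>2: "\<tau> 2 = mvar 2" using pl l by (simp add: \<tau>_def planar_def)
  have sub: "subst \<phi> (\<sigma> i) = \<tau> i" for i
  proof -
    have "subst \<tau> (subst \<rho> (\<sigma> i)) = \<tau> i" using inv by (simp add: inverse_tuples_def subst_simps)
    thus ?thesis by (simp add: subst_subst \<phi>_def)
  qed
  have tau_z_low: "hcomp z_low (z_low i) (\<tau> i) = \<sigma> i" "deg_le z_low (z_low i) (\<tau> i)" for i
  proof -
    have 0: "hcomp z_low 0 (mvar 2 :: (3, 'r) mpol) = 0"
      by (rule hcomp_deg_lt) (simp add: deg_lt_def mvar_def mon_weight_z_low)
    show "hcomp z_low (z_low i) (\<tau> i) = \<sigma> i"
    proof (cases "i = 2")
      case True thus ?thesis using \<tau>2 pl hcomp_mvar[of z_low 2] by (simp add: planar_def)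
    next
      case False
      hence "z_low i = 0" by (simp add: z_low_def)
      thus ?thesis using tfk[OF False] by (auto simp: \<tau>_def hcomp_add 0 xy_poly_hcomp)
    qed
    show "deg_le z_low (z_low i) (\<tau> i)"
      using \<tau>2 deg_le_mvar[of z_low 2] deg_le_z_low by (cases i rule: exhaust_3) auto
  qed
  have "hcomp z_low 0 (\<phi> i) = mvar i" if "i \<noteq> 2" for i
    using hcomp_subst[of z_low z_low \<tau> 0 "\<rho> i"] tau_z_low deg_le_z_low that pl inv
    by (cases i rule: exhaust_3) (auto simp: \<phi>_def planar_def xy_poly_hcomp inverse_tuples_def)
  moreover have "\<phi> 2 = mvar 2" using pl \<tau>2 by (simp add: \<phi>_def planar_def subst_simps)
  ultimately have s: "slide \<phi>" by (simp add: slide_def)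
  have "\<not> trivial_slide \<phi>"
  proof
    assume "trivial_slide \<phi>"
    hence "\<phi> i = mvar i" for i using \<open>\<phi> 2 = mvar 2\<close> by (cases i rule: exhaust_3) (auto simp: trivial_slide_def)
    hence "subst \<phi> (\<sigma> l) = subst mvar (\<sigma> l)" by (intro subst_cong)
    hence "\<tau> l = \<sigma> l" by (simp add: sub subst_mvar)
    thus False by (simp add: \<tau>_def)
  qed
  moreover have "fixed_by \<phi> (\<sigma> k)" using tfk[OF k] sub[of k] l by (simp add: fixed_by_def \<tau>_def)
  ultimately show thesis using s by (intro that[of \<phi>])
qed

text \<open>The slide fixing a coordinate degenerates to one fixing its initial form, so that form is a power
  of an irreducible form, and \<open>binomial_rigidity\<close> leaves only forms with an exponent 1.\<close>

theorem coordinate_initial_form: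
  fixes \<sigma> \<rho> :: "3 \<Rightarrow> (3, 'k::alg_closed_field) mpol" and w :: "3 \<Rightarrow> 'g::linordered_ab_group_add"
  assumes inv: "inverse_tuples \<sigma> \<rho>" and pl: "planar \<sigma>" "planar \<rho>" and w: "0 < w 0" "0 < w 1"
    and k: "k \<noteq> 2"
  obtains H c n where "coordinate_form w H" "c \<noteq> 0" "1 \<le> n" "hcomp w (wdeg w (\<sigma> k)) (\<sigma> k) = mconst c * H ^ n"
proof -
  have tfk: "xy_poly (\<sigma> i)" if "i \<noteq> 2" for i using pl that by (cases i rule: exhaust_3) (auto simp: planar_def)
  obtain \<phi> where \<phi>: "slide \<phi>" "\<not> trivial_slide \<phi>" "fixed_by \<phi> (\<sigma> k)"
    using coordinate_slide[OF inv pl k] .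
  obtain \<psi> where \<psi>: "slide \<psi>" "\<not> trivial_slide \<psi>" "fixed_by \<psi> (hcomp w (wdeg w (\<sigma> k)) (\<sigma> k))"
    using graded_slide[OF \<phi>] .
  define D where "D = wdeg w (\<sigma> k)"
  define P where "P = hcomp w D (\<sigma> k)"
  have nz: "\<sigma> k \<noteq> 0" using inverse_tuples_not_const[OF inv, of k 0] by simp
  hence P0: "P \<noteq> 0" unfolding P_def D_def by (rule init_form_nonzero)
  have D0: "D \<noteq> 0"
  proof
    assume "D = 0"
    hence "deg_le w 0 (\<sigma> k)" using wdeg_deg_le[of w "\<sigma> k"] by (simp add: D_def)
    thus False using homogeneous_0_const[OF w tfk[OF k]] inverse_tuples_not_const[OF inv] by metis
  qed
  have PP: "hcomp w D P = P" by (simp add: P_def hcomp_hcomp)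
  have fP: "fixed_by \<psi> P" using \<psi> by (simp add: P_def D_def)
  hence tP: "xy_poly P" by (simp add: fixed_by_def)
  obtain H Q where HQ: "prime_form w H" "P = H * Q" using homogeneous_has_prime_form[OF w tP PP P0 D0] by (metis dvdE)
  have fH: "fixed_by \<psi> H" using fixed_by_factor(1)[OF \<psi>(1), of H Q] HQ P0 fP by auto
  obtain c n where cn: "c \<noteq> 0" "P = mconst c * H ^ n" using fixed_homogeneous[OF \<psi>(1,2) w HQ(1) fH PP P0 fP] by auto
  have "n \<noteq> 0"
  proof
    assume "n = 0"
    hence "wdeg w P = 0" using cn by (simp add: wdeg_mconst)
    moreover have "wdeg w P = D" by (rule wdeg_eqI) (use PP P0 deg_le_hcomp[of w D] in \<open>auto simp: P_def\<close>)
    ultimately show False using D0 by simp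
  qed
  moreover have "coordinate_form w H"
  proof -
    consider "H = mvar 0" | "H = mvar 1" | a b e where "1 \<le> a" "1 \<le> b" "coprime a b" "e \<noteq> 0" "nmul a (w 0) = nmul b (w 1)"
        "H = mvar 0 ^ a - mconst e * mvar 1 ^ b" using HQ(1) by (auto simp: prime_form_def)
    thus ?thesis
    proof cases
      case (3 a b e)
      have "a = 1 \<or> b = 1"
      proof (rule ccontr)
        assume "\<not> (a = 1 \<or> b = 1)"
        hence "2 \<le> a" "2 \<le> b" using 3 by auto
        thus False using binomial_rigidity[OF \<psi>(1), of a e b] fH 3 \<psi>(2) by auto
      qed
      thus ?thesis using 3 unfolding coordinate_form_def by blast
    qed (auto simp: coordinate_form_def)
  qed
  ultimately show thesis by (intro that[of H c n]) (use cn in \<open>auto simp: P_def D_def\<close>)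
qed

section \<open>Degrees of automorphisms of the plane\<close>

text \<open>The pattern comes from components with leading forms \<open>H^s\<close> and \<open>H^(s u)\<close>. If H involves both x and
  y, or if a component of degree \<open>E\<close> involves both, then \<open>E\<close> is a multiple of one weight and at
  least the other. If the component of degree \<open>E\<close> involves only one variable, it is affine in it,
  and the other component, of degree \<open>F\<close>, involves the other variable.\<close>

definition chain :: "(3 \<Rightarrow> 'g::linordered_ab_group_add) \<Rightarrow> 'g \<Rightarrow> 'g \<Rightarrow> bool" where
  "chain w E F \<longleftrightarrow> (\<exists>u\<ge>1. F = nmul u E \<and>
     ((\<exists>s\<ge>1. E = nmul s (w 0) \<and> w 1 \<le> E) \<or> (\<exists>s\<ge>1. E = nmul s (w 1) \<and> w 0 \<le> E) \<or>
      (E = w 0 \<and> w 1 \<le> F) \<or> (E = w 1 \<and> w 0 \<le> F)))"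

definition planar_degrees :: "(3 \<Rightarrow> 'g::linordered_ab_group_add) \<Rightarrow> 'g \<Rightarrow> 'g \<Rightarrow> bool" where
  "planar_degrees w E F \<longleftrightarrow> (E = w 0 \<and> F = w 1) \<or> (E = w 1 \<and> F = w 0) \<or> chain w E F \<or> chain w F E"

lemma xy_poly_subst_cong: "xy_poly p \<Longrightarrow> \<tau> 0 = \<tau>' 0 \<Longrightarrow> \<tau> 1 = \<tau>' 1 \<Longrightarrow> subst \<tau> p = subst \<tau>' p"
  unfolding peval_def by (intro sum.cong refl arg_cong[where f = "(*) _"]) (simp add: prod_3 xy_poly_def)

lemma xy_poly_subst:
  assumes "xy_poly p" "xy_poly (\<tau> 0)" "xy_poly (\<tau> 1)" shows "xy_poly (subst \<tau> p)"
proof -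
  have "deg_le z_wt 0 (subst (\<tau>(2 := 0)) p)"
  proof (rule deg_le_subst[where w = "\<lambda>_. 0"])
    show "deg_le z_wt 0 ((\<tau>(2 := 0)) i)" for i
      using assms by (cases i rule: exhaust_3) (simp_all flip: xy_poly_deg_le)
    show "deg_le (\<lambda>_. 0) 0 p" by (simp add: deg_le_def mon_weight_nmul)
  qed
  moreover have "subst (\<tau>(2 := 0)) p = subst \<tau> p" by (rule xy_poly_subst_cong) (use assms in simp_all)
  ultimately show ?thesis by (simp add: xy_poly_deg_le)
qed

lemma inverse_tuples_sym: "inverse_tuples \<sigma> \<rho> \<Longrightarrow> inverse_tuples \<rho> \<sigma>"
  by (simp add: inverse_tuples_def)

lemma inverse_tuples_compose:
  assumes "inverse_tuples \<sigma> \<rho>" "inverse_tuples \<eta> \<theta>"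
  shows "inverse_tuples (\<lambda>i. subst \<rho> (\<eta> i)) (\<lambda>i. subst \<theta> (\<sigma> i))"
  unfolding inverse_tuples_def
proof (intro conjI allI)
  fix i
  have "subst (\<lambda>i. subst \<rho> (\<eta> i)) (subst \<theta> (\<sigma> i)) = subst \<rho> (subst \<eta> (subst \<theta> (\<sigma> i)))"
    by (simp only: subst_subst)
  thus "subst (\<lambda>i. subst \<rho> (\<eta> i)) (subst \<theta> (\<sigma> i)) = mvar i"
    using assms by (simp add: subst_inverse[OF assms(2)] inverse_tuples_def)
  have "subst (\<lambda>i. subst \<theta> (\<sigma> i)) (subst \<rho> (\<eta> i)) = subst \<theta> (subst \<sigma> (subst \<rho> (\<eta> i)))"
    by (simp only: subst_subst)
  thus "subst (\<lambda>i. subst \<theta> (\<sigma> i)) (subst \<rho> (\<eta> i)) = mvar i"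
    using assms by (simp add: subst_inverse[OF assms(1)] inverse_tuples_def)
qed

lemma inverse_tuples_mvar: "inverse_tuples mvar mvar"
  by (simp add: inverse_tuples_def subst_simps)

definition rename :: "('n \<Rightarrow> 'n) \<Rightarrow> 'n \<Rightarrow> ('n::finite, 'r::comm_ring_1) mpol" where
  "rename \<pi> i = mvar (\<pi> i)"

lemma inverse_tuples_rename:
  assumes "\<And>i. \<pi> (\<pi> i) = i" shows "inverse_tuples (rename \<pi>) (rename \<pi>)"
  by (simp add: inverse_tuples_def rename_def subst_simps assms)

lemma planar_mvar: "planar mvar"
  by (simp add: planar_def xy_poly_mvar)

lemma coordinate_form_coordinate:
  fixes H :: "(3, 'k::field) mpol"
  assumes "coordinate_form w H"
  obtains \<eta> \<theta> k where "inverse_tuples \<eta> \<theta>" "planar \<eta>" "planar \<theta>" "k \<noteq> 2" "\<eta> k = H"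
proof -
  have "(\<exists>k. k \<noteq> 2 \<and> H = mvar k) \<or> (\<exists>b c. c \<noteq> 0 \<and> H = mvar 0 - mconst c * mvar 1 ^ b) \<or>
      (\<exists>a c. c \<noteq> 0 \<and> H = mvar 0 ^ a - mconst c * mvar 1)"
    using assms unfolding coordinate_form_def
  proof (elim disjE exE conjE)
    assume "H = mvar 0" thus ?thesis by (intro disjI1 exI[of _ 0]) simp
  next
    assume "H = mvar 1" thus ?thesis by (intro disjI1 exI[of _ 1]) simp
  next
    fix a b :: nat and c assume "c \<noteq> 0" "H = mvar 0 ^ a - mconst c * mvar 1 ^ b" "a = 1"
    thus ?thesis by (intro disjI2 disjI1 exI[of _ b] exI[of _ c]) simp
  next
    fix a b :: nat and c assume "c \<noteq> 0" "H = mvar 0 ^ a - mconst c * mvar 1 ^ b" "b = 1"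
    thus ?thesis by (intro disjI2 exI[of _ a] exI[of _ c]) simp
  qed
  then consider k where "k \<noteq> 2" "H = mvar k" |
    b c where "c \<noteq> 0" "H = mvar 0 - mconst c * mvar 1 ^ b" |
    a c where "c \<noteq> 0" "H = mvar 0 ^ a - mconst c * mvar 1" by metis
  thus thesis
  proof cases
    case (1 k)
    thus ?thesis using that[of mvar mvar k] by (simp add: inverse_tuples_mvar planar_mvar)
  next
    case (2 b c)
    let ?\<eta> = "mvar(0 := H)" and ?\<theta> = "mvar(0 := mvar 0 + mconst c * mvar 1 ^ b)"
    have "inverse_tuples ?\<eta> ?\<theta>" unfolding inverse_tuples_def
      using 2 by (auto simp: subst_simps)
    moreover have "planar ?\<eta>" "planar ?\<theta>"
      using 2 by (auto simp: planar_def intro!: xy_poly_mvar xy_poly_add xy_poly_diff xy_poly_mult xy_poly_power)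
    ultimately show ?thesis using that[of ?\<eta> ?\<theta> 0] by simp
  next
    case (3 a c)
    have c: "mconst c * mconst (inverse c) = (1 :: (3, 'k) mpol)"
      using 3 by (simp flip: ring_morph_mult[OF ring_morph_mconst])
    let ?\<eta> = "mvar(1 := H)" and ?\<theta> = "mvar(1 := mconst (inverse c) * (mvar 0 ^ a - mvar 1))"
    have "inverse_tuples ?\<eta> ?\<theta>" unfolding inverse_tuples_def
      using 3 c by (auto simp: subst_simps simp flip: mult.assoc) (simp add: mult.commute)
    moreover have "planar ?\<eta>" "planar ?\<theta>"
      using 3 by (auto simp: planar_def intro!: xy_poly_mvar xy_poly_add xy_poly_diff xy_poly_mult xy_poly_power)
    ultimately show ?thesis using that[of ?\<eta> ?\<theta> 1] by simp
  qed
qed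

lemma coordinate_form_prime_form: "coordinate_form w H \<Longrightarrow> prime_form w H"
  unfolding coordinate_form_def prime_form_def by (metis coprime_1_left coprime_1_right)

lemma binomial_homogeneous:
  fixes w :: "3 \<Rightarrow> 'g::linordered_ab_group_add" and c :: "'k::field"
  assumes "nmul a (w 0) = nmul b (w 1)"
  shows "hcomp w (nmul a (w 0)) (mvar 0 ^ a - mconst c * mvar 1 ^ b) = mvar 0 ^ a - mconst c * mvar 1 ^ b"
proof -
  have "hcomp w (nmul a (w 0)) (mvar 0 ^ a) = (mvar 0 ^ a :: (3, 'k) mpol)"
    by (simp add: hcomp_power deg_le_mvar hcomp_mvar)
  moreover have "hcomp w (nmul b (w 1)) (mconst c * mvar 1 ^ b) = (mconst c * mvar 1 ^ b :: (3, 'k) mpol)"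
    using hcomp_mult[of w 0 "mconst c" "nmul b (w 1)" "mvar 1 ^ b", OF deg_le_mconst deg_le_power[OF deg_le_mvar]]
    by (simp add: hcomp_power deg_le_mvar hcomp_mvar hcomp_mconst)
  ultimately show ?thesis by (simp add: hcomp_diff assms)
qed

lemma prime_form_weight:
  fixes H :: "(3, 'k::field) mpol" and w :: "3 \<Rightarrow> 'g::linordered_ab_group_add"
  assumes w: "0 < w 0" "0 < w 1" and H: "prime_form w H"
  shows "hcomp w (wdeg w H) H = H" "wdeg w H > 0"
    "H = mvar 0 \<and> wdeg w H = w 0 \<or> H = mvar 1 \<and> wdeg w H = w 1 \<or>
      (\<exists>a b c. 1 \<le> a \<and> 1 \<le> b \<and> H = mvar 0 ^ a - mconst c * mvar 1 ^ b \<and> wdeg w H = nmul a (w 0) \<and> wdeg w H = nmul b (w 1))"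
proof -
  have "\<exists>D. hcomp w D H = H \<and> (H = mvar 0 \<and> D = w 0 \<or> H = mvar 1 \<and> D = w 1 \<or>
      (\<exists>a b c. 1 \<le> a \<and> 1 \<le> b \<and> H = mvar 0 ^ a - mconst c * mvar 1 ^ b \<and> D = nmul a (w 0) \<and> D = nmul b (w 1)))"
    using H unfolding prime_form_def
  proof (elim disjE exE conjE)
    assume "H = mvar 0"
    thus ?thesis using hcomp_mvar[of w 0] by blast
  next
    assume "H = mvar 1"
    thus ?thesis using hcomp_mvar[of w 1] by blast
  next
    fix a b c assume *: "1 \<le> a" "1 \<le> b" "nmul a (w 0) = nmul b (w 1)" "H = mvar 0 ^ a - mconst c * mvar 1 ^ b"
    hence "hcomp w (nmul a (w 0)) H = H" using binomial_homogeneous by blast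
    thus ?thesis using * by (intro exI[of _ "nmul a (w 0)"]) blast
  qed
  then obtain D where D: "hcomp w D H = H" "H = mvar 0 \<and> D = w 0 \<or> H = mvar 1 \<and> D = w 1 \<or>
      (\<exists>a b c. 1 \<le> a \<and> 1 \<le> b \<and> H = mvar 0 ^ a - mconst c * mvar 1 ^ b \<and> D = nmul a (w 0) \<and> D = nmul b (w 1))" by blast
  have "deg_le w D H" using deg_le_hcomp[of w D H] D(1) by simp
  hence wD: "wdeg w H = D" by (rule wdeg_eqI) (use D(1) prime_form_neq_0[OF H] in simp)
  show "hcomp w (wdeg w H) H = H" using D wD by simp
  show "wdeg w H > 0" unfolding wD using D(2) w nmul_pos[of _ "w 0"] by (metis less_le_trans zero_less_one)
  show "H = mvar 0 \<and> wdeg w H = w 0 \<or> H = mvar 1 \<and> wdeg w H = w 1 \<or>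
      (\<exists>a b c. 1 \<le> a \<and> 1 \<le> b \<and> H = mvar 0 ^ a - mconst c * mvar 1 ^ b \<and> wdeg w H = nmul a (w 0) \<and> wdeg w H = nmul b (w 1))"
    unfolding wD by (rule D(2))
qed

lemma le_nmul: "1 \<le> n \<Longrightarrow> 0 < g \<Longrightarrow> g \<le> nmul n g"
  using nmul_left_le_iff[of g 1 n] by simp

text \<open>A form of exponent 1 is a coordinate, so some nontrivial slide fixes it. That slide fixes the
  common power up to constants, hence also the other form, and it cannot fix two forms.\<close>

lemma prime_form_power_unique:
  fixes w :: "3 \<Rightarrow> 'g::linordered_ab_group_add" and H G :: "(3, 'k::field) mpol"
  assumes w: "0 < w 0" "0 < w 1" and H: "coordinate_form w H" and G: "prime_form w G"
    and eq: "mconst u * H ^ i = mconst v * G ^ j" "v \<noteq> 0" "1 \<le> j"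
  shows "H = G"
proof -
  obtain \<eta> \<theta> k where \<eta>: "inverse_tuples \<eta> \<theta>" "planar \<eta>" "planar \<theta>" "k \<noteq> 2" "\<eta> k = H"
    using coordinate_form_coordinate[OF H] .
  obtain \<phi> where \<phi>: "slide \<phi>" "\<not> trivial_slide \<phi>" "fixed_by \<phi> H"
    using coordinate_slide[OF \<eta>(1-4)] \<eta>(5) by metis
  have G0: "G \<noteq> 0" using prime_form_neq_0[OF G] .
  have "fixed_by \<phi> (mconst v * G ^ j)" unfolding eq(1)[symmetric]
    by (intro fixed_by_mult fixed_by_power fixed_by_mconst \<phi>)
  hence "fixed_by \<phi> (G ^ j)" using fixed_by_factor(2)[OF \<phi>(1), of "mconst v" "G ^ j"] G0 eq by simp
  hence "fixed_by \<phi> G" using fixed_by_root[OF \<phi>(1), of G j] G0 eq by simp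
  thus ?thesis using fixed_prime_form_unique[OF \<phi>(1,2) w coordinate_form_prime_form[OF H] \<phi>(3) G] by simp
qed

lemma wdeg_hcomp: "p \<noteq> 0 \<Longrightarrow> wdeg w (hcomp w (wdeg w p) p) = wdeg w p"
  by (rule wdeg_eqI[OF deg_le_hcomp]) (simp add: hcomp_hcomp init_form_nonzero)

lemma const_multiple_mvar: "mvar (i::3) = mconst e * mvar j \<Longrightarrow> i = (j::3)"
proof (rule ccontr)
  assume "mvar i = mconst e * mvar j" "i \<noteq> j"
  hence "lookup (mvar i) (single i 1) = lookup (mconst e * mvar j) (single i (1::nat))" by simp
  thus False using \<open>i \<noteq> j\<close>
    by (simp add: mconst_mult_lookup) (simp add: mvar_def lookup_single when_def single_eq_single_iff split: if_splits)
qed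

lemma keys_subset_0_const: "keys p \<subseteq> {0} \<Longrightarrow> \<exists>c. p = mconst c"
  by (intro exI[of _ "lookup p 0"] poly_mapping_eqI) (auto simp: lookup_single when_def mconst_def in_keys_iff)

text \<open>Over an algebraically closed field a polynomial in \<open>mvar i\<close> alone is divisible by \<open>mvar i\<close> minus a
  constant. The inverse automorphism maps the polynomial to a variable, which has no proper
  factors, so the cofactor is constant.\<close>

lemma univariate_coordinate:
  fixes \<sigma> \<rho> :: "3 \<Rightarrow> (3, 'k::alg_closed_field) mpol" and w :: "3 \<Rightarrow> 'g::linordered_ab_group_add"
  assumes inv: "inverse_tuples \<sigma> \<rho>" and w: "0 < w i"
    and uni: "\<And>m j. m \<in> keys (\<sigma> k) \<Longrightarrow> j \<noteq> i \<Longrightarrow> lookup m j = 0"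
  shows "wdeg w (\<sigma> k) = w i"
proof -
  define p where "p = \<sigma> k"
  have mono: "m = single i (lookup m i)" if "m \<in> keys p" for m
    by (rule poly_mapping_eqI) (use uni that in \<open>auto simp: p_def lookup_single when_def\<close>)
  have p0: "p \<noteq> 0" using inverse_tuples_not_const[OF inv, of k 0] by (simp add: p_def)
  define N where "N = Max ((\<lambda>m. lookup m i) ` keys p)"
  have le_N: "lookup m i \<le> N" if "m \<in> keys p" for m using that by (simp add: N_def)
  have "N \<in> (\<lambda>m. lookup m i) ` keys p" unfolding N_def by (rule Max_in) (use p0 in auto)
  then obtain mN where mN: "mN \<in> keys p" "lookup mN i = N" by auto
  define c where "c t = lookup p (single i t)" for t
  have "c N \<noteq> 0" using mono[OF mN(1)] mN by (simp add: c_def in_keys_iff)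
  have inj: "inj_on (single i) {..N}"
    by (rule inj_onI) (metis lookup_single_eq)
  have sub: "keys p \<subseteq> single i ` {..N}" using mono le_N by (metis atMost_iff image_eqI subsetI)
  have "p = (\<Sum>m\<in>keys p. single m (lookup p m))" by (rule mpol_expand)
  also have "\<dots> = (\<Sum>m\<in>single i ` {..N}. single m (lookup p m))"
    by (rule sum.mono_neutral_left) (use sub in \<open>auto simp: in_keys_iff\<close>)
  also have "\<dots> = (\<Sum>t\<le>N. mconst (c t) * mvar i ^ t)"
    by (simp add: sum.reindex[OF inj] c_def mvar_power mconst_def mult_single)
  finally have p_eq: "p = (\<Sum>t\<le>N. mconst (c t) * mvar i ^ t)" .
  have "N > 0"
  proof (rule gr0I)
    assume "N = 0"
    hence "p = mconst (c 0)" using p_eq by simp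
    thus False using inverse_tuples_not_const[OF inv] by (simp add: p_def)
  qed
  then obtain z where z: "(\<Sum>t\<le>N. c t * z ^ t) = 0" using alg_closed[of N c] \<open>c N \<noteq> 0\<close> by blast
  hence "mconst (\<Sum>t\<le>N. c t * z ^ t) = (0 :: (3, 'k) mpol)" by simp
  hence z': "(\<Sum>t\<le>N. mconst (c t) * mconst z ^ t) = (0 :: (3, 'k) mpol)"
    by (simp only: ring_morph_simps[OF ring_morph_mconst])
  have "p = (\<Sum>t\<le>N. mconst (c t) * (mvar i ^ t - mconst z ^ t))"
    using z' p_eq by (simp add: right_diff_distrib sum_subtractf)
  moreover have "mvar i - mconst z dvd (\<Sum>t\<le>N. mconst (c t) * (mvar i ^ t - mconst z ^ t))"
    by (intro dvd_sum dvd_mult diff_dvd_power_diff)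
  ultimately obtain q where q: "p = (mvar i - mconst z) * q" by (auto elim: dvdE)
  have "mvar k = (\<rho> i - mconst z) * subst \<rho> q"
    using arg_cong[OF q, of "subst \<rho>"] inv by (simp add: p_def inverse_tuples_def subst_simps)
  hence deg: "wdeg total ((\<rho> i - mconst z) * subst \<rho> q) = 1" by (metis wdeg_mvar)
  have nz: "\<rho> i - mconst z \<noteq> 0" using inverse_tuples_not_const[OF inverse_tuples_sym[OF inv], of i z] by simp
  have nzq: "subst \<rho> q \<noteq> 0" using q p0 subst_inverse(1)[OF inv, of q] by (auto simp: subst_simps)
  have "\<exists>m. m \<in> keys (\<rho> i - mconst z) \<and> m \<noteq> 0"
  proof (rule ccontr)
    assume "\<not> ?thesis"
    hence "keys (\<rho> i - mconst z) \<subseteq> {0}" by auto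
    then obtain v where "\<rho> i - mconst z = mconst v" using keys_subset_0_const by blast
    hence "\<rho> i = mconst v + mconst z" by (simp add: diff_eq_eq)
    hence "\<rho> i = mconst (v + z)" by (simp only: ring_morph_add[OF ring_morph_mconst])
    thus False using inverse_tuples_not_const[OF inverse_tuples_sym[OF inv]] by blast
  qed
  hence "wdeg total (\<rho> i - mconst z) \<ge> 1" using wdeg_total_pos by blast
  hence "wdeg total (subst \<rho> q) \<le> 0" using deg unfolding wdeg_mult[OF nz nzq] by linarith
  have "keys (subst \<rho> q) \<subseteq> {0}"
  proof
    fix m assume "m \<in> keys (subst \<rho> q)"
    thus "m \<in> {0}" using wdeg_total_pos[of m "subst \<rho> q"] \<open>wdeg total (subst \<rho> q) \<le> 0\<close> by force
  qed
  then obtain e where e: "subst \<rho> q = mconst e" using keys_subset_0_const by blast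
  have "q = mconst e" using subst_inverse(1)[OF inv, of q] by (simp add: e subst_simps)
  moreover from this have "e \<noteq> 0" using q p0 by auto
  moreover have "wdeg w (mvar i - mconst z :: (3, 'k) mpol) = w i"
  proof (rule wdeg_eqI)
    show "deg_le w (w i) (mvar i - mconst z :: (3, 'k) mpol)"
      using w by (intro deg_le_diff deg_le_mvar deg_le_mono[OF deg_le_mconst]) auto
    have "hcomp w (w i) (mconst z :: (3, 'k) mpol) = 0" by (rule hcomp_deg_lt[OF deg_le_imp_deg_lt[OF deg_le_mconst w]])
    thus "hcomp w (w i) (mvar i - mconst z :: (3, 'k) mpol) \<noteq> 0" by (simp add: hcomp_diff hcomp_mvar)
  qed
  moreover have "mvar i - mconst z \<noteq> (0 :: (3, 'k) mpol)" using q p0 by auto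
  ultimately show ?thesis using q by (simp add: p_def wdeg_mult wdeg_mconst)
qed

text \<open>Otherwise the variable \<open>j\<close> would not occur in the image of any polynomial.\<close>

lemma not_both_univariate:
  fixes \<sigma> \<rho> :: "3 \<Rightarrow> (3, 'r::comm_ring_1) mpol"
  assumes inv: "inverse_tuples \<sigma> \<rho>" and pl: "planar \<sigma>" and j: "j \<noteq> 2"
  obtains k m where "k \<noteq> 2" "m \<in> keys (\<sigma> k)" "lookup m j \<noteq> 0"
proof (rule ccontr)
  assume a: "\<not> thesis"
  define v :: "3 \<Rightarrow> int" where "v = (\<lambda>i. if i = j then 1 else 0)"
  have mw: "mon_weight v m = int (lookup m j)" for m
    by (simp add: mon_weight_nmul v_def if_distrib nmul_int cong: if_cong)
  have "deg_le v 0 (\<sigma> i)" for i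
  proof (cases "i = 2")
    case True thus ?thesis using pl j by (simp add: planar_def deg_le_def mvar_def mw lookup_single when_def)
  next
    case False
    thus ?thesis using that a by (auto simp: deg_le_def mw)
  qed
  hence "deg_le v 0 (subst \<sigma> (\<rho> j))"
    by (rule deg_le_subst[where w = "\<lambda>_. 0"]) (simp add: deg_le_def mon_weight_nmul)
  hence "deg_le v 0 (mvar j :: (3, 'r) mpol)" using inv by (simp add: inverse_tuples_def)
  thus False by (simp add: deg_le_def mvar_def mw)
qed

text \<open>The degree of a composite is the expected one whenever the initial forms do not cancel.\<close>

lemma substituted_initial_form:
  assumes "q = subst (\<lambda>i. hcomp w (wdeg w (\<sigma> i)) (\<sigma> i)) (hcomp (\<lambda>i. wdeg w (\<sigma> i)) D Z)" "q \<noteq> 0"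
    and "deg_le (\<lambda>i. wdeg w (\<sigma> i)) D Z"
  shows "wdeg w (subst \<sigma> Z) = D" "hcomp w D (subst \<sigma> Z) = q"
proof -
  show h: "hcomp w D (subst \<sigma> Z) = q" using hcomp_subst[OF wdeg_deg_le assms(3)] assms(1) by simp
  show "wdeg w (subst \<sigma> Z) = D"
    by (rule wdeg_eqI[OF deg_le_subst[OF wdeg_deg_le assms(3)]]) (simp only: h, rule assms(2))
qed

text \<open>This is the weighted counterpart of the Jung--van der Kulk theorem, valid in every characteristic.
  The initial forms of the two components are \<open>c H^n\<close> and \<open>c' H'^n'\<close> for forms of exponent 1. If
  \<open>H = H'\<close>, then \<open>H\<close> expressed in the two components is a coordinate Z of the plane of the
  components. The initial form of Z for the weights \<open>(n, n')\<close> is again a power of a form of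
  exponent 1. A binomial form has an exponent 1, so that one of \<open>n\<close>, \<open>n'\<close> divides the other; a
  variable means that the initial forms do not cancel in Z, and then H itself shows that the
  corresponding exponent is 1. If \<open>H \<noteq> H'\<close>, initial forms never cancel, and the expressions
  of x and y by the components show that the degrees are the two weights.\<close>

theorem planar_automorphism_degrees:
  fixes \<sigma> \<rho> :: "3 \<Rightarrow> (3, 'k::alg_closed_field) mpol" and w :: "3 \<Rightarrow> 'g::linordered_ab_group_add"
  assumes inv: "inverse_tuples \<sigma> \<rho>" and pl: "planar \<sigma>" "planar \<rho>" and w: "0 < w 0" "0 < w 1"
  shows "planar_degrees w (wdeg w (\<sigma> 0)) (wdeg w (\<sigma> 1))"
proof -
  define d where "d = (\<lambda>i. wdeg w (\<sigma> i))"
  define \<tau> where "\<tau> = (\<lambda>i. hcomp w (d i) (\<sigma> i))"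
  have "\<exists>H c n. coordinate_form w H \<and> c \<noteq> 0 \<and> 1 \<le> n \<and> \<tau> k = mconst c * H ^ n" if "k \<noteq> 2" for k
    using coordinate_initial_form[OF inv pl w that] unfolding \<tau>_def d_def by metis
  then obtain H c n where Hf: "coordinate_form w (H k)" and c: "c k \<noteq> 0" and n: "1 \<le> n k"
    and \<tau>: "\<tau> k = mconst (c k) * H k ^ n k" if "k \<noteq> 2" for k by metis
  have H0: "H k \<noteq> 0" if "k \<noteq> 2" for k using prime_form_neq_0[OF coordinate_form_prime_form[OF Hf[OF that]]] .
  have s0: "\<sigma> k \<noteq> 0" for k using inverse_tuples_not_const[OF inv, of k 0] by simp
  have d_eq: "d k = nmul (n k) (wdeg w (H k))" if "k \<noteq> 2" for k
  proof -
    have "d k = wdeg w (\<tau> k)" by (simp add: \<tau>_def d_def wdeg_hcomp s0)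
    thus ?thesis using c[OF that] H0[OF that] by (simp add: \<tau>[OF that] wdeg_mult wdeg_mconst wdeg_power)
  qed
  have Hpos: "0 < wdeg w (H k)" if "k \<noteq> 2" for k using prime_form_weight(2)[OF w coordinate_form_prime_form[OF Hf[OF that]]] .
  have dpos: "0 < d k" if "k \<noteq> 2" for k
    using nmul_pos[of "n k"] n[OF that] Hpos[OF that] by (simp add: d_eq[OF that])
  have ne: "(0::3) \<noteq> 2" "(1::3) \<noteq> 2" by simp_all
  have d01: "0 < d 0" "0 < d 1" using dpos ne by auto
  have \<tau>0: "\<tau> k \<noteq> 0" if "k \<noteq> 2" for k using c[OF that] H0[OF that] by (simp add: \<tau>[OF that])
  show ?thesis
  proof (cases "H 0 = H 1")
    case True
    define h where "h = H 0"
    have h: "H k = h" if "k \<noteq> 2" for k using True that by (cases k rule: exhaust_3) (simp_all add: h_def)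
    have ph: "coordinate_form w h" using Hf[OF ne(1)] by (simp add: h_def)
    obtain \<eta> \<theta> k where \<eta>: "inverse_tuples \<eta> \<theta>" "planar \<eta>" "planar \<theta>" "k \<noteq> 2" "\<eta> k = h"
      using coordinate_form_coordinate[OF ph] .
    \<comment> \<open>\<open>\<zeta> k\<close> is the polynomial Z in the two components whose value is the form \<open>h\<close>.\<close>
    define \<zeta> where "\<zeta> = (\<lambda>i. subst \<rho> (\<eta> i))"
    define \<zeta>' where "\<zeta>' = (\<lambda>i. subst \<theta> (\<sigma> i))"
    have inv_\<zeta>: "inverse_tuples \<zeta> \<zeta>'" unfolding \<zeta>_def \<zeta>'_def by (rule inverse_tuples_compose[OF inv \<eta>(1)])
    have pl_\<zeta>: "planar \<zeta>" "planar \<zeta>'"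
      using pl \<eta> by (auto simp: planar_def \<zeta>_def \<zeta>'_def subst_simps intro!: xy_poly_subst)
    obtain G e r where G: "coordinate_form d G" "e \<noteq> 0" "1 \<le> r" "hcomp d (wdeg d (\<zeta> k)) (\<zeta> k) = mconst e * G ^ r"
      using coordinate_initial_form[OF inv_\<zeta> pl_\<zeta> d01 \<eta>(4)] .
    have h_back: "subst \<sigma> (\<zeta> k) = h" using \<eta>(5) by (simp add: \<zeta>_def subst_inverse[OF inv])
    have one: "n i = 1" if i: "i \<noteq> 2" "G = mvar i" for i
    proof -
      define q where "q = mconst e * \<tau> i ^ r"
      have q0: "q \<noteq> 0" using G \<tau>0[OF i(1)] by (simp add: q_def)
      have q: "q = subst (\<lambda>i. hcomp w (wdeg w (\<sigma> i)) (\<sigma> i)) (hcomp (\<lambda>i. wdeg w (\<sigma> i)) (wdeg d (\<zeta> k)) (\<zeta> k))"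
        using G(4) i by (simp add: q_def \<tau>_def subst_simps flip: d_def)
          (simp add: d_def subst_simps)
      have "deg_le (\<lambda>i. wdeg w (\<sigma> i)) (wdeg d (\<zeta> k)) (\<zeta> k)" unfolding d_def[symmetric] by (rule wdeg_deg_le)
      from substituted_initial_form[OF q q0 this]
      have "hcomp w (wdeg w h) h = q" by (simp add: h_back)
      hence "h = mconst e * (mconst (c i) * h ^ n i) ^ r"
        using prime_form_weight(1)[OF w coordinate_form_prime_form[OF ph]] i by (simp add: q_def \<tau> h)
      hence "wdeg total h = int r * (int (n i) * wdeg total h)"
        using G(2) c[OF i(1)] prime_form_neq_0[OF coordinate_form_prime_form[OF ph]]
        by (metis (no_types, lifting) add_0 mconst_eq_0_iff mult_eq_0_iff nmul_int power_not_zero wdeg_mconst wdeg_mult wdeg_power)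
      hence "int r * int (n i) = 1" using prime_form_total_pos[OF coordinate_form_prime_form[OF ph]] by (simp flip: mult.assoc)
      thus ?thesis by (metis n i(1) of_nat_1 of_nat_eq_iff of_nat_mult nat_mult_eq_1_iff)
    qed
    define E where "E = wdeg w h"
    have E: "0 < E" using prime_form_weight(2)[OF w coordinate_form_prime_form[OF ph]] by (simp add: E_def)
    have dn: "d i = nmul (n i) E" if "i \<noteq> 2" for i using d_eq[OF that] h[OF that] by (simp add: E_def)
    have dvd: "n 0 dvd n 1 \<or> n 1 dvd n 0"
    proof -
      have "a * n 0 = b * n 1" if "nmul a (d 0) = nmul b (d 1)" for a b
        using that E by (simp add: dn nmul_left_eq_iff flip: nmul_mult)
      hence "n 0 dvd n 1 \<or> n 1 dvd n 0" if "nmul a (d 0) = nmul b (d 1)" "a = 1 \<or> b = 1" for a b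
        using that by (metis dvd_triv_right mult_1)
      thus ?thesis using G(1) one[of 0] one[of 1] unfolding coordinate_form_def by auto
    qed
    have chain: "chain w (d i) (d j)" if ij: "i \<noteq> 2" "j \<noteq> 2" "i \<noteq> j" "n i dvd n j" for i j
    proof -
      obtain u where u: "n j = n i * u" using ij by auto
      hence u1: "1 \<le> u" using n[OF ij(2)] by (cases u) auto
      have dj: "d j = nmul u (d i)" using ij by (simp add: dn u mult.commute nmul_mult)
      have uni: "d i = w v" if "v \<noteq> 2" "v' \<noteq> 2" "v' \<noteq> v" "d i < w v'" for v v'
        unfolding d_def
      proof (rule univariate_coordinate[OF inv])
        show "0 < w v" using that(1) w by (cases v rule: exhaust_3) auto
        fix m l assume m: "m \<in> keys (\<sigma> i)" "l \<noteq> v"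
        have t: "lookup m 2 = 0" using pl(1) ij(1) m by (cases i rule: exhaust_3) (auto simp: planar_def xy_poly_def)
        have "lookup m v' = 0"
        proof (rule ccontr)
          assume "lookup m v' \<noteq> 0"
          hence "w v' \<le> nmul (lookup m v') (w v')" using that(2) w by (intro le_nmul; cases v' rule: exhaust_3) auto
          also have "\<dots> \<le> mon_weight w m"
            using that(2) w t by (cases v' rule: exhaust_3) (auto simp: mon_weight_3 nmul_nonneg)
          also have "\<dots> \<le> d i" using wdeg_ge[OF m(1)] by (simp add: d_def)
          finally show False using that(4) by simp
        qed
        thus "lookup m l = 0" using that m(2) t by (cases l rule: exhaust_3; cases v rule: exhaust_3; cases v' rule: exhaust_3) auto
      qed
      have both: "w v' \<le> d j" if vp: "v' \<noteq> 2" "d i < w v'" for v'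
      proof (rule ccontr)
        assume "\<not> w v' \<le> d j"
        obtain l m where l: "l \<noteq> 2" "m \<in> keys (\<sigma> l)" "lookup m v' \<noteq> 0"
          using not_both_univariate[OF inv pl(1) vp(1)] .
        have t: "lookup m 2 = 0" using pl(1) l by (cases l rule: exhaust_3) (auto simp: planar_def xy_poly_def)
        have "w v' \<le> nmul (lookup m v') (w v')" using vp(1) w l by (intro le_nmul; cases v' rule: exhaust_3) auto
        also have "\<dots> \<le> mon_weight w m"
            using vp(1) w t by (cases v' rule: exhaust_3) (auto simp: mon_weight_3 nmul_nonneg)
        also have "\<dots> \<le> d l" using wdeg_ge[OF l(2)] by (simp add: d_def)
        finally have "w v' \<le> d l" .
        moreover have "l = i \<or> l = j" using l(1) ij(1-3) by (cases l rule: exhaust_3; cases i rule: exhaust_3; cases j rule: exhaust_3) auto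
        ultimately show False using vp \<open>\<not> w v' \<le> d j\<close> by auto
      qed
      have di: "d i = nmul (n i) E" and ni: "1 \<le> n i" using dn ij n by auto
      from prime_form_weight(3)[OF w coordinate_form_prime_form[OF ph]] show ?thesis
      proof (elim disjE conjE exE)
        assume "wdeg w h = w 0"
        hence "d i = nmul (n i) (w 0)" using di by (simp add: E_def)
        thus ?thesis using dj u1 ni uni[of 0 1] both[of 1] unfolding chain_def by (metis ne not_less zero_neq_one)
      next
        assume "wdeg w h = w 1"
        hence "d i = nmul (n i) (w 1)" using di by (simp add: E_def)
        thus ?thesis using dj u1 ni uni[of 1 0] both[of 0] unfolding chain_def by (metis ne not_less zero_neq_one)
      next
        fix a b assume ab: "1 \<le> a" "1 \<le> b" "wdeg w h = nmul a (w 0)" "wdeg w h = nmul b (w 1)"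
        have "d i = nmul (n i * a) (w 0)" using di ab by (simp add: E_def nmul_mult)
        moreover have "w 1 \<le> E" using ab le_nmul[of b "w 1"] w by (simp add: E_def)
        hence "w 1 \<le> d i" using le_nmul[OF ni E] di by simp
        moreover have "1 \<le> n i * a" using ab ni by simp
        ultimately show ?thesis using dj u1 unfolding chain_def by blast
      qed
    qed
    show ?thesis using dvd chain[of 0 1] chain[of 1 0] ne unfolding planar_degrees_def d_def by auto
  next
    case False
    have inv': "inverse_tuples \<rho> \<sigma>" by (rule inverse_tuples_sym[OF inv])
    \<comment> \<open>Irreducibility of the variable \<open>i\<close> forces exponent 1 in its expression by initial forms.\<close>
    have key: "(\<exists>k e. k \<noteq> 2 \<and> w i = d k \<and> mvar i = mconst e * \<tau> k) \<or>
       (\<exists>a b. 1 \<le> a \<and> 1 \<le> b \<and> (a = 1 \<or> b = 1) \<and> w i = nmul a (d 0) \<and> w i = nmul b (d 1))" if i: "i \<noteq> 2" for i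
    proof -
      obtain G e r where G: "coordinate_form d G" "e \<noteq> 0" "1 \<le> r" "hcomp d (wdeg d (\<rho> i)) (\<rho> i) = mconst e * G ^ r"
        using coordinate_initial_form[OF inv' pl(2,1) d01 i] .
      have Gn: "subst \<tau> G \<noteq> 0"
      proof
        assume z: "subst \<tau> G = 0"
        from G(1) obtain a b x where ab: "1 \<le> a" "1 \<le> b" "x \<noteq> 0" "G = mvar 0 ^ a - mconst x * mvar 1 ^ b"
          using z \<tau>0 ne unfolding coordinate_form_def by (auto simp: subst_simps)
        hence "(mconst (c 0) * H 0 ^ n 0) ^ a = mconst x * (mconst (c 1) * H 1 ^ n 1) ^ b"
          using z by (simp add: subst_simps \<tau> ne)
        hence "mconst (c 0 ^ a) * H 0 ^ (n 0 * a) = mconst (x * c 1 ^ b) * H 1 ^ (n 1 * b)"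
          by (simp add: power_mult_distrib ring_morph_simps[OF ring_morph_mconst] power_mult mult.assoc)
        hence "H 0 = H 1"
          by (rule prime_form_power_unique[OF w Hf[OF ne(1)] coordinate_form_prime_form[OF Hf[OF ne(2)]]]) (use ab c n ne in auto)
        with False show False ..
      qed
      define q where "q = mconst e * subst \<tau> G ^ r"
      have q0: "q \<noteq> 0" using Gn G by (simp add: q_def)
      have q: "q = subst (\<lambda>i. hcomp w (wdeg w (\<sigma> i)) (\<sigma> i)) (hcomp (\<lambda>i. wdeg w (\<sigma> i)) (wdeg d (\<rho> i)) (\<rho> i))"
        using G(4) unfolding q_def \<tau>_def d_def by (simp add: subst_simps)
      have "deg_le (\<lambda>i. wdeg w (\<sigma> i)) (wdeg d (\<rho> i)) (\<rho> i)" unfolding d_def[symmetric] by (rule wdeg_deg_le)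
      from substituted_initial_form[OF q q0 this]
      have wi: "w i = wdeg d (\<rho> i)" and mi: "mvar i = q"
        using inv by (simp_all add: inverse_tuples_def wdeg_mvar hcomp_mvar) (metis hcomp_mvar)
      have "wdeg total q = int r * wdeg total (subst \<tau> G)"
        using Gn G by (simp add: q_def wdeg_mult wdeg_mconst wdeg_power nmul_int)
      moreover have "wdeg total q = 1" by (simp add: wdeg_mvar flip: mi)
      ultimately have "r = 1" using wdeg_total_nonneg[OF Gn] by (metis of_nat_eq_1_iff pos_zmult_eq_1_iff zmult_eq_1_iff of_nat_0_le_iff abs_of_nonneg of_nat_1 abs_minus_cancel zero_neq_one abs_1)
      have "\<rho> i \<noteq> 0" using inverse_tuples_not_const[OF inv', of i 0] by simp
      hence "w i = wdeg d (mconst e * G ^ r)" unfolding wi G(4)[symmetric] by (simp add: wdeg_hcomp)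
      hence wG: "w i = wdeg d G" using \<open>r = 1\<close> G(2) prime_form_neq_0[OF coordinate_form_prime_form[OF G(1)]]
        by (simp add: wdeg_mult wdeg_mconst)
      have mG: "mvar i = mconst e * subst \<tau> G" using mi \<open>r = 1\<close> by (simp add: q_def)
      consider k where "k \<noteq> 2" "G = mvar k" | a b x where "1 \<le> a" "1 \<le> b" "a = 1 \<or> b = 1" "nmul a (d 0) = nmul b (d 1)" "G = mvar 0 ^ a - mconst x * mvar 1 ^ b"
        using G(1) ne unfolding coordinate_form_def by blast
      thus ?thesis
      proof cases
        case (1 k)
        hence "w i = d k" using wG by (simp add: wdeg_mvar)
        thus ?thesis using 1 mG by (auto simp: subst_simps)
      next
        case (2 a b x)
        have "hcomp d (nmul a (d 0)) G = G" "G \<noteq> 0"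
          using binomial_homogeneous[of a d b x] 2 prime_form_neq_0[OF coordinate_form_prime_form[OF G(1)]] by auto
        hence "wdeg d G = nmul a (d 0)" by (metis deg_le_hcomp wdeg_eqI)
        hence "w i = nmul a (d 0)" "w i = nmul b (d 1)" using 2(4) wG by simp_all
        thus ?thesis using 2(1-3) by blast
      qed
    qed
    have some: "w i = d 0 \<or> w i = d 1" if "i \<noteq> 2" for i
      using key[OF that]
    proof (elim disjE exE conjE)
      fix k e assume "k \<noteq> 2" "w i = d k"
      thus ?thesis by (cases k rule: exhaust_3) auto
    qed auto
    show ?thesis
    proof (cases "w 0 = w 1")
      case False
      thus ?thesis using some[OF ne(1)] some[OF ne(2)] unfolding planar_degrees_def d_def by auto
    next
      case eq: True
      have d_ge: "w 0 \<le> d k" if "k \<noteq> 2" for k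
      proof -
        have "w 0 \<le> wdeg w (H k)"
          using prime_form_weight(3)[OF w coordinate_form_prime_form[OF Hf[OF that]]] eq le_nmul[of _ "w 0"] w by auto
        also have "\<dots> \<le> d k" unfolding d_eq[OF that] by (rule le_nmul[OF n[OF that] Hpos[OF that]])
        finally show ?thesis .
      qed
      \<comment> \<open>When both weights agree, all degrees are at least this weight, and a binomial expression forces equality.\<close>
      have bin: "d 0 = w 0 \<and> d 1 = w 0" if "1 \<le> a" "1 \<le> b" "w 0 = nmul a (d 0)" "w 0 = nmul b (d 1)" for a b
        using le_nmul[OF that(1) d01(1)] le_nmul[OF that(2) d01(2)] d_ge[OF ne(1)] d_ge[OF ne(2)] that by auto
      have "d 0 = w 0 \<and> d 1 = w 0"
      proof (rule ccontr)
        assume no: "\<not> (d 0 = w 0 \<and> d 1 = w 0)"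
        obtain k e where k: "k \<noteq> 2" "w 0 = d k" "mvar 0 = mconst e * \<tau> k" using key[OF ne(1)] bin no by blast
        obtain k' e' where k': "k' \<noteq> 2" "w 0 = d k'" "mvar 1 = mconst e' * \<tau> k'" using key[OF ne(2)] bin no eq by metis
        have "k \<noteq> k'"
        proof
          assume "k = k'"
          have e: "e \<noteq> 0" using k(3) by auto
          have "mvar 1 = mconst e' * (mconst (inverse e) * (mconst e * \<tau> k))"
            using k' \<open>k = k'\<close> e by (simp flip: mult.assoc ring_morph_mult[OF ring_morph_mconst])
          hence "mvar 1 = mconst (e' * inverse e) * (mvar 0 :: (3, 'k) mpol)"
            unfolding k(3)[symmetric] ring_morph_mult[OF ring_morph_mconst] mult.assoc .
          thus False using const_multiple_mvar by (metis zero_neq_one)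
        qed
        thus False using no k k' by (cases k rule: exhaust_3; cases k' rule: exhaust_3) auto
      qed
      thus ?thesis using eq unfolding planar_degrees_def d_def by auto
    qed
  qed
qed

section \<open>Automorphisms preserving the subring of polynomials in x and y\<close>

lemma xy_poly_subst_all: "(\<And>i. xy_poly (\<tau> i)) \<Longrightarrow> xy_poly (subst \<tau> p)"
  unfolding xy_poly_deg_le by (rule deg_le_subst[where w = "\<lambda>_. 0"]) (simp_all add: deg_le_def mon_weight_nmul)

lemma not_xy_poly_mvar_2: "\<not> xy_poly (mvar 2)"
  by (simp add: xy_poly_def mvar_def)

lemma z_wt_homogeneous:
  fixes p :: "(3, 'r::idom) mpol"
  assumes "hcomp z_wt (int k) p = p"
  shows "\<exists>q. xy_poly q \<and> p = q * mvar 2 ^ k"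
  using assms
proof (induction k arbitrary: p)
  case 0
  have "deg_le z_wt 0 p" using deg_le_hcomp[of z_wt 0 p] 0 by simp
  thus ?case by (intro exI[of _ p]) (simp add: xy_poly_deg_le)
next
  case (Suc k)
  have "lookup m 2 \<noteq> 0" if "m \<in> keys p" for m
    using hcomp_weight[OF Suc.prems that] by (simp add: mon_weight_z_wt)
  hence "mvar 2 dvd p" by (rule mvar_dvd)
  then obtain q where q: "p = mvar 2 * q" by (elim dvdE)
  show ?case
  proof (cases "q = 0")
    case True thus ?thesis using q by (intro exI[of _ 0]) simp
  next
    case False
    have "hcomp z_wt (int (Suc k) - wdeg z_wt (mvar 2 :: (3, 'r) mpol)) q = q"
      by (rule homogeneous_factor) (use Suc.prems q False in simp_all)
    hence "hcomp z_wt (int k) q = q" by (simp add: wdeg_mvar)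
    then obtain u where "xy_poly u" "q = u * mvar 2 ^ k" using Suc.IH by blast
    thus ?thesis using q by (intro exI[of _ u]) simp
  qed
qed

text \<open>The components 0 and 1 are algebraically independent, being part of an automorphism, so nothing
  cancels in the coefficient of the highest power of component 2.\<close>

lemma z_degree_subst:
  fixes \<sigma> \<rho> :: "3 \<Rightarrow> (3, 'r::idom) mpol"
  assumes inv: "inverse_tuples \<sigma> \<rho>" and s: "xy_poly (\<sigma> 0)" "xy_poly (\<sigma> 1)" and p: "p \<noteq> 0"
  shows "wdeg z_wt (subst \<sigma> p) = wdeg z_wt (\<sigma> 2) * wdeg z_wt p"
proof -
  define n where "n = wdeg z_wt (\<sigma> 2)"
  have nz: "\<sigma> i \<noteq> 0" for i using inverse_tuples_not_const[OF inv, of i 0] by simp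
  have n: "n > 0"
  proof (rule ccontr)
    assume "\<not> n > 0"
    hence "xy_poly (\<sigma> 2)" using wdeg_z_wt_nonneg[OF nz, of 2] xy_poly_wdeg[OF nz, of 2] by (simp add: n_def)
    hence "xy_poly (\<sigma> i)" for i using s by (cases i rule: exhaust_3) auto
    hence "xy_poly (subst \<sigma> (\<rho> 2))" by (rule xy_poly_subst_all)
    thus False using inv by (simp add: inverse_tuples_def not_xy_poly_mvar_2)
  qed
  define \<omega> where "\<omega> = (\<lambda>i. wdeg z_wt (\<sigma> i))"
  have \<omega>: "\<omega> 0 = 0" "\<omega> 1 = 0" "\<omega> 2 = n" using s nz xy_poly_wdeg by (auto simp: \<omega>_def n_def)
  have mw: "mon_weight \<omega> m = n * mon_weight z_wt m" for m
    by (simp add: mon_weight_3 \<omega> nmul_int)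
  define D where "D = wdeg z_wt p"
  have dl: "deg_le \<omega> (n * D) p" using wdeg_deg_le[of z_wt p] n by (simp add: deg_le_def mw D_def)
  have hcp: "hcomp \<omega> (n * D) p = hcomp z_wt D p"
    by (rule poly_mapping_eqI) (use n in \<open>simp add: lookup_hcomp mw\<close>)
  obtain k where k: "D = int k" using wdeg_z_wt_nonneg[OF p] by (metis D_def nonneg_int_cases)
  obtain q where q: "xy_poly q" "hcomp z_wt D p = q * mvar 2 ^ k"
    using z_wt_homogeneous[of k "hcomp z_wt D p"] by (auto simp: hcomp_hcomp k)
  have q0: "q \<noteq> 0" using q init_form_nonzero[OF p, of z_wt] by (auto simp: D_def)
  define \<tau> where "\<tau> = (\<lambda>i. hcomp z_wt (wdeg z_wt (\<sigma> i)) (\<sigma> i))"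
  have \<tau>: "\<tau> i = \<sigma> i" if "i \<noteq> 2" for i
  proof -
    have t: "xy_poly (\<sigma> i)" using that s by (cases i rule: exhaust_3) auto
    hence "wdeg z_wt (\<sigma> i) = 0" using xy_poly_wdeg[OF nz] by simp
    moreover have "hcomp z_wt 0 (\<sigma> i) = \<sigma> i" by (rule hcomp_id) (use t in \<open>simp add: xy_poly_def mon_weight_z_wt\<close>)
    ultimately show ?thesis by (simp add: \<tau>_def)
  qed
  have "\<tau> 2 \<noteq> 0" unfolding \<tau>_def by (rule init_form_nonzero[OF nz])
  have "subst \<tau> q = subst \<sigma> q" by (rule xy_poly_subst_cong[OF q(1)]) (simp_all add: \<tau>)
  moreover have "subst \<sigma> q \<noteq> 0" using q0 subst_inverse(2)[OF inv, of q] by (metis subst_0)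
  ultimately have "subst \<tau> (hcomp \<omega> (n * D) p) \<noteq> 0" using \<open>\<tau> 2 \<noteq> 0\<close> by (simp add: hcp q(2) subst_simps)
  hence "wdeg z_wt (subst \<sigma> p) = n * D"
    by (intro substituted_initial_form(1)[OF refl]) (use dl in \<open>simp_all add: \<tau>_def \<omega>_def\<close>)
  thus ?thesis by (simp add: n_def D_def)
qed

lemma total_0_const: "p \<noteq> 0 \<Longrightarrow> wdeg total p = 0 \<Longrightarrow> \<exists>c. p = mconst c"
proof (rule keys_subset_0_const)
  assume "wdeg total p = 0"
  show "keys p \<subseteq> {0}"
  proof
    fix m assume "m \<in> keys p"
    thus "m \<in> {0}" using wdeg_total_pos[of m p] \<open>wdeg total p = 0\<close> by force
  qed
qed

lemma linear_in_last:
  fixes p :: "(3, 'r::idom) mpol"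
  assumes "wdeg z_wt p = 1"
  obtains c r where "xy_poly c" "xy_poly r" "p = c * mvar 2 + r"
proof -
  obtain c where c: "xy_poly c" "hcomp z_wt 1 p = c * mvar 2"
    using z_wt_homogeneous[of 1 "hcomp z_wt 1 p"] by (auto simp: hcomp_hcomp)
  have "xy_poly (p - hcomp z_wt 1 p)"
    unfolding xy_poly_def
  proof
    fix m assume m: "m \<in> keys (p - hcomp z_wt 1 p)"
    hence "m \<in> keys p" "mon_weight z_wt m \<noteq> 1" by (auto simp: in_keys_iff lookup_minus lookup_hcomp split: if_splits)
    thus "lookup m 2 = 0" using wdeg_ge[of m p z_wt] assms by (simp add: mon_weight_z_wt)
  qed
  thus thesis using that[of c "p - hcomp z_wt 1 p"] c by simp
qed

text \<open>By \<open>z_degree_subst\<close> the degree in z of \<open>\<rho> i\<close>, multiplied by that of \<open>\<sigma> 2\<close>, is the degree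
  in z of variable \<open>i\<close>. So component 2 of either tuple is linear in z, and the other components of
  the inverse tuple are free of z. The coefficients of z multiply to 1, so they are constants.\<close>

theorem triangular_automorphism:
  fixes \<sigma> \<rho> :: "3 \<Rightarrow> (3, 'r::idom) mpol"
  assumes inv: "inverse_tuples \<sigma> \<rho>" and s: "xy_poly (\<sigma> 0)" "xy_poly (\<sigma> 1)"
  obtains c r where "c \<noteq> 0" "xy_poly r" "\<sigma> 2 = mconst c * mvar 2 + r"
    "planar (\<sigma>(2 := mvar 2))" "planar (\<rho>(2 := mvar 2))" "inverse_tuples (\<sigma>(2 := mvar 2)) (\<rho>(2 := mvar 2))"
proof -
  have nz: "\<sigma> i \<noteq> 0" "\<rho> i \<noteq> 0" for i
    using inverse_tuples_not_const[OF inv, of i 0] inverse_tuples_not_const[OF inverse_tuples_sym[OF inv], of i 0] by simp_all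
  have *: "z_wt i = wdeg z_wt (\<sigma> 2) * wdeg z_wt (\<rho> i)" for i
  proof -
    have "wdeg z_wt (subst \<sigma> (\<rho> i)) = z_wt i" using inv by (simp add: inverse_tuples_def wdeg_mvar)
    thus ?thesis using z_degree_subst[OF inv s nz(2)[of i]] by simp
  qed
  have two: "wdeg z_wt (\<sigma> 2) = 1" "wdeg z_wt (\<rho> 2) = 1"
    using *[of 2] wdeg_z_wt_nonneg[OF nz(1), of 2] wdeg_z_wt_nonneg[OF nz(2), of 2]
    by (auto simp: zmult_eq_1_iff dest!: sym[of 1])
  have tr: "xy_poly (\<rho> 0)" "xy_poly (\<rho> 1)" using *[of 0] *[of 1] two xy_poly_wdeg[OF nz(2)] by auto
  obtain c r where c: "xy_poly c" "xy_poly r" "\<sigma> 2 = c * mvar 2 + r" using linear_in_last[OF two(1)] .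
  obtain c' r' where c': "xy_poly c'" "xy_poly r'" "\<rho> 2 = c' * mvar 2 + r'" using linear_in_last[OF two(2)] .
  let ?c = "subst \<sigma> c'" and ?r = "subst \<sigma> r'"
  have t: "xy_poly ?c" "xy_poly ?r" using xy_poly_subst[OF c'(1) s] xy_poly_subst[OF c'(2) s] .
  have "mvar 2 = subst \<sigma> (\<rho> 2)" using inv by (simp add: inverse_tuples_def)
  also have "\<dots> = ?c * c * mvar 2 + (?c * r + ?r)" by (simp add: c c' subst_simps algebra_simps)
  finally have eq: "mvar 2 = ?c * c * mvar 2 + (?c * r + ?r)" .
  have "(1 - ?c * c) * mvar 2 = ?c * r + ?r" using eq by (simp add: algebra_simps)
  moreover have "xy_poly (?c * r + ?r)" by (intro xy_poly_add xy_poly_mult t c)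
  ultimately have "xy_poly ((1 - ?c * c) * mvar 2)" by simp
  hence "1 - ?c * c = 0" using xy_poly_factor(2)[of "1 - ?c * c" "mvar 2"] by (auto simp: not_xy_poly_mvar_2)
  hence unit: "?c * c = 1" by simp
  hence n0: "?c \<noteq> 0" "c \<noteq> 0" by auto
  have "wdeg total ?c + wdeg total c = 0" using wdeg_mult[OF n0, of total] unit by (simp add: wdeg_1)
  hence "wdeg total c = 0" using wdeg_total_nonneg[OF n0(1)] wdeg_total_nonneg[OF n0(2)] by linarith
  then obtain d where d: "c = mconst d" using total_0_const[OF n0(2)] by auto
  show thesis
  proof (rule that)
    show "d \<noteq> 0" using d n0 by auto
    show "xy_poly r" "\<sigma> 2 = mconst d * mvar 2 + r" using c d by auto
    show "planar (\<sigma>(2 := mvar 2))" "planar (\<rho>(2 := mvar 2))" using s tr by (simp_all add: planar_def)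
    show "inverse_tuples (\<sigma>(2 := mvar 2)) (\<rho>(2 := mvar 2))"
      unfolding inverse_tuples_def
    proof (intro conjI allI)
      fix i
      have a: "subst (\<sigma>(2 := mvar 2)) p = subst \<sigma> p" if "xy_poly p" for p by (rule xy_poly_subst_cong[OF that]) simp_all
      have b: "subst (\<rho>(2 := mvar 2)) p = subst \<rho> p" if "xy_poly p" for p by (rule xy_poly_subst_cong[OF that]) simp_all
      show "subst (\<sigma>(2 := mvar 2)) ((\<rho>(2 := mvar 2)) i) = mvar i"
        using tr inv by (cases i rule: exhaust_3) (simp_all add: a inverse_tuples_def subst_simps)
      show "subst (\<rho>(2 := mvar 2)) ((\<sigma>(2 := mvar 2)) i) = mvar i"
        using s inv by (cases i rule: exhaust_3) (simp_all add: b inverse_tuples_def subst_simps)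
    qed
  qed
qed

section \<open>Automorphisms with two components of small degree\<close>

lemma deg_le_mconst_mult: "deg_le w D p \<Longrightarrow> deg_le w D (mconst c * p)"
  using deg_le_mult[of w 0 "mconst c" D p] by (simp add: deg_le_mconst)

text \<open>Weights are positive, so a monomial containing z weighs more than z unless it is z itself.\<close>

lemma weight_le_last_imp_eq:
  fixes w :: "3 \<Rightarrow> 'g::linordered_ab_group_add"
  assumes w: "\<And>i. 0 < w i" and m: "lookup m 2 \<noteq> 0" "mon_weight w m \<le> w 2"
  shows "m = single 2 1"
proof -
  have le: "w 2 \<le> nmul (lookup m 2) (w 2)" using le_nmul[of "lookup m 2" "w 2"] m w by simp
  have nn: "0 \<le> nmul (lookup m 0) (w 0)" "0 \<le> nmul (lookup m 1) (w 1)" using w by (simp_all add: nmul_nonneg less_imp_le)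
  have sum: "nmul (lookup m 0) (w 0) + (nmul (lookup m 1) (w 1) + nmul (lookup m 2) (w 2)) \<le> w 2"
    using m(2) by (simp add: mon_weight_3)
  have "nmul (lookup m 2) (w 2) \<le> nmul 1 (w 2)"
    using order_trans[OF add_increasing[OF nn(1) add_increasing[OF nn(2) order_refl]] sum] by simp
  hence 2: "lookup m 2 = 1" using m w by (subst (asm) nmul_left_le_iff) auto
  hence "nmul (lookup m 0) (w 0) + nmul (lookup m 1) (w 1) \<le> 0"
    using sum by (simp flip: add.assoc)
  hence "nmul (lookup m 0) (w 0) = 0 \<and> nmul (lookup m 1) (w 1) = 0"
    using nn by (metis add_nonneg_eq_0_iff add_nonneg_nonneg antisym)
  hence "lookup m 0 = 0" "lookup m 1 = 0" using nmul_pos w by (metis gr0I less_irrefl)+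
  thus ?thesis using 2 by (intro mon_eqI_3) (simp_all add: lookup_single when_def)
qed

lemma small_degree_linear:
  fixes w :: "3 \<Rightarrow> 'g::linordered_ab_group_add" and f :: "(3, 'r::comm_ring_1) mpol"
  assumes w: "\<And>i. 0 < w i" and f: "deg_le w (w 2) f"
  obtains a p where "f = mconst a * mvar 2 + p" "xy_poly p" "deg_le w (w 2) p" "a = lookup f (single 2 1)"
proof -
  define a where "a = lookup f (single 2 1)"
  define p where "p = f - mconst a * mvar 2"
  have l: "lookup (mconst a * mvar 2) m = (if m = single 2 1 then a else 0)" for m :: "3 mon"
    by (simp add: mconst_mult_lookup mvar_def lookup_single when_def)
  have "xy_poly p"
    unfolding xy_poly_def
  proof
    fix m assume m: "m \<in> keys p"
    show "lookup m 2 = 0"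
    proof (rule ccontr)
      assume 2: "lookup m 2 \<noteq> 0"
      have "m \<noteq> single 2 1" using m by (auto simp: p_def in_keys_iff lookup_minus l simp del: One_nat_def) (simp add: a_def)
      hence "m \<in> keys f" using m by (simp add: p_def in_keys_iff lookup_minus l del: One_nat_def)
      hence "mon_weight w m \<le> w 2" using f by (simp add: deg_le_def)
      thus False using weight_le_last_imp_eq[of w m, OF w 2] \<open>m \<noteq> single 2 1\<close> by blast
    qed
  qed
  moreover have "deg_le w (w 2) (mconst a * mvar 2)"
    by (intro deg_le_mconst_mult deg_le_mvar)
  hence "deg_le w (w 2) p" unfolding p_def by (rule deg_le_diff[OF f])
  ultimately show thesis using that[of a p] by (simp add: p_def a_def)
qed

lemma wdeg_eq_last:
  assumes "deg_le w (w 2) f" "lookup f (single (2::3) 1) \<noteq> 0"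
  shows "wdeg w f = w 2"
proof (rule wdeg_eqI[OF assms(1)])
  have "lookup (hcomp w (w 2) f) (single 2 1) \<noteq> 0" using assms(2) by (simp add: lookup_hcomp mon_weight_single del: One_nat_def)
  thus "hcomp w (w 2) f \<noteq> 0" by auto
qed

text \<open>Component 2 is \<open>c z + r\<close> with r in x and y. The monomial z cannot cancel against r, so the degree
  is that of z or that of a monomial in x and y.\<close>

lemma triangular_case:
  fixes \<sigma> \<rho> :: "3 \<Rightarrow> (3, 'k::alg_closed_field) mpol" and w :: "3 \<Rightarrow> 'g::linordered_ab_group_add"
  assumes inv: "inverse_tuples \<sigma> \<rho>" and w: "\<And>i. 0 < w i" and s: "xy_poly (\<sigma> 0)" "xy_poly (\<sigma> 1)"
  shows "planar_degrees w (wdeg w (\<sigma> 0)) (wdeg w (\<sigma> 1))"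
    "wdeg w (\<sigma> 2) = w 2 \<or> (w 2 < wdeg w (\<sigma> 2) \<and> (\<exists>i j. wdeg w (\<sigma> 2) = nmul i (w 0) + nmul j (w 1)))"
proof -
  obtain c r where c: "c \<noteq> 0" "xy_poly r" "\<sigma> 2 = mconst c * mvar 2 + r"
    and pl: "planar (\<sigma>(2 := mvar 2))" "planar (\<rho>(2 := mvar 2))" "inverse_tuples (\<sigma>(2 := mvar 2)) (\<rho>(2 := mvar 2))"
    using triangular_automorphism[OF inv s] .
  show "planar_degrees w (wdeg w (\<sigma> 0)) (wdeg w (\<sigma> 1))"
    using planar_automorphism_degrees[where w = w, OF pl(3,1,2) w w] by simp
  have l: "lookup (\<sigma> 2) m = (if m = single 2 1 then c else 0) + lookup r m" for m
    by (simp add: c mconst_mult_lookup lookup_add mvar_def lookup_single when_def)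
  have "single 2 1 \<notin> keys r" using c(2) by (auto simp: xy_poly_def)
  hence "single 2 1 \<in> keys (\<sigma> 2)" using c(1) by (simp add: in_keys_iff l del: One_nat_def)
  hence ge: "w 2 \<le> wdeg w (\<sigma> 2)" using wdeg_ge[of "single 2 1" "\<sigma> 2" w] by (simp add: mon_weight_single)
  have "\<sigma> 2 \<noteq> 0" using inverse_tuples_not_const[OF inv, of 2 0] by simp
  then obtain m where m: "m \<in> keys (\<sigma> 2)" "mon_weight w m = wdeg w (\<sigma> 2)" using wdeg_attained by blast
  show "wdeg w (\<sigma> 2) = w 2 \<or> (w 2 < wdeg w (\<sigma> 2) \<and> (\<exists>i j. wdeg w (\<sigma> 2) = nmul i (w 0) + nmul j (w 1)))"
  proof (cases "m = single 2 1")
    case True thus ?thesis using m by (simp add: mon_weight_single)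
  next
    case False
    hence "m \<in> keys r" using m(1) by (simp add: in_keys_iff l del: One_nat_def)
    hence "lookup m 2 = 0" using c(2) by (simp add: xy_poly_def)
    hence "wdeg w (\<sigma> 2) = nmul (lookup m 0) (w 0) + nmul (lookup m 1) (w 1)" using m(2) by (simp add: mon_weight_3)
    thus ?thesis using ge by (metis order_le_less)
  qed
qed

definition y_wt :: "3 \<Rightarrow> int" where "y_wt i = (if i = 1 then 1 else 0)"

lemma mon_weight_y_wt: "mon_weight y_wt m = int (lookup m 1)"
  by (simp add: mon_weight_3 nmul_int y_wt_def)

lemma subst_z_0:
  fixes p :: "(3, 'a::comm_ring_1) mpol"
  shows "subst (mvar(2 := 0)) p = hcomp z_low 0 p"
proof -
  have "deg_le (\<lambda>_. 0 :: int) 0 p" by (simp add: deg_le_def mon_weight_nmul)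
  hence "hcomp z_low 0 (subst mvar p) = subst (\<lambda>i. hcomp z_low 0 (mvar i)) (hcomp (\<lambda>_. 0 :: int) 0 p)"
    using hcomp_subst[of z_low "\<lambda>_. 0" mvar 0 p] by (simp add: deg_le_z_low)
  moreover have "(\<lambda>i. hcomp z_low 0 (mvar i)) = (mvar(2 := 0) :: 3 \<Rightarrow> (3, 'a) mpol)"
  proof
    fix i :: 3
    show "hcomp z_low 0 (mvar i) = (mvar(2 := 0) :: 3 \<Rightarrow> (3, 'a) mpol) i"
  proof (cases "i = 2")
    case True
    thus ?thesis by simp (rule hcomp_deg_lt, simp add: deg_lt_def mvar_def mon_weight_z_low)
  next
    case False thus ?thesis using xy_poly_mvar[of i] by (simp add: xy_poly_hcomp)
  qed
  qed
  moreover have "hcomp (\<lambda>_. 0 :: int) 0 p = p" by (rule hcomp_id) (simp add: mon_weight_nmul)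
  ultimately show ?thesis by (simp add: subst_mvar)
qed

text \<open>The initial forms of g and z are algebraically independent, since one is free of z. For the proof,
  take a top component by weight and then by the degree in z: what remains is a single monomial,
  because \<open>g\<close> has positive degree.\<close>

lemma wdeg_bivariate_subst:
  fixes w :: "3 \<Rightarrow> 'g::linordered_ab_group_add" and r g h :: "(3, 'k::field) mpol"
  assumes r: "xy_poly r" "r \<noteq> 0" and g: "xy_poly g" "0 < wdeg w g" "g \<noteq> 0" and h: "xy_poly h"
    and \<kappa>: "\<kappa> 0 = g" "\<kappa> 1 = mvar 2" "\<kappa> 2 = h"
  shows "\<exists>i j. wdeg w (subst \<kappa> r) = nmul i (wdeg w g) + nmul j (w 2)" "subst \<kappa> r \<noteq> 0"
proof -
  define d where "d = (\<lambda>i. wdeg w (\<kappa> i))"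
  have d: "d 0 = wdeg w g" "d 1 = w 2" by (simp_all add: d_def \<kappa> wdeg_mvar)
  define \<tau> where "\<tau> = (\<lambda>i. hcomp w (d i) (\<kappa> i))"
  define D where "D = wdeg d r"
  define P where "P = hcomp d D r"
  have P0: "P \<noteq> 0" unfolding P_def D_def by (rule init_form_nonzero[OF r(2)])
  have tP: "xy_poly P" using r by (auto simp: P_def xy_poly_def keys_hcomp)
  define J where "J = wdeg y_wt P"
  define Q where "Q = hcomp y_wt J P"
  have Q0: "Q \<noteq> 0" unfolding Q_def J_def by (rule init_form_nonzero[OF P0])
  then obtain m where m: "m \<in> keys Q" by (metis all_not_in_conv keys_nonempty)
  have kQ: "lookup n 2 = 0 \<and> int (lookup n 1) = J \<and> nmul (lookup n 0) (d 0) + nmul (lookup n 1) (d 1) = D" if "n \<in> keys Q" for n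
  proof -
    have n: "n \<in> keys P" "int (lookup n 1) = J" using that by (auto simp: Q_def keys_hcomp mon_weight_y_wt)
    hence "mon_weight d n = D" by (auto simp: P_def keys_hcomp)
    thus ?thesis using tP n by (simp add: xy_poly_def mon_weight_3)
  qed
  have "n = m" if n: "n \<in> keys Q" for n
  proof -
    have eq1: "lookup n 1 = lookup m 1" using kQ[OF n] kQ[OF m] by simp
    have "nmul (lookup n 0) (d 0) + nmul (lookup n 1) (d 1) = nmul (lookup m 0) (d 0) + nmul (lookup m 1) (d 1)"
      using kQ[OF n] kQ[OF m] by simp
    hence "nmul (lookup n 0) (d 0) = nmul (lookup m 0) (d 0)" using eq1 by simp
    hence "lookup n 0 = lookup m 0" using g by (simp add: nmul_left_eq_iff d)
    thus ?thesis using eq1 kQ[OF n] kQ[OF m] by (intro mon_eqI_3) simp_all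
  qed
  hence "Q = single m (lookup Q m)"
    by (intro poly_mapping_eqI) (auto simp: lookup_single when_def in_keys_iff)
  hence Qe: "Q = mconst (lookup Q m) * (mvar 0 ^ lookup m 0 * mvar 1 ^ lookup m 1)"
    using single_3[of m "lookup Q m"] kQ[OF m] by simp
  have \<tau>: "\<tau> 0 \<noteq> 0" "\<tau> 1 = mvar 2"
    using init_form_nonzero[OF g(3), of w] by (simp_all add: \<tau>_def d \<kappa> hcomp_mvar)
  have tt: "xy_poly (\<tau> 0)" "xy_poly (\<tau> 2)" using g(1) h by (auto simp: \<tau>_def \<kappa> xy_poly_def keys_hcomp)
  have hid: "hcomp z_wt 0 q = q" if "xy_poly q" for q :: "(3, 'k) mpol"
    by (rule hcomp_id) (use that in \<open>simp add: xy_poly_def mon_weight_z_wt\<close>)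
  have dl: "deg_le z_wt (y_wt i) (\<tau> i)" and hl: "hcomp z_wt (y_wt i) (\<tau> i) = \<tau> i" for i
    using tt \<tau>(2) deg_le_mvar[of z_wt 2] hcomp_mvar[of z_wt 2] hid
    by (cases i rule: exhaust_3; simp add: y_wt_def xy_poly_deg_le)+
  have "hcomp z_wt J (subst \<tau> P) = subst \<tau> Q"
    using hcomp_subst[OF dl wdeg_deg_le[of y_wt P]] by (simp add: hl Q_def J_def)
  moreover have "subst \<tau> Q \<noteq> 0" using \<tau> Q0 m by (subst Qe) (simp add: subst_simps in_keys_iff)
  ultimately have "subst \<tau> P \<noteq> 0" by auto
  hence "wdeg w (subst \<kappa> r) = D"
    by (intro substituted_initial_form(1)[OF refl]) (simp_all add: \<tau>_def d_def P_def D_def wdeg_deg_le)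
  moreover have "hcomp w D (subst \<kappa> r) = subst \<tau> P"
    by (intro substituted_initial_form(2)) (use \<open>subst \<tau> P \<noteq> 0\<close> in \<open>simp_all add: \<tau>_def d_def P_def D_def wdeg_deg_le\<close>)
  moreover obtain n where "n \<in> keys r" "mon_weight d n = D" using wdeg_attained[OF r(2)] D_def by metis
  hence "D = nmul (lookup n 0) (d 0) + nmul (lookup n 1) (d 1)" using r(1) by (simp add: xy_poly_def mon_weight_3)
  ultimately show "\<exists>i j. wdeg w (subst \<kappa> r) = nmul i (wdeg w g) + nmul j (w 2)" "subst \<kappa> r \<noteq> 0"
    using \<open>subst \<tau> P \<noteq> 0\<close> d by auto
qed

text \<open>If z is one of the components, then setting z to 0 in the other two gives an automorphism of the
  plane. Relative to this automorphism the last component is triangular, with z and \<open>\<alpha> 1\<close>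
  as the fixed components, so it differs from its value at z = 0 by z times a polynomial in
  \<open>\<alpha> 1\<close> and z.\<close>

lemma tuple_with_last_variable:
  fixes \<alpha> \<gamma> :: "3 \<Rightarrow> (3, 'k::field) mpol"
  assumes inv: "inverse_tuples \<alpha> \<gamma>" and a0: "\<alpha> 0 = mvar 2" and a1: "xy_poly (\<alpha> 1)"
  obtains \<pi> \<chi> r where "inverse_tuples \<pi> \<chi>" "planar \<pi>" "planar \<chi>" "\<pi> 0 = \<alpha> 1" "\<pi> 1 = hcomp z_low 0 (\<alpha> 2)"
    "xy_poly r" "\<And>\<kappa>. \<kappa> 0 = \<alpha> 1 \<Longrightarrow> \<kappa> 1 = mvar 2 \<Longrightarrow> \<alpha> 2 = hcomp z_low 0 (\<alpha> 2) + mvar 2 * subst \<kappa> r"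
proof -
  define \<epsilon> :: "3 \<Rightarrow> (3, 'k) mpol" where "\<epsilon> = mvar(2 := 0)"
  define h where "h = subst \<epsilon> (\<alpha> 2)"
  define g where "g = \<alpha> 1"
  have h_eq: "h = hcomp z_low 0 (\<alpha> 2)" by (simp add: h_def \<epsilon>_def subst_z_0)
  have tg: "xy_poly g" and th: "xy_poly h" using a1 by (simp_all add: g_def h_eq)
  have eg: "subst \<epsilon> g = g" using tg by (simp add: \<epsilon>_def subst_z_0 xy_poly_hcomp)
  have g2: "\<gamma> 2 = mvar 0"
  proof -
    have "subst \<gamma> (\<alpha> 0) = mvar 0" using inv by (simp add: inverse_tuples_def)
    thus ?thesis by (simp add: a0 subst_simps)
  qed
  define \<kappa> :: "3 \<Rightarrow> (3, 'k) mpol" where "\<kappa> = (\<lambda>i. if i = 0 then 0 else if i = 1 then mvar 0 else mvar 1)"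
  define \<chi> where "\<chi> = (\<lambda>i::3. if i = 2 then mvar 2 else subst \<kappa> (\<gamma> i))"
  define \<pi> where "\<pi> = (\<lambda>i::3. if i = 0 then g else if i = 1 then h else mvar 2)"
  have t\<kappa>: "xy_poly (\<kappa> i)" for i by (simp add: \<kappa>_def xy_poly_mvar)
  have pl: "planar \<pi>" "planar \<chi>" using tg th xy_poly_subst_all[of \<kappa>, OF t\<kappa>] by (simp_all add: planar_def \<pi>_def \<chi>_def)
  have inv\<pi>: "inverse_tuples \<pi> \<chi>"
    unfolding inverse_tuples_def
  proof (intro conjI allI)
    fix i
    have "subst \<pi> (\<kappa> j) = subst \<epsilon> (\<alpha> j)" for j
      using a0 eg by (cases j rule: exhaust_3) (simp_all add: \<kappa>_def \<pi>_def subst_simps h_def flip: g_def, simp add: \<epsilon>_def)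
    hence "subst \<pi> (subst \<kappa> (\<gamma> j)) = subst \<epsilon> (subst \<alpha> (\<gamma> j))" for j by (simp add: subst_subst)
    hence *: "subst \<pi> (subst \<kappa> (\<gamma> j)) = subst \<epsilon> (mvar j)" for j using inv by (simp add: inverse_tuples_def)
    show "subst \<pi> (\<chi> i) = mvar i"
      using *[of i] by (cases "i = 2") (simp_all add: \<chi>_def \<pi>_def subst_simps \<epsilon>_def)
    have e\<chi>: "subst \<chi> (\<epsilon> j) = subst \<kappa> (\<gamma> j)" for j
      by (cases "j = 2") (simp_all add: \<epsilon>_def subst_simps \<chi>_def g2 \<kappa>_def)
    have c: "subst \<chi> (subst \<epsilon> (\<alpha> j)) = subst \<kappa> (mvar j)" for j
    proof -
      have "subst \<chi> (subst \<epsilon> (\<alpha> j)) = subst \<kappa> (subst \<gamma> (\<alpha> j))" by (simp add: subst_subst e\<chi>)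
      thus ?thesis using inv by (simp add: inverse_tuples_def)
    qed
    have "subst \<chi> g = mvar 0" using c[of 1] eg by (simp add: subst_simps \<kappa>_def flip: g_def)
    moreover have "subst \<chi> h = mvar 1" using c[of 2] by (simp add: subst_simps \<kappa>_def h_def)
    ultimately show "subst \<chi> (\<pi> i) = mvar i" by (cases i rule: exhaust_3) (simp_all add: \<pi>_def \<chi>_def subst_simps)
  qed
  \<comment> \<open>Exchanging y and z turns the two components z and g, now variables, into polynomials in x and y.\<close>
  define sw :: "3 \<Rightarrow> (3, 'k) mpol" where "sw = rename (id(1 := 2, 2 := 1))"
  have invsw: "inverse_tuples sw sw" unfolding sw_def by (rule inverse_tuples_rename) simp
  define \<beta> where "\<beta> = (\<lambda>i. subst sw (subst \<chi> (\<alpha> i)))"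
  have inv\<beta>: "\<exists>\<beta>'. inverse_tuples \<beta> \<beta>'"
    using inverse_tuples_compose[OF invsw inverse_tuples_compose[OF inv\<pi> inv]] unfolding \<beta>_def by blast
  define \<delta> where "\<delta> = (\<lambda>i::3. if i = 0 then \<beta> 1 else if i = 1 then \<beta> 0 else \<beta> 2)"
  have b: "\<beta> 0 = mvar 1" "\<beta> 1 = mvar 0"
  proof -
    show "\<beta> 0 = mvar 1" by (simp add: \<beta>_def a0 subst_simps \<chi>_def sw_def rename_def)
    have "subst \<chi> (\<pi> 0) = mvar 0" using inv\<pi> by (simp add: inverse_tuples_def)
    hence "subst \<chi> g = mvar 0" by (simp add: \<pi>_def)
    thus "\<beta> 1 = mvar 0" by (simp add: \<beta>_def subst_simps sw_def rename_def flip: g_def)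
  qed
  obtain \<beta>' where \<beta>': "inverse_tuples \<beta> \<beta>'" using inv\<beta> by blast
  have invswp: "inverse_tuples (rename (id(0 := 1, 1 := 0 :: 3))) (rename (id(0 := 1, 1 := 0)) :: 3 \<Rightarrow> (3, 'k) mpol)"
    by (rule inverse_tuples_rename) simp
  have "\<delta> = (\<lambda>i. subst \<beta> (rename (id(0 := 1, 1 := 0)) i))"
  proof
    fix i show "\<delta> i = subst \<beta> (rename (id(0 := 1, 1 := 0)) i)"
      by (cases i rule: exhaust_3) (simp_all add: \<delta>_def rename_def subst_simps)
  qed
  hence "\<exists>\<delta>'. inverse_tuples \<delta> \<delta>'" using inverse_tuples_compose[OF inverse_tuples_sym[OF \<beta>'] invswp] by blast
  then obtain \<delta>' where \<delta>': "inverse_tuples \<delta> \<delta>'" by blast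
  have "xy_poly (\<delta> 0)" "xy_poly (\<delta> 1)" using b by (simp_all add: \<delta>_def xy_poly_mvar)
  then obtain c s where s: "xy_poly s" "\<delta> 2 = mconst c * mvar 2 + s" using triangular_automorphism[OF \<delta>'] by blast
  hence \<beta>2: "\<beta> 2 = mconst c * mvar 2 + s" by (simp add: \<delta>_def)
  \<comment> \<open>Split off the part of s that is divisible by y, the variable standing for z at this point.\<close>
  define s0 where "s0 = hcomp y_wt 0 s"
  have "lookup m 1 \<noteq> 0" if "m \<in> keys (s - s0)" for m
    using that by (auto simp: s0_def in_keys_iff lookup_minus lookup_hcomp mon_weight_y_wt split: if_splits)
  hence "mvar 1 dvd s - s0" by (rule mvar_dvd)
  then obtain r where r: "s - s0 = mvar 1 * r" by (elim dvdE)
  have ts0: "xy_poly s0" using s(1) by (auto simp: s0_def xy_poly_def keys_hcomp)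
  have tr: "xy_poly r"
  proof (cases "r = 0")
    case False
    have "xy_poly (mvar 1 * r)" using xy_poly_diff[OF s(1) ts0] r by simp
    thus ?thesis using xy_poly_factor(2)[of "mvar 1" r] False by simp
  qed simp
  show thesis
  proof (rule that[OF inv\<pi> pl, of r])
    show "\<pi> 0 = \<alpha> 1" "\<pi> 1 = hcomp z_low 0 (\<alpha> 2)" by (simp_all add: \<pi>_def g_def h_eq)
    show "xy_poly r" by (rule tr)
    fix \<kappa> :: "3 \<Rightarrow> (3, 'k) mpol" assume k: "\<kappa> 0 = \<alpha> 1" "\<kappa> 1 = mvar 2"
    define \<nu> where "\<nu> = \<kappa>(2 := h)"
    have \<nu>: "\<nu> 0 = g" "\<nu> 1 = mvar 2" "\<nu> 2 = h" using k by (simp_all add: \<nu>_def g_def)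
    have \<nu>sw: "subst \<nu> (sw i) = \<pi> i" for i
      using \<nu> by (cases i rule: exhaust_3) (simp_all add: sw_def rename_def \<pi>_def subst_simps)
    have "subst \<nu> (subst sw q) = subst \<pi> q" for q by (simp add: subst_subst \<nu>sw)
    hence "subst \<nu> (\<beta> 2) = \<alpha> 2" by (simp add: \<beta>_def subst_inverse[OF inv\<pi>])
    hence e1: "\<alpha> 2 = mconst c * h + subst \<nu> s" by (simp add: \<beta>2 subst_simps \<nu>)
    have "s = s0 + mvar 1 * r" using r by (simp add: algebra_simps)
    hence "subst \<nu> s = subst \<nu> s0 + mvar 2 * subst \<nu> r" by (simp add: subst_simps \<nu>)
    moreover have "subst \<nu> r = subst \<kappa> r" by (rule xy_poly_subst_cong[OF tr]) (simp_all add: \<nu>_def)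
    ultimately have e2: "\<alpha> 2 = (mconst c * h + subst \<nu> s0) + mvar 2 * subst \<kappa> r" using e1 by simp
    have "xy_poly (subst \<nu> s0)"
    proof -
      have "subst \<nu> s0 = subst (\<nu>(1 := 0)) s0"
        unfolding peval_def by (intro sum.cong refl arg_cong[where f = "(*) _"])
          (simp add: prod_3 s0_def keys_hcomp mon_weight_y_wt)
      moreover have "xy_poly ((\<nu>(1 := 0)) i)" for i using \<nu> tg th by (cases i rule: exhaust_3) simp_all
      hence "xy_poly (subst (\<nu>(1 := 0)) s0)" by (rule xy_poly_subst_all)
      ultimately show ?thesis by simp
    qed
    hence t: "xy_poly (mconst c * h + subst \<nu> s0)" using th by (intro xy_poly_add xy_poly_mult) auto
    have "subst \<epsilon> (\<alpha> 2) = mconst c * h + subst \<nu> s0"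
    proof -
      have "subst \<epsilon> (mconst c * h + subst \<nu> s0) = mconst c * h + subst \<nu> s0" using t by (simp add: \<epsilon>_def subst_z_0 xy_poly_hcomp)
      moreover have "subst \<epsilon> (mvar 2 * subst \<kappa> r) = 0" by (simp add: subst_simps \<epsilon>_def)
      ultimately show ?thesis
        using arg_cong[OF e2, of "subst \<epsilon>"] unfolding ring_morph_add[OF ring_morph_subst, of _ _ "mvar 2 * _"] by simp
    qed
    moreover have "subst \<epsilon> (\<alpha> 2) = hcomp z_low 0 (\<alpha> 2)" by (simp add: \<epsilon>_def subst_z_0)
    ultimately have A: "hcomp z_low 0 (\<alpha> 2) = mconst c * h + subst \<nu> s0" by (rule trans[OF sym, rotated])
    show "\<alpha> 2 = hcomp z_low 0 (\<alpha> 2) + mvar 2 * subst \<kappa> r" unfolding A by (rule e2)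
  qed
qed

lemma wdeg_subst_eq:
  fixes \<theta> \<theta>' :: "'n::finite \<Rightarrow> ('n, 'r::comm_ring_1) mpol" and w v :: "'n \<Rightarrow> 'g::linordered_ab_group_add"
  assumes inv: "inverse_tuples \<theta> \<theta>'" and le: "\<And>i. deg_le v (w i) (\<theta> i)" "\<And>i. deg_le w (v i) (\<theta>' i)" and p: "p \<noteq> 0"
  shows "wdeg v (subst \<theta> p) = wdeg w p"
proof (rule antisym)
  have nz: "subst \<theta> p \<noteq> 0" using p subst_inverse(2)[OF inv, of p] by (metis subst_0)
  show "wdeg v (subst \<theta> p) \<le> wdeg w p" by (intro wdeg_least nz deg_le_subst[OF le(1)] wdeg_deg_le)
  have "wdeg w (subst \<theta>' (subst \<theta> p)) \<le> wdeg v (subst \<theta> p)"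
    by (intro wdeg_least deg_le_subst[OF le(2)] wdeg_deg_le) (simp add: subst_inverse[OF inv] p)
  thus "wdeg w p \<le> wdeg v (subst \<theta> p)" by (simp add: subst_inverse[OF inv])
qed

text \<open>The degrees of the two remaining components when one component has degree \<open>w 2\<close> through the
  monomial z. Here \<open>e1\<close> and \<open>e2\<close> are the degrees of an automorphism of the plane. The first of
  them becomes \<open>w 2\<close> when a multiple of the component containing z is added, and the second grows
  when a polynomial in the other two components is added.\<close>

definition slanted_degrees :: "(3 \<Rightarrow> 'g::linordered_ab_group_add) \<Rightarrow> 'g \<Rightarrow> 'g \<Rightarrow> bool" where
  "slanted_degrees w a b \<longleftrightarrow> (\<exists>e1 e2. planar_degrees w e1 e2 \<and> e1 \<le> w 2 \<and> (a = w 2 \<or> a = e1) \<and>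
     (b = e2 \<or> (e2 < b \<and> (\<exists>i j. b = nmul i e1 + nmul j (w 2)))))"

text \<open>The first component is \<open>a z + p\<close> with \<open>a \<noteq> 0\<close> and p of degree at most \<open>w 2\<close>, so exchanging
  it with z preserves degrees. Subtracting a multiple of it makes the second component free of z,
  and the tuple then has z as a component. Terms divisible by z cannot cancel against terms free
  of z, which determines the degree of the third component.\<close>

lemma slanted_case:
  fixes \<sigma> \<rho> :: "3 \<Rightarrow> (3, 'k::alg_closed_field) mpol" and w :: "3 \<Rightarrow> 'g::linordered_ab_group_add"
  assumes inv: "inverse_tuples \<sigma> \<rho>" and w: "\<And>i. 0 < w i"
    and d: "wdeg w (\<sigma> 0) \<le> w 2" "wdeg w (\<sigma> 1) \<le> w 2" and s: "\<not> xy_poly (\<sigma> 0)"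
  shows "wdeg w (\<sigma> 0) = w 2" "slanted_degrees w (wdeg w (\<sigma> 1)) (wdeg w (\<sigma> 2))"
proof -
  have dl: "deg_le w (w 2) (\<sigma> 0)" "deg_le w (w 2) (\<sigma> 1)" using d deg_le_mono[OF wdeg_deg_le] by blast+
  obtain a p where p: "\<sigma> 0 = mconst a * mvar 2 + p" "xy_poly p" "deg_le w (w 2) p" "a = lookup (\<sigma> 0) (single 2 1)"
    using small_degree_linear[of w, OF w dl(1)] .
  obtain b q where q: "\<sigma> 1 = mconst b * mvar 2 + q" "xy_poly q" "deg_le w (w 2) q" "b = lookup (\<sigma> 1) (single 2 1)"
    using small_degree_linear[of w, OF w dl(2)] .
  have a: "a \<noteq> 0"
  proof
    assume "a = 0"
    hence "\<sigma> 0 = p" using p(1) by simp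
    with s p(2) show False by simp
  qed
  show "wdeg w (\<sigma> 0) = w 2" using wdeg_eq_last[OF dl(1)] a unfolding p(4) by simp
  have ai: "mconst a * mconst (inverse a) = (1 :: (3, 'k) mpol)" "mconst (inverse a) * mconst a = (1 :: (3, 'k) mpol)"
    using a by (simp_all flip: ring_morph_mult[OF ring_morph_mconst])
  \<comment> \<open>\<open>\<theta>\<close> maps the first component to z and keeps x and y.\<close>
  define \<theta> where "\<theta> = mvar(2 := mconst (inverse a) * (mvar 2 - p))"
  define \<theta>' where "\<theta>' = mvar(2 := mconst a * mvar 2 + p)"
  have fixp: "subst (mvar(2 := x)) p = p" for x
    using xy_poly_subst_cong[OF p(2), of "mvar(2 := x)" mvar] by (simp add: subst_mvar)
  have \<theta>0: "subst \<theta> (mconst a * mvar 2 + p) = mvar 2"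
    using fixp ai by (simp add: \<theta>_def subst_simps flip: mult.assoc)
  have inv\<theta>: "inverse_tuples \<theta> \<theta>'"
    unfolding inverse_tuples_def
  proof (intro conjI allI)
    fix i
    show "subst \<theta> (\<theta>' i) = mvar i" using \<theta>0
      by (cases "i = 2") (simp_all add: \<theta>'_def, simp add: \<theta>_def subst_simps)
    show "subst \<theta>' (\<theta> i) = mvar i"
      using fixp ai by (cases "i = 2") (simp_all add: \<theta>'_def \<theta>_def subst_simps flip: mult.assoc)
  qed
  have w\<theta>: "deg_le w (w i) (\<theta> i)" "deg_le w (w i) (\<theta>' i)" for i
    using p(3) by (cases "i = 2"; simp add: \<theta>_def \<theta>'_def deg_le_mconst_mult deg_le_diff deg_le_add deg_le_mvar)+
  define e where "e = b * inverse a"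
  define E :: "3 \<Rightarrow> (3, 'k) mpol" where "E = mvar(1 := mvar 1 - mconst e * mvar 0)"
  define E' :: "3 \<Rightarrow> (3, 'k) mpol" where "E' = mvar(1 := mvar 1 + mconst e * mvar 0)"
  have invE: "inverse_tuples E E'"
    unfolding inverse_tuples_def
  proof (intro conjI allI)
    fix i
    show "subst E (E' i) = mvar i" "subst E' (E i) = mvar i"
      by (cases "i = 1"; simp add: E_def E'_def subst_simps)+
  qed
  define g where "g = q - mconst e * p"
  have g\<sigma>: "g = \<sigma> 1 - mconst e * \<sigma> 0"
  proof -
    have "mconst e * mconst a = (mconst b :: (3, 'k) mpol)"
      using a unfolding ring_morph_mult[OF ring_morph_mconst, symmetric] by (simp add: e_def mult.assoc)
    thus ?thesis by (simp add: g_def p(1) q(1) algebra_simps flip: mult.assoc)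
  qed
  have tg: "xy_poly g" unfolding g_def by (intro xy_poly_diff xy_poly_mult p q xy_poly_mconst)
  have dg: "deg_le w (w 2) g" unfolding g_def by (intro deg_le_diff deg_le_mconst_mult q p)
  define \<alpha> where "\<alpha> = (\<lambda>i. subst \<theta> (subst \<sigma> (E i)))"
  have "\<exists>\<gamma>. inverse_tuples \<alpha> \<gamma>"
    using inverse_tuples_compose[OF inverse_tuples_sym[OF inv\<theta>] inverse_tuples_compose[OF inverse_tuples_sym[OF inv] invE]]
    unfolding \<alpha>_def by blast
  then obtain \<gamma> where inv\<alpha>: "inverse_tuples \<alpha> \<gamma>" by blast
  have \<alpha>0: "\<alpha> 0 = mvar 2" using \<theta>0 p(1) by (simp add: \<alpha>_def E_def subst_simps)
  have "subst \<theta> g = g" using xy_poly_subst_cong[OF tg, of \<theta> mvar] by (simp add: subst_mvar \<theta>_def)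
  hence \<alpha>1: "\<alpha> 1 = g" by (simp add: \<alpha>_def E_def subst_simps flip: g\<sigma>)
  have \<alpha>2: "\<alpha> 2 = subst \<theta> (\<sigma> 2)" by (simp add: \<alpha>_def E_def subst_simps)
  have nz: "\<sigma> i \<noteq> 0" "\<alpha> i \<noteq> 0" for i
    using inverse_tuples_not_const[OF inv, of i 0] inverse_tuples_not_const[OF inv\<alpha>, of i 0] by simp_all
  have deg2: "wdeg w (\<alpha> 2) = wdeg w (\<sigma> 2)" unfolding \<alpha>2 by (rule wdeg_subst_eq[OF inv\<theta> w\<theta> nz(1)])
  obtain \<pi> \<chi> r where \<pi>: "inverse_tuples \<pi> \<chi>" "planar \<pi>" "planar \<chi>" "\<pi> 0 = \<alpha> 1" "\<pi> 1 = hcomp z_low 0 (\<alpha> 2)"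
    and r: "xy_poly r" "\<And>\<kappa>. \<kappa> 0 = \<alpha> 1 \<Longrightarrow> \<kappa> 1 = mvar 2 \<Longrightarrow> \<alpha> 2 = hcomp z_low 0 (\<alpha> 2) + mvar 2 * subst \<kappa> r"
    using tuple_with_last_variable[OF inv\<alpha> \<alpha>0] tg \<alpha>1 by metis
  define h where "h = hcomp z_low 0 (\<alpha> 2)"
  have pd: "planar_degrees w (wdeg w g) (wdeg w h)"
    using planar_automorphism_degrees[where w = w, OF \<pi>(1-3) w w] by (simp add: \<pi>(4,5) \<alpha>1 h_def)
  have e1: "wdeg w g \<le> w 2" using wdeg_least[OF _ dg] nz(2)[of 1] \<alpha>1 by simp
  have d1: "wdeg w (\<sigma> 1) = w 2 \<or> wdeg w (\<sigma> 1) = wdeg w g"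
  proof (cases "b = 0")
    case True
    hence "g = \<sigma> 1" by (simp add: g\<sigma> e_def)
    thus ?thesis by simp
  next
    case False
    thus ?thesis using wdeg_eq_last[OF dl(2)] unfolding q(4) by simp
  qed
  have h0: "h \<noteq> 0" using inverse_tuples_not_const[OF \<pi>(1), of 1 0] \<pi>(5) by (simp add: h_def)
  define \<kappa> where "\<kappa> = (\<lambda>i::3. if i = 0 then g else if i = 1 then mvar 2 else h)"
  have \<kappa>: "\<kappa> 0 = g" "\<kappa> 1 = mvar 2" "\<kappa> 2 = h" by (simp_all add: \<kappa>_def)
  define v where "v = mvar 2 * subst \<kappa> r"
  have \<alpha>2v: "\<alpha> 2 = h + v" using r(2)[of \<kappa>] \<kappa> \<alpha>1 by (simp add: h_def v_def)
  have th: "xy_poly h" by (simp add: h_def)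
  have "wdeg w (\<alpha> 2) = wdeg w h \<or> (wdeg w h < wdeg w (\<alpha> 2) \<and> (\<exists>i j. wdeg w (\<alpha> 2) = nmul i (wdeg w g) + nmul j (w 2)))"
  proof -
    have hk: "keys h \<subseteq> keys (\<alpha> 2)" by (auto simp: h_def keys_hcomp)
    hence ge: "wdeg w h \<le> wdeg w (\<alpha> 2)" using wdeg_attained[OF h0, of w] wdeg_ge[of _ "\<alpha> 2" w] by (metis subsetD)
    obtain m where m: "m \<in> keys (\<alpha> 2)" "mon_weight w m = wdeg w (\<alpha> 2)" using wdeg_attained[OF nz(2)] by blast
    show ?thesis
    proof (cases "wdeg w h < wdeg w (\<alpha> 2)")
      case False
      thus ?thesis using ge by auto
    next
      case True
      have "m \<notin> keys h" using wdeg_ge[of m h w] m True by auto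
      hence mv: "m \<in> keys v" using m(1) keys_add[of h v] by (auto simp: \<alpha>2v)
      have vk: "keys v \<subseteq> keys (\<alpha> 2)"
      proof
        fix n assume n: "n \<in> keys v"
        have "hcomp z_low 0 v = 0"
        proof -
          have "hcomp z_low 0 (\<alpha> 2) = hcomp z_low 0 h + hcomp z_low 0 v" by (simp add: \<alpha>2v hcomp_add)
          thus ?thesis by (simp add: h_def hcomp_hcomp)
        qed
        hence "lookup (hcomp z_low 0 v) n = 0" by simp
        hence "lookup n 2 \<noteq> 0" using n by (auto simp: lookup_hcomp mon_weight_z_low in_keys_iff split: if_splits)
        hence "n \<notin> keys h" using th by (auto simp: xy_poly_def)
        thus "n \<in> keys (\<alpha> 2)" using n by (simp add: \<alpha>2v in_keys_iff lookup_add)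
      qed
      have r0: "r \<noteq> 0" using mv by (auto simp: v_def subst_simps)
      have gpos: "0 < wdeg w g"
      proof (rule ccontr)
        assume "\<not> 0 < wdeg w g"
        hence "deg_le w 0 g" using deg_le_mono[OF wdeg_deg_le, of w g 0] by simp
        then obtain c where "g = mconst c" using homogeneous_0_const[of w g, OF w w tg] by blast
        thus False using inverse_tuples_not_const[OF inv\<alpha>, of 1] \<alpha>1 by blast
      qed
      have g0: "g \<noteq> 0" using nz(2)[of 1] \<alpha>1 by simp
      obtain i j where ij: "wdeg w (subst \<kappa> r) = nmul i (wdeg w g) + nmul j (w 2)" and sn: "subst \<kappa> r \<noteq> 0"
        using wdeg_bivariate_subst[OF r(1) r0 tg gpos g0 th \<kappa>] by blast
      have vd: "wdeg w v = nmul i (wdeg w g) + nmul (Suc j) (w 2)"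
        by (simp add: v_def wdeg_mult sn ij wdeg_mvar add.left_commute)
      have v0: "v \<noteq> 0" using sn by (simp add: v_def)
      have "wdeg w v = wdeg w (\<alpha> 2)"
      proof (rule antisym)
        show "wdeg w v \<le> wdeg w (\<alpha> 2)" using wdeg_attained[OF v0, of w] wdeg_ge[of _ "\<alpha> 2" w] vk by (metis subsetD)
        show "wdeg w (\<alpha> 2) \<le> wdeg w v" using wdeg_ge[OF mv, of w] m by simp
      qed
      thus ?thesis using True vd by metis
    qed
  qed
  thus "slanted_degrees w (wdeg w (\<sigma> 1)) (wdeg w (\<sigma> 2))"
    unfolding slanted_degrees_def deg2 using pd e1 d1 by blast
qed

section \<open>Tame tuples over an arbitrary ring\<close>

definition tame :: "('n::finite \<Rightarrow> ('n, 'r::comm_ring_1) mpol) \<Rightarrow> bool" where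
  "tame \<sigma> \<longleftrightarrow> (\<exists>F\<in>elem_auts. \<forall>i. F (mvar i) = \<sigma> i)"

lemma poly_auts_ring_morph:
  assumes "F \<in> poly_auts" shows "ring_morph F" "F (mconst c) = mconst c"
proof -
  have c: "F (mconst c) = mconst c" for c using assms by (simp add: poly_auts_def)
  show "F (mconst c) = mconst c" by (rule c)
  show "ring_morph F" using assms c[of 1] by (auto simp: poly_auts_def ring_morph_def)
qed

lemma elem_auts_subset: "elem_auts \<subseteq> poly_auts"
proof -
  have "{F. elementary F} \<subseteq> carrier poly_aut_group"
    by (auto simp: elementary_def poly_aut_group_def)
  from group.generate_incl[OF group_poly_aut_group this] show ?thesis
    by (simp add: elem_auts_def poly_aut_group_def)
qed

lemma elem_auts_comp: "F \<in> elem_auts \<Longrightarrow> G \<in> elem_auts \<Longrightarrow> F \<circ> G \<in> elem_auts"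
  using generate.eng[of F poly_aut_group _ G] by (simp add: elem_auts_def poly_aut_group_def)

lemma elementary_in_elem_auts: "elementary F \<Longrightarrow> F \<in> elem_auts"
  by (simp add: elem_auts_def generate.incl)

lemma subst_in_poly_auts:
  assumes "inverse_tuples \<sigma> \<rho>" shows "subst \<sigma> \<in> poly_auts"
proof -
  have "bij (subst \<sigma>)"
    by (rule o_bij[of "subst \<rho>"]) (auto simp: subst_inverse[OF assms])
  thus ?thesis by (simp add: poly_auts_def subst_simps)
qed

lemma free_subst:
  assumes "\<And>m. m \<in> keys p \<Longrightarrow> lookup m l = 0"
  shows "subst (\<sigma>(l := x)) p = subst \<sigma> p"
  unfolding peval_def
proof (intro sum.cong refl arg_cong[where f = "(*) _"] prod.cong)
  fix m i assume "m \<in> keys p"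
  thus "(\<sigma>(l := x)) i ^ lookup m i = \<sigma> i ^ lookup m i" using assms by (cases "i = l") simp_all
qed

text \<open>An elementary automorphism on the inner side of a composite acts on the tuple by an elementary
  operation on its entries.\<close>

lemma tame_step:
  assumes t: "tame \<sigma>" and a: "a * a' = 1" and p: "\<And>m. m \<in> keys p \<Longrightarrow> lookup m l = 0"
  shows "tame (\<sigma>(l := mconst a * \<sigma> l + subst \<sigma> p))"
proof -
  define \<eta> where "\<eta> = mvar(l := mconst a * mvar l + p)"
  define \<theta> where "\<theta> = mvar(l := mconst a' * (mvar l - p))"
  have aa: "mconst a * mconst a' = (1 :: ('a, 'b) mpol)" "mconst a' * mconst a = (1 :: ('a, 'b) mpol)"
    using a by (simp_all add: mult.commute flip: ring_morph_mult[OF ring_morph_mconst])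
  have fix_p: "subst (mvar(l := x)) p = p" for x using free_subst[of p l mvar x] p by (simp add: subst_mvar)
  have "inverse_tuples \<eta> \<theta>"
    unfolding inverse_tuples_def
  proof (intro conjI allI)
    fix i
    show "subst \<eta> (\<theta> i) = mvar i" using fix_p aa
      by (cases "i = l") (simp_all add: \<eta>_def \<theta>_def subst_simps flip: mult.assoc)
    show "subst \<theta> (\<eta> i) = mvar i" using fix_p aa
      by (cases "i = l") (simp_all add: \<eta>_def \<theta>_def subst_simps flip: mult.assoc)
  qed
  hence "subst \<eta> \<in> poly_auts" by (rule subst_in_poly_auts)
  hence "elementary (subst \<eta>)"
    unfolding elementary_def
    by (intro conjI exI[of _ l] exI[of _ a] exI[of _ p] dvdI[of _ _ a'])
       (use p a in \<open>simp_all add: \<eta>_def subst_simps\<close>)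
  hence e: "subst \<eta> \<in> elem_auts" by (rule elementary_in_elem_auts)
  obtain F where F: "F \<in> elem_auts" "\<And>i. F (mvar i) = \<sigma> i" using t by (auto simp: tame_def)
  have Fp: "F \<in> poly_auts" using F elem_auts_subset by blast
  note Fm = poly_auts_ring_morph[OF Fp]
  have "F p = subst \<sigma> p" using morph_eq_subst[OF Fm] F by simp
  hence "(F \<circ> subst \<eta>) (mvar i) = (\<sigma>(l := mconst a * \<sigma> l + subst \<sigma> p)) i" for i
    by (cases "i = l") (simp_all add: \<eta>_def subst_simps F Fm ring_morph_simps[OF Fm(1)])
  thus ?thesis unfolding tame_def using elem_auts_comp[OF F(1) e] by blast
qed

lemma tame_mvar: "tame mvar"
  unfolding tame_def
proof
  show "id \<in> elem_auts" using generate.one[of poly_aut_group] by (simp add: elem_auts_def poly_aut_group_def)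
qed simp

lemma tame_add_monomial:
  assumes "tame \<sigma>" "lookup m l = 0"
  shows "tame (\<sigma>(l := \<sigma> l + (\<Prod>i\<in>UNIV. \<sigma> i ^ lookup m i)))"
  using tame_step[OF assms(1), of 1 1 "single m 1" l] assms(2)
  by (simp add: peval_single[OF ring_morph_mconst])

lemma tame_add_power:
  assumes "tame \<sigma>" "k \<noteq> l"
  shows "tame (\<sigma>(l := \<sigma> l + \<sigma> k ^ n))"
proof -
  have "lookup (single k n) l = 0" using assms(2) by (simp add: lookup_single)
  from tame_add_monomial[OF assms(1) this] show ?thesis by (simp only: prod_delta_power)
qed

text \<open>Row operations: (f, g), (f + g, g), (f + g, -f), (g, -f), (g, f).\<close>

lemma tame_swap:
  assumes t: "tame \<sigma>" and jk: "j \<noteq> k"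
  shows "tame (\<sigma>(j := \<sigma> k, k := \<sigma> j))"
proof -
  define \<sigma>1 where "\<sigma>1 = \<sigma>(j := \<sigma> j + \<sigma> k)"
  have 1: "tame \<sigma>1" using tame_add_power[OF t, of k j 1] jk by (simp add: \<sigma>1_def)
  define \<sigma>2 where "\<sigma>2 = \<sigma>1(k := - \<sigma> j)"
  have "tame (\<sigma>1(k := mconst 1 * \<sigma>1 k + subst \<sigma>1 (- mvar j)))"
    by (rule tame_step[OF 1, of 1 1]) (use jk in \<open>simp_all add: mvar_def lookup_single when_def\<close>)
  hence 2: "tame \<sigma>2" using jk by (simp add: \<sigma>1_def \<sigma>2_def subst_simps)
  define \<sigma>3 where "\<sigma>3 = \<sigma>2(j := \<sigma> k)"
  have 3: "tame \<sigma>3" using tame_add_power[OF 2, of k j 1] jk by (simp add: \<sigma>1_def \<sigma>2_def \<sigma>3_def)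
  have "tame (\<sigma>3(k := mconst (-1) * \<sigma>3 k + subst \<sigma>3 0))"
    by (rule tame_step[OF 3, of "-1" "-1"]) simp_all
  hence "tame (\<sigma>3(k := \<sigma> j))"
    using jk by (simp add: \<sigma>2_def \<sigma>3_def subst_0 ring_morph_uminus[OF ring_morph_mconst])
  moreover have "\<sigma>3(k := \<sigma> j) = \<sigma>(j := \<sigma> k, k := \<sigma> j)"
    using jk by (auto simp: \<sigma>1_def \<sigma>2_def \<sigma>3_def)
  ultimately show ?thesis by simp
qed

lemma tame_comp:
  assumes s: "tame s" and t: "tame \<sigma>" shows "tame (\<lambda>i. subst s (\<sigma> i))"
proof -
  obtain F where F: "F \<in> elem_auts" "\<And>i. F (mvar i) = \<sigma> i" using t by (auto simp: tame_def)
  obtain G where G: "G \<in> elem_auts" "\<And>i. G (mvar i) = s i" using s by (auto simp: tame_def)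
  have Gp: "G \<in> poly_auts" using G elem_auts_subset by blast
  have "G p = subst s p" for p using morph_eq_subst[OF poly_auts_ring_morph[OF Gp]] G by simp
  hence "(G \<circ> F) (mvar i) = subst s (\<sigma> i)" for i by (simp add: F)
  thus ?thesis unfolding tame_def using elem_auts_comp[OF G(1) F(1)] by blast
qed

section \<open>Leading monomials with coefficient one\<close>

text \<open>A monomial with coefficient 1 is a nonzero divisor over every ring, and products of such monomials
  do not vanish. So degrees of tuples with initial forms of this kind can be computed over rings
  with zero divisors as well.\<close>

definition monic_lead :: "('n::finite \<Rightarrow> 'g::linordered_ab_group_add) \<Rightarrow> 'g \<Rightarrow> ('n, 'r::comm_ring_1) mpol \<Rightarrow> bool" where
  "monic_lead w D p \<longleftrightarrow> (\<exists>m. mon_weight w m = D \<and> deg_lt w D (p - single m 1))"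

lemma deg_le_single: "mon_weight w m = D \<Longrightarrow> deg_le w D (single m c)"
  by (simp add: deg_le_def)

lemma monic_lead_deg_le: "monic_lead w D p \<Longrightarrow> deg_le w D p"
proof -
  assume "monic_lead w D p"
  then obtain m where m: "mon_weight w m = D" "deg_lt w D (p - single m 1)" by (auto simp: monic_lead_def)
  have "deg_le w D ((p - single m 1) + single m 1)"
    by (rule deg_le_add[OF deg_lt_imp_deg_le[OF m(2)] deg_le_single[OF m(1)]])
  thus ?thesis by simp
qed

lemma monic_lead_mvar: "monic_lead w (w i) (mvar i)"
  unfolding monic_lead_def
  by (rule exI[of _ "single i 1"]) (simp add: mon_weight_single mvar_def deg_lt_def del: One_nat_def)

lemma monic_lead_1: "monic_lead w 0 1"
  unfolding monic_lead_def by (rule exI[of _ 0]) (simp add: deg_lt_def)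

lemma monic_lead_mult:
  assumes p: "monic_lead w D p" and q: "monic_lead w E q"
  shows "monic_lead w (D + E) (p * q)"
proof -
  obtain m where m: "mon_weight w m = D" "deg_lt w D (p - single m 1)" using p by (auto simp: monic_lead_def)
  obtain n where n: "mon_weight w n = E" "deg_lt w E (q - single n 1)" using q by (auto simp: monic_lead_def)
  have "p * q - single (m + n) 1 = single m 1 * (q - single n 1) + (p - single m 1) * q"
    by (simp add: algebra_simps mult_single)
  moreover have "deg_lt w (D + E) (single m 1 * (q - single n 1) + (p - single m 1) * q)"
    by (intro deg_lt_add deg_lt_mult1 deg_lt_mult2 deg_le_single m n monic_lead_deg_le[OF q])
  ultimately show ?thesis unfolding monic_lead_def
    by (intro exI[of _ "m + n"]) (simp add: mon_weight_add m n)
qed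

lemma monic_lead_power: "monic_lead w D p \<Longrightarrow> monic_lead w (nmul k D) (p ^ k)"
  by (induction k) (auto simp: monic_lead_1 monic_lead_mult)

lemma monic_lead_add:
  assumes "monic_lead w D p" "monic_lead w E q" "E < D"
  shows "monic_lead w D (q + p)"
proof -
  obtain m where m: "mon_weight w m = D" "deg_lt w D (p - single m 1)" using assms(1) by (auto simp: monic_lead_def)
  have "deg_lt w D (q + (p - single m 1))"
    by (intro deg_lt_add deg_le_imp_deg_lt[OF monic_lead_deg_le[OF assms(2)]] assms m)
  thus ?thesis using m(1) unfolding monic_lead_def by (intro exI[of _ m]) (simp add: add_diff_eq)
qed

lemma nonzero_divisor_monomial: "nonzero_divisor (single m (1::'r::comm_ring_1) :: ('n::finite, 'r) mpol)"
  unfolding nonzero_divisor_def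
proof (intro allI impI)
  fix g :: "('n, 'r) mpol" assume z: "single m 1 * g = 0"
  have "single m 1 * g = (\<Sum>n\<in>keys g. single (m + n) (lookup g n))"
    by (subst mpol_expand[of g]) (simp add: sum_distrib_left mult_single)
  hence "(\<Sum>n\<in>keys g. single (m + n) (lookup g n)) = 0" using z by simp
  hence "lookup (\<Sum>n\<in>keys g. single (m + n) (lookup g n)) (m + k) = 0" for k by simp
  hence "(if k \<in> keys g then lookup g k else 0) = 0" for k
    by (simp add: lookup_sum lookup_single when_def)
  hence "lookup g k = 0" for k by (metis in_keys_iff)
  thus "g = 0" by (intro poly_mapping_eqI) simp
qed

lemma monic_lead_wdeg:
  fixes p :: "('n::finite, 'r::comm_ring_1) mpol"
  assumes "monic_lead w D p"
  shows "wdeg w p = D" "nonzero_divisor (init_form w p)"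
proof -
  obtain m where m: "mon_weight w m = D" "deg_lt w D (p - single m 1)" using assms by (auto simp: monic_lead_def)
  have "hcomp w D p = hcomp w D (single m 1) + hcomp w D (p - single m 1)" by (simp flip: hcomp_add)
  also have "\<dots> = single m 1" using m hcomp_deg_lt[OF m(2)] hcomp_id[of "single m 1" w D] by simp
  finally have h: "hcomp w D p = single m 1" .
  show "wdeg w p = D" by (rule wdeg_eqI[OF monic_lead_deg_le[OF assms]]) (metis h lookup_single_eq lookup_zero zero_neq_one)
  thus "nonzero_divisor (init_form w p)" by (simp add: init_form_hcomp h nonzero_divisor_monomial)
qed

section \<open>Realization of degrees\<close>

text \<open>If the target degree equals the present one, nothing is added, since a sum of two monomials of the
  same weight would destroy the shape of the initial form.\<close>

lemma raise_degree:
  assumes "tame \<sigma>" "i \<noteq> j" "monic_lead w A (\<sigma> j)" "monic_lead w B (\<sigma> i)" "A \<le> nmul n B"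
  shows "\<exists>\<sigma>'. tame \<sigma>' \<and> (\<forall>k. k \<noteq> j \<longrightarrow> \<sigma>' k = \<sigma> k) \<and> monic_lead w (nmul n B) (\<sigma>' j)"
proof (cases "A = nmul n B")
  case True thus ?thesis using assms by (intro exI[of _ \<sigma>]) simp
next
  case False
  thus ?thesis using assms tame_add_power[OF assms(1,2), of n]
    by (intro exI[of _ "\<sigma>(j := \<sigma> j + \<sigma> i ^ n)"])
       (auto intro!: monic_lead_add[of w "nmul n B" _ A] monic_lead_power)
qed

lemma realize_swap:
  fixes \<sigma> :: "3 \<Rightarrow> (3, 'r::comm_ring_1) mpol"
  assumes "\<exists>\<sigma>'. tame \<sigma>' \<and> \<sigma>' 2 = \<sigma> 2 \<and> monic_lead w E (\<sigma>' 1) \<and> monic_lead w F (\<sigma>' 0)"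
  shows "\<exists>\<sigma>'. tame \<sigma>' \<and> \<sigma>' 2 = \<sigma> 2 \<and> monic_lead w E (\<sigma>' 0) \<and> monic_lead w F (\<sigma>' 1)"
proof -
  from assms obtain \<tau> where \<tau>: "tame \<tau>" "\<tau> 2 = \<sigma> 2" "monic_lead w F (\<tau> 0)" "monic_lead w E (\<tau> 1)" by auto
  have "tame (\<tau>(0 := \<tau> 1, 1 := \<tau> 0))" by (rule tame_swap[OF \<tau>(1)]) simp
  thus ?thesis using \<tau> by (intro exI[of _ "\<tau>(0 := \<tau> 1, 1 := \<tau> 0)"]) simp
qed

text \<open>First a power of one component raises the other one to \<open>E\<close>, then a power of the latter raises the
  former to \<open>F\<close>. If \<open>E\<close> is one of the weights, one such step leads to \<open>F\<close>.\<close>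

lemma realize_chain:
  fixes \<sigma> :: "3 \<Rightarrow> (3, 'r::comm_ring_1) mpol"
  assumes w: "0 < w 0" "0 < w 1" and ch: "chain w E F"
    and t: "tame \<sigma>" and l: "monic_lead w (w 0) (\<sigma> 0)" "monic_lead w (w 1) (\<sigma> 1)"
  shows "\<exists>\<sigma>'. tame \<sigma>' \<and> \<sigma>' 2 = \<sigma> 2 \<and> monic_lead w E (\<sigma>' 0) \<and> monic_lead w F (\<sigma>' 1)"
proof -
  obtain u where u: "1 \<le> u" "F = nmul u E" and
    cases: "(\<exists>s\<ge>1. E = nmul s (w 0) \<and> w 1 \<le> E) \<or> (\<exists>s\<ge>1. E = nmul s (w 1) \<and> w 0 \<le> E) \<or>
      (E = w 0 \<and> w 1 \<le> F) \<or> (E = w 1 \<and> w 0 \<le> F)" using ch unfolding chain_def by blast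
  have two: "\<exists>\<sigma>'. tame \<sigma>' \<and> \<sigma>' 2 = \<sigma> 2 \<and> monic_lead w E (\<sigma>' j) \<and> monic_lead w F (\<sigma>' i)"
    if ij: "i \<noteq> j" "i \<noteq> 2" "j \<noteq> 2" "1 \<le> s" "E = nmul s (w i)" "w j \<le> E"
      "monic_lead w (w i) (\<sigma> i)" "monic_lead w (w j) (\<sigma> j)" "0 < w i" for i j s
  proof -
    obtain \<tau> where \<tau>: "tame \<tau>" "\<forall>k. k \<noteq> j \<longrightarrow> \<tau> k = \<sigma> k" "monic_lead w E (\<tau> j)"
      using raise_degree[OF t ij(1) ij(8,7), of s] ij by auto
    have i: "monic_lead w (w i) (\<tau> i)" using \<tau>(2) ij(1,7) by simp
    have "w i \<le> E" using ij le_nmul[of s "w i"] by simp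
    hence "w i \<le> nmul u E" using le_nmul[of u E] u ij(9) by (metis less_le_trans order_trans)
    from raise_degree[OF \<tau>(1) _ i \<tau>(3) this] obtain \<tau>' where "tame \<tau>'" "\<forall>k. k \<noteq> i \<longrightarrow> \<tau>' k = \<tau> k" "monic_lead w F (\<tau>' i)"
      using ij(1) u(2) by auto
    thus ?thesis using \<tau> ij(1-3) by (intro exI[of _ \<tau>']) auto
  qed
  have one: "\<exists>\<sigma>'. tame \<sigma>' \<and> \<sigma>' 2 = \<sigma> 2 \<and> monic_lead w E (\<sigma>' i) \<and> monic_lead w F (\<sigma>' j)"
    if ij: "i \<noteq> j" "i \<noteq> 2" "j \<noteq> 2" "E = w i" "w j \<le> F"
      "monic_lead w (w i) (\<sigma> i)" "monic_lead w (w j) (\<sigma> j)" for i j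
  proof -
    obtain \<tau> where \<tau>: "tame \<tau>" "\<forall>k. k \<noteq> j \<longrightarrow> \<tau> k = \<sigma> k" "monic_lead w F (\<tau> j)"
      using raise_degree[OF t ij(1,7,6), of u] ij u by auto
    thus ?thesis using ij by (intro exI[of _ \<tau>]) auto
  qed
  from cases show ?thesis
  proof (elim disjE exE conjE)
    fix s assume *: "1 \<le> s" "E = nmul s (w 0)" "w 1 \<le> E"
    show ?thesis by (rule realize_swap) (use * two[of 0 1 s] w l in simp)
  next
    fix s assume "1 \<le> s" "E = nmul s (w 1)" "w 0 \<le> E"
    thus ?thesis using two[of 1 0 s] w l by simp
  next
    assume "E = w 0" "w 1 \<le> F" thus ?thesis using one[of 0 1] l by simp
  next
    assume *: "E = w 1" "w 0 \<le> F"
    show ?thesis by (rule realize_swap) (use * one[of 1 0] l in simp)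
  qed
qed

lemma realize_planar:
  fixes \<sigma> :: "3 \<Rightarrow> (3, 'r::comm_ring_1) mpol"
  assumes w: "0 < w 0" "0 < w 1" and pd: "planar_degrees w E F"
    and t: "tame \<sigma>" and l: "monic_lead w (w 0) (\<sigma> 0)" "monic_lead w (w 1) (\<sigma> 1)"
  shows "\<exists>\<sigma>'. tame \<sigma>' \<and> \<sigma>' 2 = \<sigma> 2 \<and> monic_lead w E (\<sigma>' 0) \<and> monic_lead w F (\<sigma>' 1)"
proof -
  from pd show ?thesis unfolding planar_degrees_def
  proof (elim disjE conjE)
    assume "E = w 0" "F = w 1" thus ?thesis using t l by blast
  next
    assume *: "E = w 1" "F = w 0"
    show ?thesis by (rule realize_swap) (use * t l in blast)
  next
    assume "chain w E F" thus ?thesis by (rule realize_chain[OF w _ t l])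
  next
    assume "chain w F E"
    from realize_chain[OF w this t l] have "\<exists>\<sigma>'. tame \<sigma>' \<and> \<sigma>' 2 = \<sigma> 2 \<and> monic_lead w E (\<sigma>' 1) \<and> monic_lead w F (\<sigma>' 0)" by blast
    thus ?thesis by (rule realize_swap)
  qed
qed

text \<open>The type argument fixes the coefficient ring, which the other two arguments do not determine.\<close>

definition realizable :: "'r::comm_ring_1 itself \<Rightarrow> (3 \<Rightarrow> 'g::linordered_ab_group_add) \<Rightarrow> (3 \<Rightarrow> 'g) \<Rightarrow> bool" where
  "realizable (_ :: 'r itself) w d \<longleftrightarrow> (\<exists>\<sigma> :: 3 \<Rightarrow> (3, 'r) mpol. tame \<sigma> \<and> (\<forall>i. monic_lead w (d i) (\<sigma> i)))"

lemma realizable_swap: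
  assumes "realizable TYPE('r::comm_ring_1) w d" shows "realizable TYPE('r) w (d(j := d k, k := d j))"
proof (cases "j = k")
  case True thus ?thesis using assms by simp
next
  case False
  obtain \<sigma> :: "3 \<Rightarrow> (3, 'r) mpol" where \<sigma>: "tame \<sigma>" "\<And>i. monic_lead w (d i) (\<sigma> i)" using assms by (auto simp: realizable_def)
  show ?thesis unfolding realizable_def
    by (intro exI[of _ "\<sigma>(j := \<sigma> k, k := \<sigma> j)"] conjI tame_swap \<sigma> False) (use \<sigma> in simp)
qed

lemma realizable_triangular:
  assumes w: "\<And>i. 0 < w i" and pd: "planar_degrees w (d 0) (d 1)"
    and d2: "d 2 = w 2 \<or> (w 2 < d 2 \<and> (\<exists>i j. d 2 = nmul i (w 0) + nmul j (w 1)))"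
  shows "realizable TYPE('r::comm_ring_1) w d"
proof -
  have "\<exists>\<sigma> :: 3 \<Rightarrow> (3, 'r) mpol. tame \<sigma> \<and> \<sigma> 0 = mvar 0 \<and> \<sigma> 1 = mvar 1 \<and> monic_lead w (d 2) (\<sigma> 2)"
    using d2
  proof (elim disjE conjE exE)
    assume "d 2 = w 2"
    thus ?thesis by (intro exI[of _ mvar]) (simp add: tame_mvar monic_lead_mvar)
  next
    fix i j assume *: "w 2 < d 2" "d 2 = nmul i (w 0) + nmul j (w 1)"
    let ?m = "single 0 i + single 1 j :: 3 mon"
    let ?\<sigma> = "mvar(2 := mvar 2 + mvar 0 ^ i * mvar 1 ^ j) :: 3 \<Rightarrow> (3, 'r) mpol"
    have "tame (mvar(2 := mvar 2 + (\<Prod>i\<in>UNIV. mvar i ^ lookup ?m i)) :: 3 \<Rightarrow> (3, 'r) mpol)"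
      by (rule tame_add_monomial[OF tame_mvar]) (simp add: lookup_add lookup_single when_def)
    hence "tame ?\<sigma>" by (simp add: prod_3 lookup_add lookup_single when_def)
    moreover have "monic_lead w (d 2) (?\<sigma> 2)"
      using * by (simp add: monic_lead_add[where E = "w 2"] monic_lead_mult monic_lead_power monic_lead_mvar)
    ultimately show ?thesis by (intro exI[of _ ?\<sigma>]) simp
  qed
  then obtain \<sigma> :: "3 \<Rightarrow> (3, 'r) mpol" where \<sigma>: "tame \<sigma>" "\<sigma> 0 = mvar 0" "\<sigma> 1 = mvar 1" "monic_lead w (d 2) (\<sigma> 2)" by blast
  obtain \<sigma>' where \<sigma>': "tame \<sigma>'" "\<sigma>' 2 = \<sigma> 2" "monic_lead w (d 0) (\<sigma>' 0)" "monic_lead w (d 1) (\<sigma>' 1)"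
    using realize_planar[of w, OF w w pd \<sigma>(1)] \<sigma>(2,3) by (auto simp: monic_lead_mvar)
  have "monic_lead w (d i) (\<sigma>' i)" for i using \<sigma> \<sigma>' by (cases i rule: exhaust_3) simp_all
  thus ?thesis using \<sigma>'(1) unfolding realizable_def by blast
qed

lemma realizable_slanted:
  assumes w: "\<And>i. 0 < w i" and d0: "d 0 = w 2" and sl: "slanted_degrees w (d 1) (d 2)"
  shows "realizable TYPE('r::comm_ring_1) w d"
proof -
  obtain e1 e2 where e: "planar_degrees w e1 e2" "e1 \<le> w 2" "d 1 = w 2 \<or> d 1 = e1"
    "d 2 = e2 \<or> (e2 < d 2 \<and> (\<exists>i j. d 2 = nmul i e1 + nmul j (w 2)))" using sl unfolding slanted_degrees_def by blast
  obtain \<sigma> :: "3 \<Rightarrow> (3, 'r) mpol" where \<sigma>: "tame \<sigma>" "\<sigma> 2 = mvar 2" "monic_lead w e1 (\<sigma> 0)" "monic_lead w e2 (\<sigma> 1)"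
    using realize_planar[of w, OF w w e(1) tame_mvar] by (auto simp: monic_lead_mvar)
  have "\<exists>\<tau> :: 3 \<Rightarrow> (3, 'r) mpol. tame \<tau> \<and> \<tau> 2 = mvar 2 \<and> monic_lead w e1 (\<tau> 0) \<and> monic_lead w (d 2) (\<tau> 1)"
    using e(4)
  proof (elim disjE conjE exE)
    assume "d 2 = e2" thus ?thesis using \<sigma> by blast
  next
    fix i j assume *: "e2 < d 2" "d 2 = nmul i e1 + nmul j (w 2)"
    let ?m = "single 0 i + single 2 j :: 3 mon"
    let ?\<tau> = "\<sigma>(1 := \<sigma> 1 + \<sigma> 0 ^ i * \<sigma> 2 ^ j)"
    have "tame (\<sigma>(1 := \<sigma> 1 + (\<Prod>i\<in>UNIV. \<sigma> i ^ lookup ?m i)))"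
      by (rule tame_add_monomial[OF \<sigma>(1)]) (simp add: lookup_add lookup_single when_def)
    hence "tame ?\<tau>" by (simp add: prod_3 lookup_add lookup_single when_def)
    moreover have "monic_lead w (w 2) (\<sigma> 2)" by (simp add: \<sigma> monic_lead_mvar)
    hence "monic_lead w (d 2) (?\<tau> 1)"
      using * \<sigma> by (simp add: monic_lead_add[where E = e2] monic_lead_mult monic_lead_power)
    ultimately show ?thesis using \<sigma> by (intro exI[of _ ?\<tau>]) simp
  qed
  then obtain \<tau> where \<tau>: "tame \<tau>" "\<tau> 2 = (mvar 2 :: (3, 'r) mpol)" "monic_lead w e1 (\<tau> 0)" "monic_lead w (d 2) (\<tau> 1)" by blast
  have \<tau>2: "monic_lead w (w 2) (\<tau> 2)" by (simp add: \<tau> monic_lead_mvar)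
  have "\<exists>\<upsilon>. tame \<upsilon> \<and> \<upsilon> 2 = \<tau> 2 \<and> monic_lead w (d 1) (\<upsilon> 0) \<and> \<upsilon> 1 = \<tau> 1"
    using e(3)
  proof
    assume "d 1 = w 2"
    thus ?thesis using raise_degree[OF \<tau>(1) _ \<tau>(3) \<tau>2, of 1] e(2) by auto
  next
    assume "d 1 = e1" thus ?thesis using \<tau> by blast
  qed
  then obtain \<upsilon> where \<upsilon>: "tame \<upsilon>" "\<upsilon> 2 = \<tau> 2" "monic_lead w (d 1) (\<upsilon> 0)" "\<upsilon> 1 = \<tau> 1" by blast
  \<comment> \<open>So far the component with leading monomial z is the last one; it has to become the first.\<close>
  define d' where "d' = (\<lambda>i::3. if i = 0 then d 1 else if i = 1 then d 2 else d 0)"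
  have "monic_lead w (d' i) (\<upsilon> i)" for i
    using \<upsilon> \<tau> \<tau>2 d0 by (cases i rule: exhaust_3) (simp_all add: d'_def)
  hence "realizable TYPE('r) w d'" using \<upsilon>(1) unfolding realizable_def by blast
  hence "realizable TYPE('r) w (d'(0 := d' 1, 1 := d' 0))" by (rule realizable_swap)
  from realizable_swap[OF this, of 0 2]
  have "realizable TYPE('r) w ((d'(0 := d' 1, 1 := d' 0))(0 := d' 2, 2 := d' 1))" by simp
  moreover have "(d'(0 := d' 1, 1 := d' 0))(0 := d' 2, 2 := d' 1) = d"
  proof
    fix i show "((d'(0 := d' 1, 1 := d' 0))(0 := d' 2, 2 := d' 1)) i = d i"
      by (cases i rule: exhaust_3) (simp_all add: d'_def)
  qed
  ultimately show ?thesis by simp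
qed

section \<open>Renaming of variables\<close>

lemma monic_lead_rename:
  fixes p :: "('n::finite, 'r::comm_ring_1) mpol"
  assumes "monic_lead (\<lambda>i. w (\<pi> i)) D p"
  shows "monic_lead w D (subst (rename \<pi>) p)"
proof -
  let ?w = "\<lambda>i. w (\<pi> i)"
  obtain m where m: "mon_weight ?w m = D" "deg_lt ?w D (p - single m 1)" using assms by (auto simp: monic_lead_def)
  define n where "n = (\<Sum>i\<in>UNIV. single (\<pi> i) (lookup m i))"
  have s: "subst (rename \<pi>) (single m (1::'r)) = single n 1"
    by (simp add: peval_single[OF ring_morph_mconst] rename_def mvar_power prod_single n_def)
  have "mon_weight w (\<Sum>i\<in>A. single (\<pi> i) (lookup m i)) = (\<Sum>i\<in>A. nmul (lookup m i) (w (\<pi> i)))" if "finite A" for A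
    using that by (induction A rule: finite_induct) (auto simp: mon_weight_add mon_weight_single)
  hence wn: "mon_weight w n = D" using m(1) by (simp add: n_def mon_weight_nmul)
  have d: "deg_le w (?w i) (rename \<pi> i :: ('n, 'r) mpol)" for i by (simp add: rename_def deg_le_mvar)
  have "deg_le w D (subst (rename \<pi>) (p - single m 1))" by (rule deg_le_subst[OF d deg_lt_imp_deg_le[OF m(2)]])
  moreover have "hcomp w D (subst (rename \<pi>) (p - single m 1)) = 0"
    using hcomp_subst[OF d deg_lt_imp_deg_le[OF m(2)]] hcomp_deg_lt[OF m(2)] by (simp add: subst_0)
  ultimately have "deg_lt w D (subst (rename \<pi>) (p - single m 1))"
    using deg_lt_diff_hcomp by fastforce
  hence "deg_lt w D (subst (rename \<pi>) p - single n 1)" by (simp add: subst_simps s)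
  thus ?thesis using wn unfolding monic_lead_def by blast
qed

lemma tame_rename_swap:
  fixes j k :: 3
  shows "tame (rename (id(j := k, k := j)) :: 3 \<Rightarrow> (3, 'r::comm_ring_1) mpol)"
proof (cases "j = k")
  case True
  hence "rename (id(j := k, k := j)) = (mvar :: 3 \<Rightarrow> (3, 'r) mpol)" by (auto simp: rename_def)
  thus ?thesis by (simp add: tame_mvar)
next
  case False
  have "rename (id(j := k, k := j)) = (mvar(j := mvar k, k := mvar j) :: 3 \<Rightarrow> (3, 'r) mpol)"
    by (auto simp: rename_def)
  thus ?thesis using tame_swap[OF tame_mvar False] by simp
qed

lemma realizable_rename:
  assumes "realizable TYPE('r::comm_ring_1) (\<lambda>i. w ((id(j := k, k := j)) i)) d"
  shows "realizable TYPE('r) w d"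
proof -
  obtain \<sigma> :: "3 \<Rightarrow> (3, 'r) mpol" where \<sigma>: "tame \<sigma>" "\<And>i. monic_lead (\<lambda>i. w ((id(j := k, k := j)) i)) (d i) (\<sigma> i)"
    using assms by (auto simp: realizable_def)
  have "monic_lead w (d i) (subst (rename (id(j := k, k := j))) (\<sigma> i))" for i by (rule monic_lead_rename[of w "id(j := k, k := j)", OF \<sigma>(2)])
  thus ?thesis unfolding realizable_def using tame_comp[OF tame_rename_swap \<sigma>(1)] by blast
qed

section \<open>Extension of coefficients and conclusion\<close>

text \<open>Extension of coefficients along an injective morphism keeps supports, hence weighted degrees.\<close>

lemma lookup_coefficient_map:
  assumes "ring_morph \<iota>"
  shows "lookup (peval (\<lambda>c. mconst (\<iota> c)) mvar p) m = \<iota> (lookup p m)"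
proof -
  have h: "ring_morph (\<lambda>c. mconst (\<iota> c))" by (rule ring_morph_comp[OF ring_morph_mconst assms])
  have s: "peval (\<lambda>c. mconst (\<iota> c)) mvar (single n c) = single n (\<iota> c)" for n c
    by (simp add: peval_single[OF h] flip: single_expand)
  have "peval (\<lambda>c. mconst (\<iota> c)) mvar p = (\<Sum>n\<in>keys p. single n (\<iota> (lookup p n)))"
    by (subst mpol_expand[of p]) (simp add: peval_sum[OF h] s)
  thus ?thesis by (auto simp: lookup_sum lookup_single when_def in_keys_iff ring_morph_0[OF assms])
qed

lemma extend_coefficients:
  fixes \<sigma> \<rho> :: "'n::finite \<Rightarrow> ('n, 'r::comm_ring_1) mpol" and \<iota> :: "'r \<Rightarrow> 's::comm_ring_1"
  assumes \<iota>: "ring_morph \<iota>" "inj \<iota>" and inv: "inverse_tuples \<sigma> \<rho>"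
  obtains \<sigma>' \<rho>' :: "'n \<Rightarrow> ('n, 's) mpol" where "inverse_tuples \<sigma>' \<rho>'" "\<And>i. keys (\<sigma>' i) = keys (\<sigma> i)"
proof -
  let ?c = "peval (\<lambda>c. mconst (\<iota> c)) mvar :: ('n, 'r) mpol \<Rightarrow> ('n, 's) mpol"
  have h: "ring_morph (\<lambda>c. mconst (\<iota> c) :: ('n, 's) mpol)" by (rule ring_morph_comp[OF ring_morph_mconst \<iota>(1)])
  have cs: "?c (subst \<tau> p) = subst (\<lambda>i. ?c (\<tau> i)) (?c p)" for \<tau> p
  proof (rule ring_morph_mpol_ext[where F = "\<lambda>p. ?c (subst \<tau> p)" and G = "\<lambda>p. subst (\<lambda>i. ?c (\<tau> i)) (?c p)"])
    show "ring_morph (\<lambda>p. ?c (subst \<tau> p))"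
      by (rule ring_morph_comp[OF ring_morph_peval[OF h] ring_morph_subst])
    show "ring_morph (\<lambda>p. subst (\<lambda>i. ?c (\<tau> i)) (?c p))"
      by (rule ring_morph_comp[OF ring_morph_subst ring_morph_peval[OF h]])
    show "?c (subst \<tau> (mconst x)) = subst (\<lambda>i. ?c (\<tau> i)) (?c (mconst x))" for x
      by (simp add: subst_simps peval_mconst[OF h])
    show "?c (subst \<tau> (mvar i)) = subst (\<lambda>i. ?c (\<tau> i)) (?c (mvar i))" for i
      by (simp add: subst_simps peval_mvar[OF h])
  qed
  have "inverse_tuples (\<lambda>i. ?c (\<sigma> i)) (\<lambda>i. ?c (\<rho> i))"
    using inv by (simp add: inverse_tuples_def cs[symmetric] peval_mvar[OF h])
  moreover have "keys (?c (\<sigma> i)) = keys (\<sigma> i)" for i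
  proof -
    have z: "\<iota> x = 0 \<longleftrightarrow> x = 0" for x using \<iota> by (metis injD ring_morph_0)
    show ?thesis
      by (rule Set.set_eqI) (simp only: in_keys_iff lookup_coefficient_map[OF \<iota>(1)] z)
  qed
  ultimately show thesis by (rule that)
qed

lemma poly_aut_tuples:
  assumes "F \<in> poly_auts"
  obtains \<rho> where "inverse_tuples (\<lambda>i. F (mvar i)) \<rho>"
proof -
  let ?G = "inv_into UNIV F"
  have b: "bij F" using assms by (simp add: poly_auts_def)
  note F = poly_auts_ring_morph[OF assms]
  have FG: "F (?G p) = p" "?G (F p) = p" for p using b by (simp_all add: bij_is_surj surj_f_inv_f bij_is_inj)
  have G: "ring_morph ?G" by (rule ring_morph_inv_into[OF b F(1)])
  have Gc: "?G (mconst c) = mconst c" for c by (metis F(2) FG(2))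
  have "inverse_tuples (\<lambda>i. F (mvar i)) (\<lambda>i. ?G (mvar i))"
    unfolding inverse_tuples_def
    by (simp add: morph_eq_subst[OF F, symmetric] morph_eq_subst[OF G Gc, symmetric] FG)
  thus thesis by (rule that)
qed

lemma automorphism_degrees_realizable:
  fixes \<sigma> \<rho> :: "3 \<Rightarrow> (3, 'k::alg_closed_field) mpol" and w :: "3 \<Rightarrow> 'g::linordered_ab_group_add"
  assumes inv: "inverse_tuples \<sigma> \<rho>" and w: "\<And>i. 0 < w i"
    and d: "wdeg w (\<sigma> 0) \<le> w 2" "wdeg w (\<sigma> 1) \<le> w 2"
  shows "realizable TYPE('r::comm_ring_1) w (\<lambda>i. wdeg w (\<sigma> i))"
proof (cases "xy_poly (\<sigma> 0)")
  case True
  show ?thesis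
  proof (cases "xy_poly (\<sigma> 1)")
    case t: True
    show ?thesis by (rule realizable_triangular[OF w triangular_case[OF inv w True t]])
  next
    case False
    define s where "s = (\<lambda>i. subst \<sigma> (rename (id(0 := 1, 1 := 0)) i))"
    have s: "s 0 = \<sigma> 1" "s 1 = \<sigma> 0" "s 2 = \<sigma> 2" by (simp_all add: s_def rename_def subst_simps)
    have "inverse_tuples (rename (id(0 := 1, 1 := 0))) (rename (id(0 := 1, 1 := 0 :: 3)) :: 3 \<Rightarrow> (3, 'k) mpol)"
      by (rule inverse_tuples_rename) simp
    from inverse_tuples_compose[OF inverse_tuples_sym[OF inv] this]
    obtain s' where s': "inverse_tuples s s'" unfolding s_def by blast
    let ?d = "\<lambda>i. wdeg w (s i)"
    have "realizable TYPE('r) w ?d"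
      by (rule realizable_slanted[of w, OF w]) (use slanted_case[OF s' w] d False s in simp_all)
    hence "realizable TYPE('r) w (?d(0 := ?d 1, 1 := ?d 0))" by (rule realizable_swap)
    moreover have "?d(0 := ?d 1, 1 := ?d 0) = (\<lambda>i. wdeg w (\<sigma> i))"
    proof
      fix i show "(?d(0 := ?d 1, 1 := ?d 0)) i = wdeg w (\<sigma> i)" by (cases i rule: exhaust_3) (simp_all add: s)
    qed
    ultimately show ?thesis by simp
  qed
next
  case False
  show ?thesis by (rule realizable_slanted[of w, OF w]) (use slanted_case[OF inv w d False] in simp_all)
qed

theorem theorem1p6:
  fixes w d :: "3 \<Rightarrow> 'g::linordered_ab_group_add"
  assumes "\<forall>i. w i > 0"
    and "d \<in> mdeg w ` (poly_auts :: ((3, 'k::idom) mpol \<Rightarrow> (3, 'k) mpol) set)"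
    and "card {i. d i \<le> Max (range w)} \<ge> 2"
  shows "d \<in> mdeg w ` (elem_auts_w w :: ((3, 'r::comm_ring_1) mpol \<Rightarrow> (3, 'r) mpol) set)"
proof -
  obtain F :: "(3, 'k) mpol \<Rightarrow> (3, 'k) mpol" where F: "F \<in> poly_auts" "d = mdeg w F" using assms(2) by blast
  obtain \<rho>0 where inv0: "inverse_tuples (\<lambda>i. F (mvar i)) \<rho>0" using poly_aut_tuples[OF F(1)] .
  \<comment> \<open>Fractions turn the domain into a field, which is then embedded in its algebraic closure.\<close>
  define \<iota> :: "'k \<Rightarrow> 'k fract alg_closure" where "\<iota> c = to_ac (Fract c 1)" for c
  have "ring_morph \<iota>" by (rule ring_morphI) (simp_all add: \<iota>_def flip: One_fract_def to_ac_add to_ac_mult)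
  moreover have "inj \<iota>" by (rule injI) (simp add: \<iota>_def eq_fract)
  ultimately obtain \<sigma> \<rho> :: "3 \<Rightarrow> (3, 'k fract alg_closure) mpol" where inv: "inverse_tuples \<sigma> \<rho>"
    and keys: "\<And>i. keys (\<sigma> i) = keys (F (mvar i))" using extend_coefficients[OF _ _ inv0] by blast
  have d: "d i = wdeg w (\<sigma> i)" for i by (simp add: F(2) mdeg_def wdeg_def keys)
  have "Max (range w) \<in> range w" by (rule Max_in) simp_all
  then obtain M where M: "w M = Max (range w)" by (metis rangeE)
  obtain l where l: "\<And>i. i \<noteq> l \<Longrightarrow> d i \<le> w M"
  proof -
    let ?S = "- {i. d i \<le> w M}"
    have "card ?S \<le> Suc 0"
      using assms(3) by (simp add: M Compl_eq_Diff_UNIV card_Diff_subset)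
    hence eq: "x = y" if "x \<in> ?S" "y \<in> ?S" for x y using that by (metis card_le_Suc0_iff_eq finite)
    show thesis
    proof (cases "?S = {}")
      case True
      thus thesis using that[of 0] by blast
    next
      case False
      then obtain l where "l \<in> ?S" by blast
      thus thesis using that[of l] eq by blast
    qed
  qed
  let ?\<pi> = "id(M := 2, 2 := M) :: 3 \<Rightarrow> 3" and ?\<mu> = "id(l := 2, 2 := l) :: 3 \<Rightarrow> 3"
  \<comment> \<open>Exchange variables so that z has the largest weight, and components so that the first two have small degree.\<close>
  define v where "v = (\<lambda>i. w (?\<pi> i))"
  have vpos: "0 < v i" for i using assms(1) by (simp add: v_def)
  have v2: "v 2 = w M" by (simp add: v_def)
  have \<pi>\<pi>: "?\<pi> (?\<pi> i) = i" for i by simp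
  have \<mu>\<mu>: "?\<mu> (?\<mu> i) = i" for i by simp
  have inv\<pi>: "inverse_tuples (rename ?\<pi>) (rename ?\<pi> :: 3 \<Rightarrow> (3, 'k fract alg_closure) mpol)"
    by (rule inverse_tuples_rename[OF \<pi>\<pi>])
  have inv\<mu>: "inverse_tuples (rename ?\<mu>) (rename ?\<mu> :: 3 \<Rightarrow> (3, 'k fract alg_closure) mpol)"
    by (rule inverse_tuples_rename[OF \<mu>\<mu>])
  define \<tau> where "\<tau> = (\<lambda>i. subst (rename ?\<pi>) (subst \<sigma> (rename ?\<mu> i)))"
  obtain \<tau>' where \<tau>': "inverse_tuples \<tau> \<tau>'"
    using inverse_tuples_compose[OF inv\<pi> inverse_tuples_compose[OF inverse_tuples_sym[OF inv] inv\<mu>]] unfolding \<tau>_def by blast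
  have \<tau>d: "wdeg v (\<tau> i) = d (?\<mu> i)" for i
  proof -
    have "\<tau> i = subst (rename ?\<pi>) (\<sigma> (?\<mu> i))" by (simp add: \<tau>_def rename_def subst_simps)
    moreover have "wdeg v (subst (rename ?\<pi>) (\<sigma> (?\<mu> i))) = wdeg w (\<sigma> (?\<mu> i))"
    proof (rule wdeg_subst_eq[OF inv\<pi>])
      show "deg_le v (w j) (rename ?\<pi> j :: (3, 'k fract alg_closure) mpol)" for j
        using deg_le_mvar[of v "?\<pi> j"] unfolding rename_def v_def \<pi>\<pi> .
      show "deg_le w (v j) (rename ?\<pi> j :: (3, 'k fract alg_closure) mpol)" for j
        using deg_le_mvar[of w "?\<pi> j"] unfolding rename_def v_def .
      show "\<sigma> (?\<mu> i) \<noteq> 0" using inverse_tuples_not_const[OF inv, of _ 0] by simp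
    qed
    ultimately show ?thesis by (simp only: d)
  qed
  have "wdeg v (\<tau> 0) \<le> v 2" unfolding \<tau>d v2 by (rule l) auto
  moreover have "wdeg v (\<tau> 1) \<le> v 2" unfolding \<tau>d v2 by (rule l) auto
  ultimately have "realizable TYPE('r) v (\<lambda>i. wdeg v (\<tau> i))" by (rule automorphism_degrees_realizable[of _ _ v, OF \<tau>' vpos])
  hence "realizable TYPE('r) v (\<lambda>i. d (?\<mu> i))" by (simp only: \<tau>d)
  hence "realizable TYPE('r) w (\<lambda>i. d (?\<mu> i))" unfolding v_def by (rule realizable_rename)
  from realizable_swap[OF this, of l 2]
  have "realizable TYPE('r) w ((\<lambda>i. d (?\<mu> i))(l := d (?\<mu> 2), 2 := d (?\<mu> l)))" .
  moreover have "(\<lambda>i. d (?\<mu> i))(l := d (?\<mu> 2), 2 := d (?\<mu> l)) = d"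
    by (rule ext) auto
  ultimately have "realizable TYPE('r) w d" by (simp only:)
  then obtain s :: "3 \<Rightarrow> (3, 'r) mpol" where s: "tame s" "\<And>i. monic_lead w (d i) (s i)" by (auto simp: realizable_def)
  obtain G where G: "G \<in> elem_auts" "\<And>i. G (mvar i) = s i" using s(1) by (auto simp: tame_def)
  have "G \<in> poly_auts" using G elem_auts_subset by blast
  hence "G \<in> elem_auts_w w"
    using G monic_lead_wdeg(2)[OF s(2)] by (simp add: elem_auts_w_def poly_auts_w_def)
  moreover have "d = mdeg w G" using monic_lead_wdeg(1)[OF s(2)] by (auto simp: mdeg_def G)
  ultimately show ?thesis by blast
qed

end
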